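(* Let $H_3$ be the 3-dimensional Heisenberg group, realized as $\mathbb R^3$ with multiplication $$(x^1,x^2,x^3)\cdot(y^1,y^2,y^3)=(x^1+y^1,\;x^2+y^2+x^1y^3,\;x^3+y^3),$$ equipped with the singular (non $y$-global) left-invariant Berwald--Moór Finsler metric $$\mathcal F(x,y)=\big(y^1\,(y^2-x^1y^3)\,y^3\big)^{2/3},\qquad x\in H_3,\ y=(y^1,y^2,y^3)\in T_xH_3 .$$ Then the holonomy group of the Finsler manifold $(H_3,\mathcal F)$ has an infinite dimensional tangent Lie algebra; that is, for $x\in H_3$ there is an infinite-dimensional Lie subalgebra of the Lie algebra of smooth vector fields on the indicatrix $\mathfrak I_xH_3$ which is tangent to $\mathsf{Hol}(x)$.
   Context: A singular (non $y$-global) Finsler space is a manifold with a metric function $\mathcal F$, positively homogeneous of degree two in $y$, required to be smooth (with non-degenerate $g_{ij}$) only on an open cone bundle $\mathcal CM=\bigcup_x\mathcal C_xM\subset TM\setminus\{0\}$, each $\mathcal C_xM$ being an open cone in $T_xM\setminus\{0\}$; here $\mathcal C_xH_3$ is the cone where $y^1(y^2-x^1y^3)y^3\neq0$. All objects below are considered on this cone. Put $g_{ij}(x,y)=\frac12\frac{\partial^2\mathcal F}{\partial y^i\partial y^j}$, $G^i(x,y)=\frac14 g^{il}\big(2\frac{\partial g_{jl}}{\partial x^k}-\frac{\partial g_{jk}}{\partial x^l}\big)y^jy^k$, $\Gamma^i_j=\frac{\partial G^i}{\partial y^j}$. A vector field $X(t)=X^i(t)\frac{\partial}{\partial x^i}$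 along a curve $c(t)$ is parallel if $\frac{dX^i}{dt}+\Gamma^i_j(c(t),X(t))\dot c^j(t)=0$; parallel vector fields along $c\colon[0,1]\to M$ define the (nonlinear) parallel translation $\tau_c$ from $c(0)$ to $c(1)$, which preserves $\mathcal F$ and induces a map between the indicatrices $\mathfrak I_xM=\{y:\mathcal F(x,y)=\pm1\}$ at $x=c(0)$ and $x=c(1)$. The holonomy group $\mathsf{Hol}(x)$ is the subgroup of $\mathsf{Diff}(\mathfrak I_xM)$ consisting of the parallel translations of $\mathfrak I_xM$ along piecewise differentiable closed curves starting at $x$. Tangency. Let $H$ be a subgroup of the diffeomorphism group of a manifold $N$. A smooth vector field $X$ on $N$ is tangent to $H$ if there is a $\mathcal C^1$-differentiable 1-parameter family $\{\phi_t\in H\}_{t\in(-\varepsilon,\varepsilon)}$ of diffeomorphisms of $N$ with $\phi_0=\mathsf{Id}$ and $\frac{\partial\phi_t}{\partial t}\big|_{t=0}=X$. A Lie subalgebra of the Lie algebra of smooth vector fields on $N$ is tangent to $H$ if all its elements are tangent to $H$. *)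

theory Defs
  imports
    "HOL-Analysis.Analysis"
    "HOL-Library.FuncSet"
    "HOL-Library.Extended_Nat"
    "HOL-Library.Function_Algebras"
begin

section \<open>Maps of class \<open>C\<^sup>k\<close>\<close>

primrec Ck_open :: "nat \<Rightarrow> 'a::euclidean_space set \<Rightarrow> ('a \<Rightarrow> 'b::euclidean_space) \<Rightarrow> bool" where
  "Ck_open 0 U f \<longleftrightarrow> continuous_on U f"
| "Ck_open (Suc k) U f \<longleftrightarrow>
     (\<forall>x\<in>U. f differentiable (at x)) \<and> (\<forall>v. Ck_open k U (\<lambda>x. frechet_derivative f (at x) v))"

text \<open>On an arbitrary subset \<open>N\<close> of a Euclidean space, a map is of class \<open>C\<^sup>k\<close> if near every point
  of \<open>N\<close> it extends to a \<open>C\<^sup>k\<close> map on an open set. For an embedded submanifold \<open>N\<close> this is the usual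
  notion. The value \<open>k = \<infinity>\<close> means smooth.\<close>

definition Ck_on :: "enat \<Rightarrow> 'a::euclidean_space set \<Rightarrow> ('a \<Rightarrow> 'b::euclidean_space) \<Rightarrow> bool" where
  "Ck_on k N f \<longleftrightarrow>
     (\<forall>p\<in>N. \<exists>U g. open U \<and> p \<in> U \<and> (\<forall>j. enat j \<le> k \<longrightarrow> Ck_open j U g) \<and> (\<forall>q\<in>N \<inter> U. f q = g q))"

abbreviation smooth_on :: "'a::euclidean_space set \<Rightarrow> ('a \<Rightarrow> 'b::euclidean_space) \<Rightarrow> bool" where
  "smooth_on \<equiv> Ck_on \<infinity>"

section \<open>Diffeomorphisms and vector fields of submanifolds of Euclidean space\<close>

definition Diff :: "'a::euclidean_space set \<Rightarrow> ('a \<Rightarrow> 'a) set" where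
  "Diff N = {\<phi> \<in> extensional N. bij_betw \<phi> N N \<and> smooth_on N \<phi> \<and> smooth_on N (inv_into N \<phi>)}"

definition tangent_space :: "'a::euclidean_space set \<Rightarrow> 'a \<Rightarrow> 'a set" where
  "tangent_space N p =
     {v. \<exists>\<delta>>0. \<exists>\<gamma>. smooth_on {-\<delta><..<\<delta>} \<gamma> \<and> \<gamma> ` {-\<delta><..<\<delta>} \<subseteq> N \<and> \<gamma> 0 = p \<and>
            (\<gamma> has_vector_derivative v) (at (0::real))}"

text \<open>Vector fields are normalised to be \<open>0\<close> outside \<open>N\<close>, so that equality and linear dependence of
  functions is equality and linear dependence of vector fields on \<open>N\<close>.\<close>

definition vector_fields :: "'a::euclidean_space set \<Rightarrow> ('a \<Rightarrow> 'a) set" where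
  "vector_fields N =
     {X. smooth_on N X \<and> (\<forall>p\<in>N. X p \<in> tangent_space N p) \<and> (\<forall>p. p \<notin> N \<longrightarrow> X p = 0)}"

text \<open>A derivative within \<open>N\<close> is in general not unique, but its values on vectors tangent to \<open>N\<close> are.
  Hence the next expression is well defined for vector fields on a submanifold \<open>N\<close>; it is the
  difference of the directional derivatives of \<open>Y\<close> along \<open>X\<close> and of \<open>X\<close> along \<open>Y\<close>, i.e. the Lie
  bracket \<open>[X, Y]\<close>.\<close>

definition lie_bracket :: "'a::euclidean_space set \<Rightarrow> ('a \<Rightarrow> 'a) \<Rightarrow> ('a \<Rightarrow> 'a) \<Rightarrow> 'a \<Rightarrow> 'a" where
  "lie_bracket N X Y = (\<lambda>p. if p \<in> N
     then frechet_derivative Y (at p within N) (X p) - frechet_derivative X (at p within N) (Y p)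
     else 0)"

interpretation vf: vector_space "\<lambda>(c::real) (X::'a \<Rightarrow> 'b::real_vector) p. c *\<^sub>R X p"
  by unfold_locales (auto simp: fun_eq_iff scaleR_right_distrib scaleR_left_distrib)

definition lie_subalgebra :: "'a::euclidean_space set \<Rightarrow> ('a \<Rightarrow> 'a) set \<Rightarrow> bool" where
  "lie_subalgebra N L \<longleftrightarrow>
     L \<subseteq> vector_fields N \<and> vf.subspace L \<and> (\<forall>X\<in>L. \<forall>Y\<in>L. lie_bracket N X Y \<in> L)"

definition infinite_dimensional :: "('a \<Rightarrow> 'b::real_vector) set \<Rightarrow> bool" where
  "infinite_dimensional L \<longleftrightarrow> \<not> (\<exists>B. finite B \<and> B \<subseteq> L \<and> L \<subseteq> vf.span B)"

text \<open>A \<open>C\<^sup>1\<close>-differentiable family is one that is \<open>C\<^sup>1\<close> jointly in the parameter and the point.\<close>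

definition tangent_to ::
  "'a::euclidean_space set \<Rightarrow> ('a \<Rightarrow> 'a) set \<Rightarrow> ('a \<Rightarrow> 'a) \<Rightarrow> bool" where
  "tangent_to N H X \<longleftrightarrow>
     (\<exists>\<epsilon>>0. \<exists>\<phi> :: real \<Rightarrow> 'a \<Rightarrow> 'a.
        (\<forall>t\<in>{-\<epsilon><..<\<epsilon>}. \<phi> t \<in> H) \<and>
        Ck_on 1 ({-\<epsilon><..<\<epsilon>} \<times> N) (\<lambda>(t, p). \<phi> t p) \<and>
        (\<forall>p\<in>N. \<phi> 0 p = p) \<and>
        (\<forall>p\<in>N. ((\<lambda>t. \<phi> t p) has_vector_derivative X p) (at 0)))"

section \<open>Singular Finsler metrics on \<open>\<real>\<^sup>n\<close>\<close>

definition partial :: "'n::finite \<Rightarrow> (real^'n \<Rightarrow> real) \<Rightarrow> real^'n \<Rightarrow> real" where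
  "partial i f x = deriv (\<lambda>s. f (x + s *\<^sub>R axis i 1)) 0"

text \<open>In the following, \<open>F x y\<close> is the metric function and \<open>C x\<close> is the cone of admissible tangent
  vectors \<open>y\<close> at \<open>x\<close>.\<close>

definition metric_tensor :: "(real^'n \<Rightarrow> real^'n \<Rightarrow> real) \<Rightarrow> real^'n \<Rightarrow> real^'n \<Rightarrow> real^'n^'n" where
  "metric_tensor F x y = (\<chi> i j. (1/2) * partial i (partial j (F x)) y)"

definition spray_coeff :: "(real^'n \<Rightarrow> real^'n \<Rightarrow> real) \<Rightarrow> real^'n \<Rightarrow> real^'n \<Rightarrow> real^'n" where
  "spray_coeff F x y = (\<chi> i. (1/4) * (\<Sum>l\<in>UNIV. \<Sum>j\<in>UNIV. \<Sum>k\<in>UNIV.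
      matrix_inv (metric_tensor F x y) $ i $ l *
      (2 * partial k (\<lambda>z. metric_tensor F z y $ j $ l) x
         - partial l (\<lambda>z. metric_tensor F z y $ j $ k) x) * y $ j * y $ k))"

definition connection_coeff :: "(real^'n \<Rightarrow> real^'n \<Rightarrow> real) \<Rightarrow> real^'n \<Rightarrow> real^'n \<Rightarrow> real^'n^'n" where
  "connection_coeff F x y = (\<chi> i j. partial j (\<lambda>z. spray_coeff F x z $ i) y)"

definition indicatrix ::
  "(real^'n \<Rightarrow> (real^'n) set) \<Rightarrow> (real^'n \<Rightarrow> real^'n \<Rightarrow> real) \<Rightarrow> real^'n \<Rightarrow> (real^'n) set" where
  "indicatrix C F x = {y \<in> C x. F x y = 1 \<or> F x y = -1}"

text \<open>Piecewise \<open>C\<^sup>1\<close> in the strict sense: \<open>C\<^sup>1\<close> up to the end points on each closed subinterval of a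
  partition. The constant \<^const>\<open>piecewise_C1_differentiable_on\<close> would allow unbounded derivatives
  near the break points.\<close>

definition piecewise_C1_curve :: "(real \<Rightarrow> 'a::real_normed_vector) \<Rightarrow> bool" where
  "piecewise_C1_curve c \<longleftrightarrow>
     (\<exists>n (\<tau> :: nat \<Rightarrow> real). \<tau> 0 = 0 \<and> \<tau> n = 1 \<and>
        (\<forall>i<n. \<tau> i < \<tau> (Suc i) \<and>
           (\<exists>g. g C1_differentiable_on {\<tau> i..\<tau> (Suc i)} \<and> (\<forall>t\<in>{\<tau> i..\<tau> (Suc i)}. c t = g t))))"

definition parallel_along ::
  "(real^'n \<Rightarrow> (real^'n) set) \<Rightarrow> (real^'n \<Rightarrow> real^'n \<Rightarrow> real) \<Rightarrow>
   (real \<Rightarrow> real^'n) \<Rightarrow> (real \<Rightarrow> real^'n) \<Rightarrow> bool" where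
  "parallel_along C F c X \<longleftrightarrow>
     continuous_on {0..1} X \<and> (\<forall>t\<in>{0..1}. X t \<in> C (c t)) \<and>
     (\<exists>S. finite S \<and> (\<forall>t\<in>{0<..<1} - S. c differentiable (at t) \<and>
        (X has_vector_derivative
           - (connection_coeff F (c t) (X t) *v vector_derivative c (at t))) (at t)))"

text \<open>The parallel transport equation is nonlinear, so parallel translation along a given loop need
  not be defined on the whole indicatrix. Only loops for which it is contribute to the holonomy group.\<close>

definition holonomy ::
  "(real^'n \<Rightarrow> (real^'n) set) \<Rightarrow> (real^'n \<Rightarrow> real^'n \<Rightarrow> real) \<Rightarrow> real^'n \<Rightarrow> (real^'n \<Rightarrow> real^'n) set" where
  "holonomy C F x =
     {\<phi> \<in> Diff (indicatrix C F x).
        \<exists>c. piecewise_C1_curve c \<and> c 0 = x \<and> c 1 = x \<and>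
            (\<forall>v\<in>indicatrix C F x. \<exists>X. parallel_along C F c X \<and> X 0 = v \<and> X 1 = \<phi> v)}"

section \<open>The Berwald--Moor metric on the Heisenberg group\<close>

definition heis_mult :: "real^3 \<Rightarrow> real^3 \<Rightarrow> real^3" where
  "heis_mult x y = vector [x$1 + y$1, x$2 + y$2 + x$1 * y$3, x$3 + y$3]"

definition heis_cone :: "real^3 \<Rightarrow> (real^3) set" where
  "heis_cone x = {y. y$1 * (y$2 - x$1 * y$3) * y$3 \<noteq> 0}"

text \<open>The argument of the power \<open>2/3\<close> takes both signs on the cone; the power is the square of the
  real cube root, not \<open>powr\<close>.\<close>

definition berwald_moor :: "real^3 \<Rightarrow> real^3 \<Rightarrow> real" where
  "berwald_moor x y = (root 3 (y$1 * (y$2 - x$1 * y$3) * y$3))\<^sup>2"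

lemma heis_mult_has_derivative:
  "(heis_mult a has_derivative (\<lambda>y. vector [y$1, y$2 + a$1 * y$3, y$3])) (at x)"
proof -
  define D where "D = (\<lambda>y::real^3. vector [y$1, y$2 + a$1 * y$3, y$3] :: real^3)"
  have "linear D"
    unfolding D_def
    by (rule linearI) (auto simp: vec_eq_iff forall_3 algebra_simps)
  then have "bounded_linear D"
    by (simp add: linear_conv_bounded_linear)
  moreover have "heis_mult a = (\<lambda>x. a + D x)"
    by (auto simp: heis_mult_def D_def vec_eq_iff forall_3 fun_eq_iff)
  ultimately have "(heis_mult a has_derivative D) (at x)"
    using has_derivative_add[OF has_derivative_const bounded_linear_imp_has_derivative] by fastforce
  then show ?thesis by (simp add: D_def)
qed

lemma berwald_moor_left_invariant:
  "berwald_moor (heis_mult a x) (frechet_derivative (heis_mult a) (at x) y) = berwald_moor x y"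
  by (simp add: frechet_derivative_at[OF heis_mult_has_derivative, symmetric]
      berwald_moor_def heis_mult_def algebra_simps)

end

theory Submission
  imports Defs
begin

text \<open>
  Write \<open>u = (y\<^sup>1, y\<^sup>2 - x\<^sup>1 y\<^sup>3, y\<^sup>3)\<close> for the components of a tangent vector in the left-invariant frame
  \<open>E\<^sub>1 = \<partial>\<^sub>1\<close>, \<open>E\<^sub>2 = \<partial>\<^sub>2\<close>, \<open>E\<^sub>3 = \<partial>\<^sub>3 + x\<^sup>1 \<partial>\<^sub>2\<close>. In these components the metric function is \<open>(u\<^sub>1 u\<^sub>2 u\<^sub>3)\<^sup>2\<^sup>/\<^sup>3\<close>
  and parallel translation does not depend on the base point. With \<open>p = u\<^sub>1/u\<^sub>2\<close> and \<open>q = u\<^sub>3/u\<^sub>2\<close>, translation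
  along an integral curve of \<open>E\<^sub>1\<close>, \<open>E\<^sub>2\<close> or \<open>E\<^sub>3\<close> multiplies each \<open>u\<^sub>k\<close> by the exponential of time times a
  constant multiple of \<open>q\<close>, \<open>pq\<close> or \<open>p\<close> respectively, and that function is constant along the translation
  (\<open>connection_coeff_frame\<close>, \<open>parallel_along_frame_segment\<close>). Hence these translations are defined for all
  times on the whole cone, and each word in them whose base curve closes up is an element of the
  holonomy group (\<open>word_map_in_holonomy\<close>).

  In the coordinates \<open>log \<bar>p\<bar>\<close>, \<open>log \<bar>q\<bar>\<close> the three translations are Hamiltonian flows with Hamiltonians
  proportional to \<open>q\<close>, \<open>pq\<close> and \<open>p\<close>. Conjugating the third by the second for a fixed time \<open>\<tau>\<close> gives a flow with
  Hamiltonian proportional to \<open>p exp (\<tau> pq / 2)\<close>. Its Poisson bracket with \<open>q\<close> is a function of \<open>pq\<close> alone.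
  Accordingly, the group commutator of this flow at time \<open>t\<close> with the translation along \<open>E\<^sub>1\<close> for time \<open>s\<close>
  has a mixed derivative at \<open>s = t = 0\<close> of the form \<open>f(pq) (u\<^sub>1 \<partial>\<^sub>1 - u\<^sub>3 \<partial>\<^sub>3)\<close>. The commutator does not close up
  in the Heisenberg group, but its defect lies in the centre, and a final translation along \<open>E\<^sub>2\<close> for
  time \<open>st\<close> repairs it, changing \<open>f\<close> only by a linear term (\<open>commutator_word_second_derivative\<close>).

  A mixed derivative of a two-parameter family that is trivial when either parameter vanishes becomes
  the velocity of a one-parameter family by substituting \<open>s = \<plusminus> \<surd>\<bar>r\<bar>\<close>, \<open>t = \<surd>\<bar>r\<bar>\<close>; this family is
  still of class \<open>C\<^sup>1\<close> (\<open>square_root_reparametrisation\<close>), which is all that tangency demands.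

  Fields of the form \<open>f(pq) (u\<^sub>1 \<partial>\<^sub>1 - u\<^sub>3 \<partial>\<^sub>3)\<close> commute with each other, because \<open>pq\<close> is constant along each of them.
  Those that are velocities of holonomy families therefore form an abelian Lie algebra. It contains
  one field for each \<open>\<tau>\<close>; for \<open>\<tau> > 0\<close> its factor \<open>f\<close> grows like \<open>(pq)\<^sup>3 exp (\<tau> pq / 2)\<close>; different growth rates make
  these fields linearly independent, so the algebra has infinite dimension.
\<close>

section \<open>Calculus of maps of class \<open>C\<^sup>k\<close>\<close>

lemma Ck_open_cong:
  assumes "open U" "\<And>x. x \<in> U \<Longrightarrow> f x = g x" "Ck_open k U f"
  shows "Ck_open k U g"
  using assms(2,3)
proof (induction k arbitrary: f g)
  case 0
  then show ?case by (simp cong: continuous_on_cong)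
next
  case (Suc k)
  have D: "(g has_derivative frechet_derivative f (at x)) (at x)" if "x \<in> U" for x
    using Suc.prems that assms(1)
    by (auto intro!: has_derivative_transform_within_open[of f _ x UNIV U g] simp: frechet_derivative_works)
  have "frechet_derivative g (at x) = frechet_derivative f (at x)" if "x \<in> U" for x
    using frechet_derivative_at[OF D[OF that]] by simp
  then have "Ck_open k U (\<lambda>x. frechet_derivative g (at x) v)" for v
    using Suc.IH[of "\<lambda>x. frechet_derivative f (at x) v" "\<lambda>x. frechet_derivative g (at x) v"] Suc.prems by auto
  then show ?case using D by (auto simp: differentiable_def)
qed

text \<open>On an open set derivatives are unique, so any known derivative can take the place of
  \<open>frechet_derivative\<close> in the recursive definition.\<close>
lemma Ck_open_SucI:
  assumes "open U" "\<And>x. x \<in> U \<Longrightarrow> (f has_derivative D x) (at x)" "\<And>v. Ck_open k U (\<lambda>x. D x v)"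
  shows "Ck_open (Suc k) U f"
proof -
  have "D x = frechet_derivative f (at x)" if "x \<in> U" for x
    using frechet_derivative_at[OF assms(2)[OF that]] .
  then have "Ck_open k U (\<lambda>x. frechet_derivative f (at x) v)" for v
    by (intro Ck_open_cong[OF assms(1) _ assms(3)[of v]]) simp
  then show ?thesis using assms(2) by (auto simp: differentiable_def)
qed

lemma Ck_open_lower: "Ck_open (Suc k) U f \<Longrightarrow> Ck_open k U f"
proof (induction k arbitrary: f)
  case 0
  then show ?case
    by (auto intro!: continuous_at_imp_continuous_on differentiable_imp_continuous_within)
next
  case (Suc k)
  then show ?case by auto
qed

lemma Ck_open_mono: "Ck_open k U f \<Longrightarrow> j \<le> k \<Longrightarrow> Ck_open j U f"
  by (induction k) (auto simp del: Ck_open.simps simp: le_Suc_eq dest: Ck_open_lower)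

lemma Ck_open_imp_continuous_on: "Ck_open k U f \<Longrightarrow> continuous_on U f"
  by (drule Ck_open_mono[of k U f 0]) auto

lemma Ck_open_Suc_has_derivative:
  "Ck_open (Suc k) U f \<Longrightarrow> x \<in> U \<Longrightarrow> (f has_derivative frechet_derivative f (at x)) (at x)"
  by (simp add: frechet_derivative_works)

lemma Ck_open_const: "Ck_open k U (\<lambda>x. c)"
  by (induction k arbitrary: c) auto

lemma Ck_open_linear_comp:
  assumes "bounded_linear L" "open U" "Ck_open k U f"
  shows "Ck_open k U (\<lambda>x. L (f x))"
  using assms(3)
proof (induction k arbitrary: f)
  case 0
  then show ?case using bounded_linear.continuous_on[OF assms(1)] by simp
next
  case (Suc k)
  show ?case
  proof (rule Ck_open_SucI[OF assms(2)])
    show "((\<lambda>x. L (f x)) has_derivative (\<lambda>v. L (frechet_derivative f (at x) v))) (at x)" if "x \<in> U" for x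
      by (rule bounded_linear.has_derivative[OF assms(1) Ck_open_Suc_has_derivative[OF Suc.prems that]])
    show "Ck_open k U (\<lambda>x. L (frechet_derivative f (at x) v))" for v
      using Suc by simp
  qed
qed

lemma Ck_open_linear: 
  assumes "bounded_linear L" "open U"
  shows "Ck_open k U L"
proof (cases k)
  case 0
  then show ?thesis using bounded_linear.continuous_on[OF assms(1) continuous_on_id] by simp
next
  case (Suc j)
  show ?thesis unfolding Suc
    by (rule Ck_open_SucI[OF assms(2) bounded_linear_imp_has_derivative[OF assms(1)] Ck_open_const])
qed

lemma Ck_open_add:
  assumes "open U" "Ck_open k U f" "Ck_open k U g"
  shows "Ck_open k U (\<lambda>x. f x + g x)"
  using assms(2,3)
proof (induction k arbitrary: f g)
  case 0
  then show ?case by (auto intro: continuous_intros)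
next
  case (Suc k)
  show ?case
    by (rule Ck_open_SucI[OF assms(1) has_derivative_add[OF Ck_open_Suc_has_derivative[OF Suc.prems(1)]
            Ck_open_Suc_has_derivative[OF Suc.prems(2)]] Suc.IH]) (use Suc.prems in auto)
qed

lemma Ck_open_sum:
  assumes "open U" "finite I" "\<And>i. i \<in> I \<Longrightarrow> Ck_open k U (f i)"
  shows "Ck_open k U (\<lambda>x. \<Sum>i\<in>I. f i x)"
  using assms(2,3)
  by (induction I rule: finite_induct) (auto intro: Ck_open_const Ck_open_add assms(1))

lemma Ck_open_bilinear:
  assumes "bounded_bilinear B" "open U" "Ck_open k U f" "Ck_open k U g"
  shows "Ck_open k U (\<lambda>x. B (f x) (g x))"
  using assms(3,4)
proof (induction k arbitrary: f g)
  case 0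
  then show ?case using bounded_bilinear.continuous_on[OF assms(1)] by auto
next
  case (Suc k)
  show ?case
    by (rule Ck_open_SucI[OF assms(2) bounded_bilinear.FDERIV[OF assms(1)
          Ck_open_Suc_has_derivative[OF Suc.prems(1)] Ck_open_Suc_has_derivative[OF Suc.prems(2)]]
          Ck_open_add[OF assms(2) Suc.IH Suc.IH]])
       (use Suc.prems in \<open>auto intro: Ck_open_lower simp del: Ck_open.simps simp: Ck_open.simps(2)[of k] \<close>)
qed

lemmas Ck_open_scaleR = Ck_open_bilinear[OF bounded_bilinear_scaleR]
lemmas Ck_open_mult = Ck_open_bilinear[OF bounded_bilinear_mult]

text \<open>The chain rule expresses a directional derivative of \<open>g \<circ> f\<close> through values of the derivative of \<open>g\<close>
  in directions that vary with the point. Expanding them in the standard basis leaves directional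
  derivatives of \<open>g\<close> in fixed directions, to which the induction hypothesis applies.\<close>
lemma Ck_open_compose:
  fixes f :: "'a::euclidean_space \<Rightarrow> 'b::euclidean_space" and g :: "'b \<Rightarrow> 'c::euclidean_space"
  assumes "open U" "open V" "f ` U \<subseteq> V" "Ck_open k U f" "Ck_open k V g"
  shows "Ck_open k U (\<lambda>x. g (f x))"
  using assms(4,5)
proof (induction k arbitrary: g)
  case 0
  then show ?case using assms(3) by (auto intro: continuous_on_compose2)
next
  case (Suc k)
  show ?case
  proof (rule Ck_open_SucI[OF assms(1)])
    fix x assume x: "x \<in> U"
    then have "f x \<in> V" using assms(3) by auto
    from Ck_open_Suc_has_derivative[OF Suc.prems(2) this]
    have g: "(g has_derivative frechet_derivative g (at (f x))) (at (f x))" .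
    have D: "((\<lambda>x. g (f x)) has_derivative (\<lambda>v. frechet_derivative g (at (f x)) (frechet_derivative f (at x) v))) (at x)"
      by (rule has_derivative_compose[OF Ck_open_Suc_has_derivative[OF Suc.prems(1) x] g])
    have L: "frechet_derivative g (at (f x)) w = (\<Sum>b\<in>Basis. (w \<bullet> b) *\<^sub>R frechet_derivative g (at (f x)) b)" for w
    proof -
      have lin: "linear (frechet_derivative g (at (f x)))" using g by (rule has_derivative_linear)
      have "frechet_derivative g (at (f x)) (\<Sum>b\<in>Basis. (w \<bullet> b) *\<^sub>R b)
         = (\<Sum>b\<in>Basis. (w \<bullet> b) *\<^sub>R frechet_derivative g (at (f x)) b)"
        by (simp add: linear_sum[OF lin] linear_scale[OF lin])
      then show ?thesis by (simp add: euclidean_representation)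
    qed
    show "((\<lambda>x. g (f x)) has_derivative
      (\<lambda>v. \<Sum>b\<in>Basis. (frechet_derivative f (at x) v \<bullet> b) *\<^sub>R frechet_derivative g (at (f x)) b)) (at x)"
      by (rule has_derivative_eq_rhs[OF D], rule ext, rule L)
  next
    fix v
    show "Ck_open k U (\<lambda>x. \<Sum>b\<in>Basis. (frechet_derivative f (at x) v \<bullet> b) *\<^sub>R frechet_derivative g (at (f x)) b)"
      using Suc.prems Ck_open_lower[OF Suc.prems(1)]
      by (intro Ck_open_sum Ck_open_scaleR assms finite_Basis Suc.IH
          Ck_open_linear_comp[OF bounded_linear_inner_left]) auto
  qed
qed

lemma Ck_open_inverse: "Ck_open k (- {0}) (inverse :: real \<Rightarrow> real)"
proof (induction k)
  case 0
  show ?case by (auto intro!: continuous_intros)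
next
  case (Suc k)
  show ?case
  proof (rule Ck_open_SucI)
    show "(inverse has_derivative (\<lambda>v::real. (- v) * (inverse x * inverse x))) (at x)" if "x \<in> - {0}" for x
      using has_derivative_inverse'[of x UNIV] that by (simp add: algebra_simps)
    show "Ck_open k (- {0}) (\<lambda>x. (- v) * (inverse x * inverse x))" for v :: real
      by (intro Ck_open_mult Ck_open_const Suc) auto
  qed auto
qed

lemma Ck_open_exp: "Ck_open k UNIV (exp :: real \<Rightarrow> real)"
proof (induction k)
  case 0
  show ?case by (auto intro!: continuous_intros)
next
  case (Suc k)
  show ?case
  proof (rule Ck_open_SucI)
    show "(exp has_derivative (\<lambda>v. exp x * v)) (at x)" for x :: real
      using DERIV_exp[of x] by (simp add: has_field_derivative_def)
    show "Ck_open k UNIV (\<lambda>x. exp x * v)" for v :: real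
      by (intro Ck_open_mult Ck_open_const Suc) auto
  qed auto
qed

lemma Ck_open_divide:
  fixes f g :: "'a::euclidean_space \<Rightarrow> real"
  assumes "open U" "Ck_open k U f" "Ck_open k U g" "\<And>x. x \<in> U \<Longrightarrow> g x \<noteq> 0"
  shows "Ck_open k U (\<lambda>x. f x / g x)"
  unfolding divide_inverse
  by (intro Ck_open_mult assms Ck_open_compose[OF _ _ _ _ Ck_open_inverse]) (use assms in auto)

lemma Ck_open_exp_comp:
  fixes f :: "'a::euclidean_space \<Rightarrow> real"
  assumes "open U" "Ck_open k U f"
  shows "Ck_open k U (\<lambda>x. exp (f x))"
  by (rule Ck_open_compose[OF assms(1) open_UNIV _ assms(2) Ck_open_exp]) auto

lemma Ck_open_uminus:
  assumes "open U" "Ck_open k U f"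
  shows "Ck_open k U (\<lambda>x. - f x)"
  by (rule Ck_open_linear_comp[OF _ assms]) (intro bounded_linear_minus bounded_linear_ident)

lemma Ck_open_vec_lambda:
  fixes f :: "'a::euclidean_space \<Rightarrow> 'n::finite \<Rightarrow> real"
  assumes "open U" "\<And>i. Ck_open k U (\<lambda>x. f x i)"
  shows "Ck_open k U (\<lambda>x. \<chi> i. f x i)"
proof -
  have "(\<chi> i. f x i) = (\<Sum>i\<in>UNIV. f x i *\<^sub>R axis i 1)" for x
    by (simp add: vec_eq_iff axis_def if_distrib sum.delta cong: if_cong)
  then show ?thesis
    by (simp only:) (intro Ck_open_sum Ck_open_scaleR assms Ck_open_const finite)
qed

lemma Ck_open_vec_nth:
  assumes "open U" "Ck_open k U f"
  shows "Ck_open k U (\<lambda>x. f x $ i)"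
  by (rule Ck_open_linear_comp[OF bounded_linear_vec_nth assms])

lemma Ck_open_Pair:
  assumes "open U" "Ck_open k U f" "Ck_open k U g"
  shows "Ck_open k U (\<lambda>x. (f x, g x))"
proof -
  have "Ck_open k U (\<lambda>x. (\<lambda>y. (y, 0)) (f x) + (\<lambda>y. (0, y)) (g x))"
    by (intro Ck_open_add assms Ck_open_linear_comp[OF _ assms(1) assms(2)]
         Ck_open_linear_comp[OF _ assms(1) assms(3)]) 
       (auto intro!: bounded_linear_Pair bounded_linear_zero bounded_linear_ident)
  then show ?thesis by simp
qed

lemma Ck_on_restrict:
  assumes "open U" "N \<subseteq> U" "\<And>j. enat j \<le> k \<Longrightarrow> Ck_open j U g" "\<And>q. q \<in> N \<Longrightarrow> f q = g q"
  shows "Ck_on k N f"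
  unfolding Ck_on_def using assms by blast

section \<open>The nonlinear connection of the Berwald-Moor metric\<close>

lemma partial_eqI:
  assumes "((\<lambda>s. f (x + s *\<^sub>R axis i 1)) has_real_derivative D) (at 0)"
  shows "partial i f x = D"
  using assms by (simp add: partial_def DERIV_imp_deriv)

lemma partial_cong_open:
  assumes "open U" "x \<in> U" "\<And>z. z \<in> U \<Longrightarrow> f z = g z"
  shows "partial i f x = partial i g x"
proof -
  have "((\<lambda>s. x + s *\<^sub>R axis i (1::real)) \<longlongrightarrow> x + 0 *\<^sub>R axis i 1) (at 0 within UNIV)"
    by (intro tendsto_intros)
  then have "eventually (\<lambda>s. x + s *\<^sub>R axis i (1::real) \<in> U) (at (0::real))"
    using assms by (intro topological_tendstoD) auto
  then have "eventually (\<lambda>s. x + s *\<^sub>R axis i (1::real) \<in> U) (nhds 0)"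
    using assms(2) by (auto simp: eventually_at_filter elim: eventually_mono)
  then have "eventually (\<lambda>s. f (x + s *\<^sub>R axis i (1::real)) = g (x + s *\<^sub>R axis i 1)) (nhds 0)"
    by eventually_elim (simp add: assms)
  then show ?thesis
    unfolding partial_def by (intro deriv_cong_ev) auto
qed

lemma matrix_inv_vector_eqI:
  fixes A :: "real^'n^'n"
  assumes "det A \<noteq> 0" "A *v z = b"
  shows "matrix_inv A *v b = z"
proof -
  have "invertible A" using assms(1) by (simp add: invertible_det_nz)
  then have "matrix_inv A ** A = mat 1"
    unfolding invertible_def matrix_inv_def by (rule someI2_ex) auto
  then show ?thesis
    unfolding assms(2)[symmetric] by (simp add: matrix_vector_mul_assoc)
qed

text \<open>Away from zero, \<open>w\<^sup>2\<^sup>/\<^sup>3\<close> has \<open>2/3\<close> times the logarithmic derivative of \<open>w\<close>. Logarithmic derivatives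
  make the metric a rational expression times the metric function.\<close>
lemma has_real_derivative_cbrt_square:
  fixes w :: "real \<Rightarrow> real"
  assumes "(w has_real_derivative w s * l) (at s)" "w s \<noteq> 0"
  shows "((\<lambda>s. (root 3 (w s))\<^sup>2) has_real_derivative (2/3) * (root 3 (w s))\<^sup>2 * l) (at s)"
proof -
  define r where "r = root 3 (w s)"
  have r: "r \<noteq> 0" "w s = r ^ 3"
    using assms(2) by (auto simp: odd_real_root_pow r_def)
  have *: "(root 3 has_real_derivative inverse (3 * root 3 (w s) ^ (3 - Suc 0))) (at (w s))"
    using DERIV_odd_real_root[of 3 "w s"] assms(2) by simp
  have "((\<lambda>s. root 3 (w s)) has_real_derivative inverse (3 * root 3 (w s) ^ (3 - Suc 0)) * (w s * l)) (at s)"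
    using DERIV_chain2[OF * assms(1)] .
  moreover have "inverse (3 * root 3 (w s) ^ (3 - Suc 0)) * (w s * l) = root 3 (w s) * l / 3"
    using r(1) unfolding r_def[symmetric] by (simp add: r(2) field_simps power2_eq_square power3_eq_cube)
  ultimately have "((\<lambda>s. root 3 (w s)) has_real_derivative root 3 (w s) * l / 3) (at s)" by (simp only:)
  from DERIV_power[OF this, of 2] show ?thesis
    by (rule DERIV_cong) (simp add: power2_eq_square)
qed

text \<open>The metric function depends on the base point only through \<open>a = x\<^sup>1\<close>.\<close>
definition bm_metric :: "real \<Rightarrow> real^3 \<Rightarrow> real" where
  "bm_metric a y = (root 3 (y$1 * (y$2 - a * y$3) * y$3))\<^sup>2"

lemma berwald_moor_eq: "berwald_moor x y = bm_metric (x$1) y"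
  by (simp add: berwald_moor_def bm_metric_def)

lemma open_heis_cone: "open (heis_cone x)"
  unfolding heis_cone_def
  by (intro open_Collect_neq continuous_intros)

text \<open>\<open>dlog\<close> and \<open>- hlog\<close> are the gradient and the Hessian in \<open>y\<close> of \<open>log (y\<^sup>1 (y\<^sup>2 - a y\<^sup>3) y\<^sup>3)\<close>. The matrix
  \<open>gmat\<close> below is the metric tensor divided by one third of the metric function.\<close>
definition dlog :: "real \<Rightarrow> real^3 \<Rightarrow> real^3" where
  "dlog a y = vector [1 / y$1, 1 / (y$2 - a * y$3), 1 / y$3 - a / (y$2 - a * y$3)]"

definition hlog :: "real \<Rightarrow> real^3 \<Rightarrow> 3 \<Rightarrow> 3 \<Rightarrow> real" where
  "hlog a y i j =
     (if i = 1 \<and> j = 1 then 1 / (y$1)\<^sup>2 else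
      if i = 2 \<and> j = 2 then 1 / (y$2 - a*y$3)\<^sup>2 else
      if i = 2 \<and> j = 3 \<or> i = 3 \<and> j = 2 then - a / (y$2 - a*y$3)\<^sup>2 else
      if i = 3 \<and> j = 3 then 1/(y$3)\<^sup>2 + a\<^sup>2 / (y$2 - a*y$3)\<^sup>2 else 0)"

lemma bm_metric_has_derivative:
  assumes "y \<in> heis_cone x"
  shows "((\<lambda>s. bm_metric (x$1) (y + s *\<^sub>R axis j 1)) has_real_derivative
           (2/3) * bm_metric (x$1) y * dlog (x$1) y $ j) (at 0)"
proof -
  have nz: "y$1 \<noteq> 0" "y$2 - x$1*y$3 \<noteq> 0" "y$3 \<noteq> 0"
    using assms by (auto simp: heis_cone_def)
  define w where "w = (\<lambda>s::real. (y + s *\<^sub>R axis j 1)$1 *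
      ((y + s *\<^sub>R axis j 1)$2 - x$1 * (y + s *\<^sub>R axis j 1)$3) * (y + s *\<^sub>R axis j 1)$3)"
  have w0: "w 0 \<noteq> 0" using nz by (simp add: w_def)
  have "(w has_real_derivative (w 0 * dlog (x$1) y $ j)) (at 0)"
    using exhaust_3[of j] nz unfolding w_def dlog_def
    by (auto simp: axis_def intro!: derivative_eq_intros) (auto simp: field_simps)
  from has_real_derivative_cbrt_square[OF this w0]
  show ?thesis
    unfolding bm_metric_def w_def by simp
qed

lemma dlog_has_derivative:
  assumes "y \<in> heis_cone x"
  shows "((\<lambda>s. dlog (x$1) (y + s *\<^sub>R axis i 1) $ j) has_real_derivative - hlog (x$1) y i j) (at 0)"
proof -
  have nz: "y$1 \<noteq> 0" "y$2 - x$1*y$3 \<noteq> 0" "y$3 \<noteq> 0"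
    using assms by (auto simp: heis_cone_def)
  show ?thesis
    using exhaust_3[of i] exhaust_3[of j] nz unfolding dlog_def hlog_def
    by (auto simp: axis_def intro!: derivative_eq_intros) (auto simp: field_simps power2_eq_square)
qed

lemma partial_berwald_moor:
  assumes "y \<in> heis_cone x"
  shows "partial j (berwald_moor x) y = (2/3) * bm_metric (x$1) y * dlog (x$1) y $ j"
  using bm_metric_has_derivative[OF assms] by (intro partial_eqI) (simp add: berwald_moor_eq)

definition gmat :: "real \<Rightarrow> real^3 \<Rightarrow> 3 \<Rightarrow> 3 \<Rightarrow> real" where
  "gmat a y i j = (2/3) * dlog a y $ i * dlog a y $ j - hlog a y i j"

lemma metric_tensor_berwald_moor:
  assumes "y \<in> heis_cone x"
  shows "metric_tensor berwald_moor x y $ i $ j = (1/3) * (bm_metric (x$1) y * gmat (x$1) y i j)"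
proof -
  have "partial i (partial j (berwald_moor x)) y =
        partial i (\<lambda>y. (2/3) * (bm_metric (x$1) y * dlog (x$1) y $ j)) y"
    by (rule partial_cong_open[OF open_heis_cone assms]) (simp add: partial_berwald_moor)
  also have "\<dots> = (2/3) * (bm_metric (x$1) y * gmat (x$1) y i j)"
  proof (rule partial_eqI)
    show "((\<lambda>s. (2/3) * (bm_metric (x$1) (y + s *\<^sub>R axis i 1) * dlog (x$1) (y + s *\<^sub>R axis i 1) $ j))
        has_real_derivative (2/3) * (bm_metric (x$1) y * gmat (x$1) y i j)) (at 0)"
      using DERIV_cmult[OF DERIV_mult[OF bm_metric_has_derivative[OF assms, of i] dlog_has_derivative[OF assms, of i j]], of "2/3"]
      by (rule DERIV_cong) (simp add: gmat_def algebra_simps)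
  qed
  finally show ?thesis by (simp add: metric_tensor_def)
qed

text \<open>Derivatives with respect to \<open>a\<close>. The last term of \<open>gmat_x\<close> accounts for the metric function, so that
  \<open>bm_metric * gmat_x\<close> is the derivative of the product \<open>bm_metric * gmat\<close>.\<close>
definition dlog_x :: "real \<Rightarrow> real^3 \<Rightarrow> real^3" where
  "dlog_x a y = (let u = y$2 - a*y$3 in vector [0, y$3 / u\<^sup>2, - 1/u - a*y$3/u\<^sup>2])"

definition hlog_x :: "real \<Rightarrow> real^3 \<Rightarrow> 3 \<Rightarrow> 3 \<Rightarrow> real" where
  "hlog_x a y i j = (let u = y$2 - a*y$3 in
     if i = 2 \<and> j = 2 then 2 * y$3 / u^3 else
     if i = 2 \<and> j = 3 \<or> i = 3 \<and> j = 2 then - 1/u\<^sup>2 - 2 * a*y$3/u^3 else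
     if i = 3 \<and> j = 3 then 2 * a / u\<^sup>2 + 2 * a\<^sup>2*y$3/u^3 else 0)"

definition gmat_x :: "real \<Rightarrow> real^3 \<Rightarrow> 3 \<Rightarrow> 3 \<Rightarrow> real" where
  "gmat_x a y i j = (2/3) * (dlog_x a y $ i * dlog a y $ j + dlog a y $ i * dlog_x a y $ j) - hlog_x a y i j
     - (2/3) * (y$3 / (y$2 - a*y$3)) * gmat a y i j"

lemma metric_tensor_berwald_moor_dx:
  assumes "y \<in> heis_cone x"
  shows "partial k (\<lambda>z. metric_tensor berwald_moor z y $ i $ j) x =
    (if k = 1 then (1/3) * (bm_metric (x$1) y * gmat_x (x$1) y i j) else 0)"
proof -
  define a where "a = x$1"
  have nz: "y$1 \<noteq> 0" "y$2 - a*y$3 \<noteq> 0" "y$3 \<noteq> 0"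
    using assms by (auto simp: heis_cone_def a_def)
  have "open {z. y \<in> heis_cone z}"
    unfolding heis_cone_def mem_Collect_eq by (intro open_Collect_neq continuous_intros)
  then have "partial k (\<lambda>z. metric_tensor berwald_moor z y $ i $ j) x =
     partial k (\<lambda>z. (1/3) * (bm_metric (z$1) y * gmat (z$1) y i j)) x"
    by (rule partial_cong_open) (use assms(1) in \<open>simp_all add: metric_tensor_berwald_moor\<close>)
  also have "\<dots> = (if k = 1 then (1/3) * (bm_metric (x$1) y * gmat_x (x$1) y i j) else 0)"
  proof (cases "k = 1")
    case False
    then show ?thesis
      by (intro partial_eqI) (auto simp: axis_def)
  next
    case True
    have "((\<lambda>s. y$1 * (y$2 - (a+s) * y$3) * y$3) has_real_derivative
         (y$1 * (y$2 - (a+0) * y$3) * y$3) * (- y$3 / (y$2 - a*y$3))) (at 0)"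
      using nz by (auto intro!: derivative_eq_intros)
    from has_real_derivative_cbrt_square[OF this]
    have F: "((\<lambda>s. bm_metric (a+s) y) has_real_derivative (2/3) * bm_metric (a+0) y * (- y$3 / (y$2 - a*y$3))) (at 0)"
      using nz by (simp add: bm_metric_def)
    define r where "r s = 1 / (y$2 - (a+s) * y$3)" for s
    have r: "(r has_real_derivative y$3 * (r 0)\<^sup>2) (at 0)"
      unfolding r_def using nz by (auto intro!: derivative_eq_intros simp: power2_eq_square)
    have g: "((\<lambda>s. dlog (a+s) y $ l) has_real_derivative dlog_x a y $ l) (at 0)" for l
    proof -
      have "dlog (a+s) y = vector [1/y$1, r s, 1/y$3 - (a+s) * r s]" for s
        by (simp add: dlog_def r_def)
      moreover have "dlog_x a y = vector [0, y$3 * (r 0)\<^sup>2, - r 0 - a * y$3 * (r 0)\<^sup>2]"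
        by (simp add: dlog_x_def r_def Let_def power_divide)
      ultimately show ?thesis
        using exhaust_3[of l] by (auto intro!: derivative_eq_intros r)
    qed
    have h: "((\<lambda>s. hlog (a+s) y i j) has_real_derivative hlog_x a y i j) (at 0)"
    proof -
      have "((\<lambda>s. (r s)\<^sup>2) has_real_derivative 2 * y$3 * r 0 ^ 3) (at 0)"
        by (rule DERIV_cong[OF DERIV_power[OF r]]) (simp add: power2_eq_square power3_eq_cube)
      moreover have "((\<lambda>s. - (a+s) * (r s)\<^sup>2) has_real_derivative - (r 0)\<^sup>2 - 2 * a * y$3 * r 0 ^ 3) (at 0)"
        by (rule derivative_eq_intros calculation refl)+ simp
      moreover have "((\<lambda>s. 1/(y$3)\<^sup>2 + (a+s)\<^sup>2 * (r s)\<^sup>2) has_real_derivative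
          2 * a * (r 0)\<^sup>2 + 2 * a\<^sup>2 * y$3 * r 0 ^ 3) (at 0)"
        by (rule derivative_eq_intros calculation(1) refl)+ simp
      moreover have "hlog (a+s) y i j =
         (if i = 1 \<and> j = 1 then 1 / (y$1)\<^sup>2 else
          if i = 2 \<and> j = 2 then (r s)\<^sup>2 else
          if i = 2 \<and> j = 3 \<or> i = 3 \<and> j = 2 then - (a+s) * (r s)\<^sup>2 else
          if i = 3 \<and> j = 3 then 1/(y$3)\<^sup>2 + (a+s)\<^sup>2 * (r s)\<^sup>2 else 0)" for s
        by (simp add: hlog_def r_def power_divide)
      moreover have "hlog_x a y i j = 
         (if i = 2 \<and> j = 2 then 2 * y$3 * r 0 ^ 3 else
          if i = 2 \<and> j = 3 \<or> i = 3 \<and> j = 2 then - (r 0)\<^sup>2 - 2 * a * y$3 * r 0 ^ 3 else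
          if i = 3 \<and> j = 3 then 2 * a * (r 0)\<^sup>2 + 2 * a\<^sup>2 * y$3 * r 0 ^ 3 else 0)"
        by (simp add: hlog_x_def r_def power_divide Let_def)
      ultimately show ?thesis
        using exhaust_3[of i] exhaust_3[of j] by auto
    qed
    have G: "((\<lambda>s. gmat (a+s) y i j) has_real_derivative (2/3) * (dlog_x a y $ i * dlog (a+0) y $ j
           + dlog_x a y $ j * dlog (a+0) y $ i) - hlog_x a y i j) (at 0)"
      unfolding gmat_def mult.assoc
      by (rule DERIV_diff[OF DERIV_cmult[OF DERIV_mult[OF g g]] h])
    have "((\<lambda>s. (1/3) * (bm_metric (a+s) y * gmat (a+s) y i j)) has_real_derivative (1/3) * (bm_metric a y * gmat_x a y i j)) (at 0)"
      using DERIV_cmult[OF DERIV_mult[OF F G], of "1/3"]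
      by (rule DERIV_cong) (simp add: gmat_x_def algebra_simps)
    with True show ?thesis
      by (intro partial_eqI) (simp add: a_def)
  qed
  finally show ?thesis .
qed

text \<open>In frame components the spray is \<open>(- u\<^sub>1\<^sup>2 u\<^sub>3 / (2 u\<^sub>2), - u\<^sub>1 u\<^sub>3 / 2, u\<^sub>1 u\<^sub>3\<^sup>2 / (2 u\<^sub>2))\<close>, read off from the
  Euler-Lagrange equations of the metric function on the group.\<close>
definition spray :: "real \<Rightarrow> real^3 \<Rightarrow> real^3" where
  "spray a y = (let u = y$2 - a * y$3 in
     vector [- (y$1)\<^sup>2 * y$3 / (2*u), - y$1 * y$3 / 2 + a * y$1 * (y$3)\<^sup>2 / (2*u), y$1 * (y$3)\<^sup>2 / (2*u)])"

text \<open>The inverse of the metric tensor need not be computed: it is enough that the tensor is invertible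
  and maps the claimed spray to the right-hand side \<open>b\<close>. Since the metric function is homogeneous,
  contracting \<open>gmat\<close> and its derivative with \<open>y\<close> collapses them to \<open>dlog\<close> and its derivative, so both
  sides become short expressions.\<close>
lemma spray_coeff_berwald_moor:
  assumes "y \<in> heis_cone x"
  shows "spray_coeff berwald_moor x y = spray (x$1) y"
proof -
  define a where "a = x$1"
  define u where "u = y$2 - a*y$3"
  have nz: "y$1 \<noteq> 0" "u \<noteq> 0" "y$3 \<noteq> 0"
    using assms by (auto simp: heis_cone_def u_def a_def)
  have y2: "y$2 = u + a*y$3" by (simp add: u_def)
  define F where "F = bm_metric a y"
  have F: "F \<noteq> 0" using nz by (simp add: F_def bm_metric_def u_def)
  define A where "A = metric_tensor berwald_moor x y"
  have A: "A $ i $ j = (1/3) * (F * gmat a y i j)" for i j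
    using assms by (simp add: A_def F_def a_def metric_tensor_berwald_moor)
  define b :: "real^3" where "b = (\<chi> l. (\<Sum>j\<in>UNIV. \<Sum>k\<in>UNIV.
      (2 * partial k (\<lambda>z. metric_tensor berwald_moor z y $ j $ l) x
         - partial l (\<lambda>z. metric_tensor berwald_moor z y $ j $ k) x) * y $ j * y $ k))"
  have dlog_y: "dlog a y $ 1 * y$1 + dlog a y $ 2 * y$2 + dlog a y $ 3 * y$3 = 3"
    using nz by (simp add: dlog_def u_def[symmetric]) (simp add: y2 field_simps)
  have gmat_y: "gmat a y 1 l * y$1 + gmat a y 2 l * y$2 + gmat a y 3 l * y$3 = dlog a y $ l" for l
  proof -
    have "hlog a y 1 l * y$1 + hlog a y 2 l * y$2 + hlog a y 3 l * y$3 = dlog a y $ l"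
      using exhaust_3[of l] nz by (auto simp: hlog_def dlog_def u_def[symmetric])
        (simp_all add: y2 field_simps power2_eq_square)
    moreover have "gmat a y 1 l * y$1 + gmat a y 2 l * y$2 + gmat a y 3 l * y$3 =
        (2/3) * dlog a y $ l * (dlog a y $ 1 * y$1 + dlog a y $ 2 * y$2 + dlog a y $ 3 * y$3)
        - (hlog a y 1 l * y$1 + hlog a y 2 l * y$2 + hlog a y 3 l * y$3)"
      unfolding gmat_def by (simp only: algebra_simps)
    ultimately show ?thesis unfolding dlog_y by simp
  qed
  have gmat_x_y: "gmat_x a y 1 l * y$1 + gmat_x a y 2 l * y$2 + gmat_x a y 3 l * y$3
      = dlog_x a y $ l - (2/3) * (y$3 / u) * dlog a y $ l" for l
  proof -
    have 1: "hlog_x a y 1 l * y$1 + hlog_x a y 2 l * y$2 + hlog_x a y 3 l * y$3 = dlog_x a y $ l"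
      using exhaust_3[of l] nz by (auto simp: hlog_x_def dlog_x_def u_def[symmetric])
        (simp_all add: y2 field_simps power2_eq_square power3_eq_cube)
    have 2: "dlog_x a y $ 1 * y$1 + dlog_x a y $ 2 * y$2 + dlog_x a y $ 3 * y$3 = 0"
      using nz by (simp add: dlog_x_def u_def[symmetric]) (simp add: y2 field_simps power2_eq_square)
    have "gmat_x a y 1 l * y$1 + gmat_x a y 2 l * y$2 + gmat_x a y 3 l * y$3 =
        (2/3) * dlog a y $ l * (dlog_x a y $ 1 * y$1 + dlog_x a y $ 2 * y$2 + dlog_x a y $ 3 * y$3)
        + (2/3) * dlog_x a y $ l * (dlog a y $ 1 * y$1 + dlog a y $ 2 * y$2 + dlog a y $ 3 * y$3)
        - (hlog_x a y 1 l * y$1 + hlog_x a y 2 l * y$2 + hlog_x a y 3 l * y$3)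
        - (2/3) * (y$3 / u) * (gmat a y 1 l * y$1 + gmat a y 2 l * y$2 + gmat a y 3 l * y$3)"
      unfolding gmat_x_def u_def[symmetric] by (simp only: algebra_simps)
    then show ?thesis unfolding 1 2 dlog_y gmat_y by simp
  qed
  have b: "b $ l = (1/3) * F * (2 * y$1 * (dlog_x a y $ l - (2/3) * (y$3 / u) * dlog a y $ l)
      + (if l = 1 then 2 * y$3 / u else 0))" for l
  proof -
    have "b $ l = (1/3) * F * (2 * y$1 * (gmat_x a y 1 l * y$1 + gmat_x a y 2 l * y$2 + gmat_x a y 3 l * y$3)
       - (if l = 1 then (gmat_x a y 1 1 * y$1 + gmat_x a y 2 1 * y$2 + gmat_x a y 3 1 * y$3) * y$1
          + (gmat_x a y 1 2 * y$1 + gmat_x a y 2 2 * y$2 + gmat_x a y 3 2 * y$3) * y$2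
          + (gmat_x a y 1 3 * y$1 + gmat_x a y 2 3 * y$2 + gmat_x a y 3 3 * y$3) * y$3 else 0))"
      by (simp add: b_def sum_3 metric_tensor_berwald_moor_dx[OF assms] a_def[symmetric] F_def[symmetric])
        (simp add: algebra_simps)
    also have "(gmat_x a y 1 1 * y$1 + gmat_x a y 2 1 * y$2 + gmat_x a y 3 1 * y$3) * y$1
          + (gmat_x a y 1 2 * y$1 + gmat_x a y 2 2 * y$2 + gmat_x a y 3 2 * y$3) * y$2
          + (gmat_x a y 1 3 * y$1 + gmat_x a y 2 3 * y$2 + gmat_x a y 3 3 * y$3) * y$3 = - 2 * y$3 / u"
    proof -
      have 2: "dlog_x a y $ 1 * y$1 + dlog_x a y $ 2 * y$2 + dlog_x a y $ 3 * y$3 = 0"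
        using nz by (simp add: dlog_x_def u_def[symmetric]) (simp add: y2 field_simps power2_eq_square)
      have "(dlog_x a y $ 1 - (2/3) * (y$3 / u) * dlog a y $ 1) * y$1 + (dlog_x a y $ 2 - (2/3) * (y$3 / u) * dlog a y $ 2) * y$2 
         + (dlog_x a y $ 3 - (2/3) * (y$3 / u) * dlog a y $ 3) * y$3 = - 2 * (y$3 / u)"
        (is "?S = _")
      proof -
        have "?S = (dlog_x a y $ 1 * y$1 + dlog_x a y $ 2 * y$2 + dlog_x a y $ 3 * y$3)
          - (2/3) * (y$3 / u) * (dlog a y $ 1 * y$1 + dlog a y $ 2 * y$2 + dlog a y $ 3 * y$3)"
          by (simp only: algebra_simps)
        then show ?thesis unfolding 2 dlog_y by simp
      qed
      then show ?thesis unfolding gmat_x_y by simp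
    qed
    finally show ?thesis unfolding gmat_x_y by simp
  qed
  define z where "z = 4 *\<^sub>R spray a y"
  have z: "z$1 = - 2 * (y$1)\<^sup>2 * y$3 / u" "z$2 = - 2 * y$1 * y$3 + 2 * a * y$1 * (y$3)\<^sup>2 / u"
     "z$3 = 2 * y$1 * (y$3)\<^sup>2 / u"
    by (simp_all add: z_def spray_def u_def[symmetric] Let_def)
  have "A *v z = b"
  proof -
    have dz: "dlog a y $ 1 * z$1 + dlog a y $ 2 * z$2 + dlog a y $ 3 * z$3 = - 2 * y$1 * (y$3 / u)"
      using nz by (simp add: dlog_def z u_def[symmetric]) (simp add: field_simps power2_eq_square)
    have hz: "hlog a y l 1 * z$1 + hlog a y l 2 * z$2 + hlog a y l 3 * z$3 
         = - 2 * y$1 * dlog_x a y $ l - (if l = 1 then 2 * y$3/u else 0)" for l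
      using exhaust_3[of l] nz by (auto simp: hlog_def dlog_x_def z u_def[symmetric])
        (simp_all add: field_simps power2_eq_square)
    have gz: "gmat a y l 1 * z$1 + gmat a y l 2 * z$2 + gmat a y l 3 * z$3
      = 2 * y$1 * (dlog_x a y $ l - (2/3) * (y$3 / u) * dlog a y $ l)
      + (if l = 1 then 2 * y$3 / u else 0)" for l
    proof -
      have "gmat a y l 1 * z$1 + gmat a y l 2 * z$2 + gmat a y l 3 * z$3
        = (2/3) * dlog a y $ l * (dlog a y $ 1 * z$1 + dlog a y $ 2 * z$2 + dlog a y $ 3 * z$3)
          - (hlog a y l 1 * z$1 + hlog a y l 2 * z$2 + hlog a y l 3 * z$3)"
        unfolding gmat_def by (simp only: algebra_simps)
      then show ?thesis unfolding dz hz by (simp add: algebra_simps)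
    qed
    show ?thesis
    proof (rule vec_eq_iff[THEN iffD2], rule allI)
      fix l
      have "(A *v z) $ l = (1/3) * F * (gmat a y l 1 * z$1 + gmat a y l 2 * z$2 + gmat a y l 3 * z$3)"
        by (simp add: matrix_vector_mult_def sum_3 A algebra_simps)
      also have "\<dots> = b $ l" unfolding gz b ..
      finally show "(A *v z) $ l = b $ l" .
    qed
  qed
  moreover have "det A \<noteq> 0"
  proof -
    define \<alpha> \<beta> \<gamma> where "\<alpha> = 1/y$1" and "\<beta> = 1/u" and "\<gamma> = 1/y$3"
    have "dlog a y = vector [\<alpha>, \<beta>, \<gamma> - a * \<beta>]"
      by (simp add: dlog_def u_def \<alpha>_def \<beta>_def \<gamma>_def)
    moreover have "hlog a y 1 1 = \<alpha>\<^sup>2" "hlog a y 2 2 = \<beta>\<^sup>2" "hlog a y 3 3 = \<gamma>\<^sup>2 + a\<^sup>2 * \<beta>\<^sup>2"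
      "hlog a y 2 3 = - a * \<beta>\<^sup>2" "hlog a y 3 2 = - a * \<beta>\<^sup>2" "hlog a y 1 2 = 0" "hlog a y 1 3 = 0"
      "hlog a y 2 1 = 0" "hlog a y 3 1 = 0"
      by (simp_all add: hlog_def u_def[symmetric] \<alpha>_def \<beta>_def \<gamma>_def power_divide)
    ultimately have "det A = (F/3)^3 * (\<alpha> * \<beta> * \<gamma>)\<^sup>2"
      unfolding det_3 A gmat_def by (simp add: algebra_simps power2_eq_square power3_eq_cube) (simp add: field_simps)
    moreover have "\<alpha> * \<beta> * \<gamma> \<noteq> 0" using nz by (simp add: \<alpha>_def \<beta>_def \<gamma>_def)
    ultimately show ?thesis using F by simp
  qed
  ultimately have "matrix_inv A *v b = z"
    by (intro matrix_inv_vector_eqI)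
  then have "spray a y = (1/4) *\<^sub>R (matrix_inv A *v b)" by (simp add: z_def)
  moreover have "spray_coeff berwald_moor x y = (1/4) *\<^sub>R (matrix_inv A *v b)"
    by (simp add: vec_eq_iff spray_coeff_def matrix_vector_mult_def A_def b_def sum_distrib_left mult.assoc)
  ultimately show ?thesis by (simp add: a_def)
qed

lemma has_vector_derivative_vecI:
  fixes f :: "real \<Rightarrow> real^'n"
  assumes "\<And>i. ((\<lambda>t. f t $ i) has_real_derivative D $ i) (at t within S)"
  shows "(f has_vector_derivative D) (at t within S)"
proof -
  have "((\<lambda>t. \<Sum>i\<in>UNIV. f t $ i *\<^sub>R axis i (1::real)) has_vector_derivative (\<Sum>i\<in>UNIV. D $ i *\<^sub>R axis i 1)) (at t within S)"
    using assms unfolding has_real_derivative_iff_has_vector_derivative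
    by (intro has_vector_derivative_sum bounded_linear.has_vector_derivative[OF bounded_linear_scaleR_left])
  moreover have "(\<Sum>i\<in>UNIV. v $ i *\<^sub>R axis i 1) = v" for v :: "real^'n"
    by (simp add: vec_eq_iff axis_def if_distrib sum.delta cong: if_cong)
  ultimately show ?thesis by simp
qed

section \<open>Parallel translation along the left-invariant frame\<close>

definition frame :: "3 \<Rightarrow> real \<Rightarrow> real^3" where
  "frame i a = (if i = 1 then vector [1, 0, 0] else if i = 2 then vector [0, 1, 0] else vector [0, a, 1])"

definition to_frame :: "real \<Rightarrow> real^3 \<Rightarrow> real^3" where
  "to_frame a y = vector [y$1, y$2 - a * y$3, y$3]"

definition from_frame :: "real \<Rightarrow> real^3 \<Rightarrow> real^3" where
  "from_frame a u = vector [u$1, u$2 + a * u$3, u$3]"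

lemma to_frame_from_frame [simp]: "to_frame a (from_frame a u) = u"
  and from_frame_to_frame [simp]: "from_frame a (to_frame a u) = u"
  by (simp_all add: to_frame_def from_frame_def vec_eq_iff forall_3)

definition frame_cone :: "(real^3) set" where
  "frame_cone = {u. u$1 \<noteq> 0 \<and> u$2 \<noteq> 0 \<and> u$3 \<noteq> 0}"

lemma heis_cone_iff: "y \<in> heis_cone x \<longleftrightarrow> to_frame (x$1) y \<in> frame_cone"
  by (auto simp: heis_cone_def to_frame_def frame_cone_def)

text \<open>The translation along the \<open>i\<close>-th frame field multiplies \<open>u\<^sub>k\<close> by \<open>exp (s * rate * weight)\<close>. In the
  notation \<open>p = u\<^sub>1/u\<^sub>2\<close>, \<open>q = u\<^sub>3/u\<^sub>2\<close> the three rates are \<open>q\<close>, \<open>pq\<close> and \<open>p\<close>. Each vector of weights has sum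
  zero, which preserves the metric function, and leaves its own rate unchanged.\<close>
definition rate :: "3 \<Rightarrow> real^3 \<Rightarrow> real" where
  "rate i u = (if i = 1 then u$3 / u$2 else if i = 2 then u$1 * u$3 / (u$2)\<^sup>2 else u$1 / u$2)"

definition weight :: "3 \<Rightarrow> real^3" where
  "weight i = (if i = 1 then vector [1, -1/2, -1/2] else if i = 2 then vector [-1/2, 0, 1/2]
     else vector [1/2, 1/2, -1])"

definition flow :: "3 \<Rightarrow> real \<Rightarrow> real^3 \<Rightarrow> real^3" where
  "flow i s u = (\<chi> k. u$k * exp (s * rate i u * weight i $ k))"

lemma flow_in_cone [simp]: "flow i s u \<in> frame_cone \<longleftrightarrow> u \<in> frame_cone"
  by (simp add: frame_cone_def flow_def)

lemma rate_flow [simp]: "rate i (flow i s u) = rate i u"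
  using exhaust_3[of i]
  by (auto simp: rate_def flow_def weight_def power_mult_distrib exp_double[symmetric] exp_add[symmetric] mult.commute simp flip: exp_diff)

lemma flow_add: "flow i s (flow i t u) = flow i (s + t) u"
  by (simp add: flow_def[of i s] flow_def[of i "s+t"] vec_eq_iff) 
     (simp add: flow_def algebra_simps flip: exp_add)

lemma flow_0 [simp]: "flow i 0 u = u"
  by (simp add: flow_def vec_eq_iff)

text \<open>The covariant derivative along a frame field acts on frame components by the generator of \<open>flow\<close>.
  The additional term for \<open>i = 1\<close> is the derivative of the frame itself, as only \<open>E\<^sub>3\<close> varies, along \<open>E\<^sub>1\<close>.\<close>
lemma connection_coeff_frame:
  assumes "y \<in> heis_cone x"
  shows "connection_coeff berwald_moor x y *v frame i (x$1) =
     - (from_frame (x$1) (\<chi> k. to_frame (x$1) y $ k * (rate i (to_frame (x$1) y) * weight i $ k))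
        + (if i = 1 then y$3 *\<^sub>R axis 2 1 else 0))"
proof -
  define a where "a = x$1"
  have nz: "y$1 \<noteq> 0" "y$2 - a*y$3 \<noteq> 0" "y$3 \<noteq> 0"
    using assms by (auto simp: heis_cone_def a_def)
  define r where "r = 1 / (y$2 - a*y$3)"
  define C where "C = connection_coeff berwald_moor x y"
  have C: "C $ k $ j = partial j (\<lambda>z. spray a z $ k) y" for k j
    unfolding C_def connection_coeff_def
    using spray_coeff_berwald_moor by (simp add: partial_cong_open[OF open_heis_cone assms, of "\<lambda>z. spray_coeff berwald_moor x z $ k" "\<lambda>z. spray a z $ k"] a_def)
  have sp: "spray a z $ 1 = - (z$1)\<^sup>2 * z$3 * (1 / (z$2 - a * z$3)) / 2"
    "spray a z $ 3 = z$1 * (z$3)\<^sup>2 * (1 / (z$2 - a * z$3)) / 2"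
    "spray a z $ 2 = - (z$1 * z$3) / 2 + a * (z$1 * (z$3)\<^sup>2 * (1 / (z$2 - a * z$3)) / 2)" for z
  proof -
    define w where "w = z$2 - a * z$3"
    show "spray a z $ 1 = - (z$1)\<^sup>2 * z$3 * (1 / (z$2 - a * z$3)) / 2"
      "spray a z $ 3 = z$1 * (z$3)\<^sup>2 * (1 / (z$2 - a * z$3)) / 2"
      "spray a z $ 2 = - (z$1 * z$3) / 2 + a * (z$1 * (z$3)\<^sup>2 * (1 / (z$2 - a * z$3)) / 2)"
      by (simp_all add: spray_def Let_def w_def[symmetric])
  qed
  have C_eq: "C $ 1 $ j = - y$1*y$3*r * axis j 1 $ 1 - (y$1)\<^sup>2*r/2 * axis j 1 $ 3
      + (y$1)\<^sup>2*y$3*r\<^sup>2/2 * (axis j 1 $ 2 - a * axis j 1 $ 3)" (is "_ = ?C1")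
    "C $ 3 $ j = (y$3)\<^sup>2*r/2 * axis j 1 $ 1 + y$1*y$3*r * axis j 1 $ 3
      - y$1*(y$3)\<^sup>2*r\<^sup>2/2 * (axis j 1 $ 2 - a * axis j 1 $ 3)" (is "_ = ?C3")
    "C $ 2 $ j = - (y$3 * axis j 1 $ 1 + y$1 * axis j 1 $ 3)/2 + a * C $ 3 $ j" (is "_ = ?C2 + a * _") for j
  proof -
    define Y where "Y k s = (y + s *\<^sub>R axis j 1) $ k" for k s
    define d where "d = axis j (1::real)"
    have Y: "(Y k has_real_derivative d $ k) (at 0)" for k
      unfolding Y_def d_def by (auto intro!: derivative_eq_intros)
    have Y0: "Y k 0 = y $ k" for k by (simp add: Y_def)
    define R where "R s = 1 / (Y 2 s - a * Y 3 s)" for s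
    have R0: "R 0 = r" by (simp add: R_def r_def Y0)
    have R: "(R has_real_derivative - r\<^sup>2 * (d$2 - a * d$3)) (at 0)"
      unfolding R_def using nz
      by (auto intro!: derivative_eq_intros Y simp: Y0 r_def power2_eq_square)
        (simp add: minus_divide_left algebra_simps)
    have "((\<lambda>s. - (Y 1 s)\<^sup>2 * Y 3 s * R s / 2) has_real_derivative ?C1) (at 0)"
      by (rule derivative_eq_intros Y R refl | simp)+ (simp add: Y0 R0 d_def power2_eq_square algebra_simps)
    then show "C $ 1 $ j = ?C1"
      unfolding C by (intro partial_eqI) (simp only: sp Y_def R_def)
    have 3: "((\<lambda>s. Y 1 s * (Y 3 s)\<^sup>2 * R s / 2) has_real_derivative ?C3) (at 0)"
      by (rule derivative_eq_intros Y R refl | simp)+ (simp add: Y0 R0 d_def power2_eq_square algebra_simps)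
    then show C3: "C $ 3 $ j = ?C3"
      unfolding C by (intro partial_eqI) (simp only: sp Y_def R_def)
    have "((\<lambda>s. - (Y 1 s * Y 3 s) / 2) has_real_derivative ?C2) (at 0)"
      by (rule derivative_eq_intros Y R refl | simp)+ (simp add: Y0 R0 d_def power2_eq_square algebra_simps)
    from DERIV_add[OF this DERIV_cmult[OF 3, of a]] show "C $ 2 $ j = ?C2 + a * C $ 3 $ j"
      unfolding C3 unfolding C by (intro partial_eqI) (simp only: sp Y_def R_def mult.assoc)
  qed
  define u where "u = to_frame a y"
  have y: "y$1 = u$1" "y$3 = u$3" by (simp_all add: u_def to_frame_def)
  have r: "r = 1 / u$2" by (simp add: u_def to_frame_def r_def)
  have ur: "u$2 * r = 1" "r * u$2 = 1" "u$2 * (r * z) = z" "r * (u$2 * z) = z" for z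
    using nz(2) by (simp_all add: r u_def to_frame_def)
  have rate: "rate i u = (if i = 1 then u$3 * r else if i = 2 then u$1 * u$3 * r\<^sup>2 else u$1 * r)"
    by (simp add: rate_def r power_divide)
  have "C *v frame i a = - (from_frame a (\<chi> k. u $ k * (rate i u * weight i $ k))
        + (if i = 1 then y$3 *\<^sub>R axis 2 1 else 0))"
    unfolding vec_eq_iff forall_3 matrix_vector_mult_def rate
    using exhaust_3[of i]
    by (auto simp: sum_3 frame_def C_eq from_frame_def weight_def axis_def y)
       (simp_all add: ur algebra_simps power2_eq_square)
  then show ?thesis by (simp add: C_def a_def u_def)
qed

lemma frame_at_step [simp]: "frame i ((x + s *\<^sub>R frame i (x$1)) $ 1) = frame i (x$1)"
  by (simp add: frame_def)

text \<open>Integral curves of the frame fields are straight lines, and along them the parallel transport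
  equation is solved by \<open>flow\<close>, for all times because the rate is constant along the solution.\<close>
lemma parallel_along_frame_segment:
  fixes x v :: "real^3" and s :: real and i :: 3
  assumes v: "v \<in> heis_cone x"
  defines "c \<equiv> \<lambda>t::real. x + (t * s) *\<^sub>R frame i (x$1)"
  shows "parallel_along heis_cone berwald_moor c
     (\<lambda>t. from_frame (c t $ 1) (flow i (t * s) (to_frame (x$1) v)))"
    (is "parallel_along _ _ _ ?X")
proof -
  define u where "u = to_frame (x$1) v"
  have u: "u \<in> frame_cone" using v by (simp add: u_def heis_cone_iff)
  define U where "U t = flow i (t * s) u" for t
  have U: "((\<lambda>t. U t $ k) has_real_derivative s * (U t $ k * (rate i (U t) * weight i $ k))) (at t)" for t k
  proof -
    have "((\<lambda>t. u$k * exp (t * s * rate i u * weight i $ k)) has_real_derivative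
       s * ((u$k * exp (t * s * rate i u * weight i $ k)) * (rate i u * weight i $ k))) (at t)"
      by (auto intro!: derivative_eq_intros)
    moreover have "rate i (U t) = rate i u" by (simp add: U_def)
    ultimately show ?thesis by (simp add: U_def flow_def)
  qed
  have c1: "((\<lambda>t. c t $ 1) has_real_derivative (if i = 1 then s else 0)) (at t)" for t
    unfolding c_def by (auto simp: frame_def intro!: derivative_eq_intros)
  have c: "(c has_vector_derivative s *\<^sub>R frame i (x$1)) (at t)" for t
    unfolding c_def by (auto intro!: derivative_eq_intros)
  have in_cone: "?X t \<in> heis_cone (c t)" for t
    using u by (simp add: heis_cone_iff u_def)
  have X: "(?X has_vector_derivative - (connection_coeff berwald_moor (c t) (?X t) *v (s *\<^sub>R frame i (x$1)))) (at t)" for t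
  proof -
    define a where "a = c t $ 1"
    have f3: "from_frame a w $ 3 = w $ 3" for a w by (simp add: from_frame_def)
    have fr: "frame i (x$1) = frame i (c t $ 1)" unfolding c_def frame_at_step ..
    have "- (connection_coeff berwald_moor (c t) (?X t) *v (s *\<^sub>R frame i (x$1))) =
       s *\<^sub>R (from_frame a (\<chi> k. U t $ k * (rate i (U t) * weight i $ k)) + (if i = 1 then U t $ 3 *\<^sub>R axis 2 1 else 0))"
      unfolding fr matrix_vector_mult_scaleR connection_coeff_frame[OF in_cone] to_frame_from_frame f3 a_def U_def u_def
      by (simp only: scaleR_minus_right minus_minus)
    also have "(?X has_vector_derivative \<dots>) (at t)"
    proof (rule has_vector_derivative_vecI)
      fix k
      show "((\<lambda>t. ?X t $ k) has_real_derivative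
         (s *\<^sub>R (from_frame a (\<chi> k. U t $ k * (rate i (U t) * weight i $ k)) + (if i = 1 then U t $ 3 *\<^sub>R axis 2 1 else 0))) $ k) (at t)"
        using exhaust_3[of k] U[where k=1 and t=t] U[where k=3 and t=t]
         DERIV_add[OF U[where k=2 and t=t] DERIV_mult[OF c1[of t] U[where k=3 and t=t]]]
        by (auto simp: from_frame_def U_def[symmetric] u_def[symmetric] a_def[symmetric] axis_def algebra_simps)
    qed
    finally show ?thesis .
  qed
  have "continuous_on {0..1} ?X"
    using X by (auto intro!: continuous_at_imp_continuous_on has_vector_derivative_continuous)
  moreover have "c differentiable (at t)" for t
    using c by (auto simp: has_vector_derivative_def differentiable_def)
  moreover have "vector_derivative c (at t) = s *\<^sub>R frame i (x$1)" for t
    by (rule vector_derivative_at[OF c])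
  ultimately show ?thesis
    unfolding parallel_along_def using in_cone X by (intro conjI exI[of _ "{}"]) auto
qed

section \<open>Composition of parallel translations\<close>

text \<open>The relation that defines the holonomy group, for arbitrary end points and for all vectors of the
  cone, so that translations can be composed.\<close>
definition translation :: "(real^'n \<Rightarrow> (real^'n) set) \<Rightarrow> (real^'n \<Rightarrow> real^'n \<Rightarrow> real) \<Rightarrow>
    real^'n \<Rightarrow> real^'n \<Rightarrow> (real^'n \<Rightarrow> real^'n) \<Rightarrow> bool" where
  "translation C F x y \<phi> \<longleftrightarrow> (\<exists>c. piecewise_C1_curve c \<and> c 0 = x \<and> c 1 = y \<and>
     (\<forall>v\<in>C x. \<exists>X. parallel_along C F c X \<and> X 0 = v \<and> X 1 = \<phi> v))"

lemma piecewise_C1_curve_C1: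
  assumes "\<And>t. (c has_vector_derivative D t) (at t)" "continuous_on {0..1} D"
  shows "piecewise_C1_curve c"
  unfolding piecewise_C1_curve_def
proof (intro exI[of _ "1::nat"] exI[of _ real] conjI allI impI)
  fix i :: nat assume "i < 1"
  then show "\<exists>g. g C1_differentiable_on {real i..real (Suc i)} \<and> (\<forall>t\<in>{real i..real (Suc i)}. c t = g t)"
    using assms by (intro exI[of _ c]) (auto simp: C1_differentiable_on_def)
qed auto

lemma translation_id: "translation C F x x (\<lambda>v. v)"
proof -
  have "piecewise_C1_curve (\<lambda>t. x)"
    by (rule piecewise_C1_curve_C1[of _ "\<lambda>_. 0"]) auto
  moreover have "parallel_along C F (\<lambda>t. x) (\<lambda>t. v)" if "v \<in> C x" for v
    using that unfolding parallel_along_def by (auto intro!: exI[of _ "{}"])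
  ultimately show ?thesis
    unfolding translation_def by (intro exI[of _ "\<lambda>t. x"]) auto
qed

lemma translation_frame:
  "translation heis_cone berwald_moor x (x + s *\<^sub>R frame i (x$1))
     (\<lambda>v. from_frame ((x + s *\<^sub>R frame i (x$1))$1) (flow i s (to_frame (x$1) v)))"
proof -
  define c where "c = (\<lambda>t::real. x + (t * s) *\<^sub>R frame i (x$1))"
  have "piecewise_C1_curve c"
    by (rule piecewise_C1_curve_C1[of _ "\<lambda>_. s *\<^sub>R frame i (x$1)"])
      (auto simp: c_def intro!: derivative_eq_intros)
  moreover have "\<exists>X. parallel_along heis_cone berwald_moor c X \<and> X 0 = v \<and>
      X 1 = from_frame ((x + s *\<^sub>R frame i (x$1))$1) (flow i s (to_frame (x$1) v))" if "v \<in> heis_cone x" for v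
    using parallel_along_frame_segment[OF that, of s i, folded c_def]
    by (intro exI[of _ "\<lambda>t. from_frame (c t $ 1) (flow i (t * s) (to_frame (x$1) v))"]) (simp add: c_def)
  ultimately show ?thesis
    unfolding translation_def by (intro exI[of _ c]) (simp add: c_def)
qed

definition join :: "(real \<Rightarrow> 'a) \<Rightarrow> (real \<Rightarrow> 'a) \<Rightarrow> real \<Rightarrow> 'a" where
  "join f g t = (if t \<le> 1/2 then f (2 * t) else g (2 * t - 1))"

lemma C1_differentiable_on_affine:
  fixes g :: "real \<Rightarrow> 'a::real_normed_vector"
  assumes "g C1_differentiable_on S" "(\<lambda>t. 2 * t - b) ` T \<subseteq> S"
  shows "(\<lambda>t. g (2 * t - b)) C1_differentiable_on T"
proof -
  obtain D where D: "\<And>x. x \<in> S \<Longrightarrow> (g has_vector_derivative D x) (at x)" "continuous_on S D"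
    using assms(1) by (auto simp: C1_differentiable_on_def)
  have "((\<lambda>t. g (2 * t - b)) has_vector_derivative 2 *\<^sub>R D (2 * t - b)) (at t)" if "t \<in> T" for t
  proof -
    have 1: "((\<lambda>t. 2 * t - b) has_vector_derivative 2) (at t)"
      by (auto intro!: derivative_eq_intros)
    have "2 * t - b \<in> S" using assms(2) that by blast
    then have "(g has_vector_derivative D (2 * t - b)) (at (2 * t - b))" by (rule D(1))
    from vector_diff_chain_at[OF 1 this] show ?thesis by (simp only: o_def)
  qed
  moreover have "continuous_on T (\<lambda>t. 2 *\<^sub>R D (2 * t - b))"
    by (intro continuous_on_scaleR continuous_on_const continuous_on_compose2[OF D(2) _ assms(2)])
      (auto intro!: continuous_intros)
  ultimately show ?thesis unfolding C1_differentiable_on_def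
    by (intro exI[of _ "\<lambda>t. 2 *\<^sub>R D (2 * t - b)"] conjI allI ballI impI)
qed

lemma piecewise_C1_curve_join:
  assumes "piecewise_C1_curve c" "piecewise_C1_curve d" "c 1 = d 0"
  shows "piecewise_C1_curve (join c d)"
proof -
  obtain n \<tau> where n: "\<tau> 0 = (0::real)" "\<tau> n = 1" and \<tau>: "\<And>i. i < n \<Longrightarrow> \<tau> i < \<tau> (Suc i) \<and>
           (\<exists>g. g C1_differentiable_on {\<tau> i..\<tau> (Suc i)} \<and> (\<forall>t\<in>{\<tau> i..\<tau> (Suc i)}. c t = g t))"
    using assms(1) unfolding piecewise_C1_curve_def by blast
  obtain m \<sigma> where m: "\<sigma> 0 = (0::real)" "\<sigma> m = 1" and \<sigma>: "\<And>i. i < m \<Longrightarrow> \<sigma> i < \<sigma> (Suc i) \<and>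
           (\<exists>g. g C1_differentiable_on {\<sigma> i..\<sigma> (Suc i)} \<and> (\<forall>t\<in>{\<sigma> i..\<sigma> (Suc i)}. d t = g t))"
    using assms(2) unfolding piecewise_C1_curve_def by blast
  define \<rho> where "\<rho> i = (if i \<le> n then \<tau> i / 2 else (\<sigma> (i - n) + 1) / 2)" for i
  have mono\<tau>: "\<tau> i \<le> \<tau> j" if "i \<le> j" "j \<le> n" for i j
    using that
  proof (induction j rule: dec_induct)
    case (step k)
    then show ?case using \<tau>[of k] by simp
  qed simp
  have mono\<sigma>: "\<sigma> i \<le> \<sigma> j" if "i \<le> j" "j \<le> m" for i j
    using that
  proof (induction j rule: dec_induct)
    case (step k)
    then show ?case using \<sigma>[of k] by simp
  qed simp
  have "m > 0" using m by (cases m) auto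
  then have "\<rho> 0 = 0" "\<rho> (n + m) = 1" using n m by (auto simp: \<rho>_def)
  moreover have "\<rho> i < \<rho> (Suc i) \<and> (\<exists>g. g C1_differentiable_on {\<rho> i..\<rho> (Suc i)} \<and>
      (\<forall>t\<in>{\<rho> i..\<rho> (Suc i)}. join c d t = g t))" if i: "i < n + m" for i
  proof (cases "i < n")
    case True
    obtain g where g: "g C1_differentiable_on {\<tau> i..\<tau> (Suc i)}" "\<forall>t\<in>{\<tau> i..\<tau> (Suc i)}. c t = g t"
      using \<tau>[OF True] by blast
    have \<rho>: "\<rho> i = \<tau> i / 2" "\<rho> (Suc i) = \<tau> (Suc i) / 2" using True by (auto simp: \<rho>_def)
    have C1: "(\<lambda>t. g (2 * t - 0)) C1_differentiable_on {\<rho> i..\<rho> (Suc i)}"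
      by (rule C1_differentiable_on_affine[OF g(1)]) (auto simp: \<rho>)
    have 1: "\<tau> (Suc i) \<le> 1" using mono\<tau>[of "Suc i" n] True n by simp
    note C1
    moreover have "\<forall>t\<in>{\<rho> i..\<rho> (Suc i)}. join c d t = g (2 * t - 0)"
      using g(2) 1 by (auto simp: join_def \<rho>)
    moreover have "\<rho> i < \<rho> (Suc i)" using \<tau>[OF True] \<rho> by simp
    ultimately show ?thesis by blast
  next
    case False
    define j where "j = i - n"
    have j: "j < m" "i = n + j" using i False by (auto simp: j_def)
    obtain g where g: "g C1_differentiable_on {\<sigma> j..\<sigma> (Suc j)}" "\<forall>t\<in>{\<sigma> j..\<sigma> (Suc j)}. d t = g t"
      using \<sigma>[OF j(1)] by blast
    have \<rho>: "\<rho> i = (\<sigma> j + 1) / 2" "\<rho> (Suc i) = (\<sigma> (Suc j) + 1) / 2"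
      using j n m by (auto simp: \<rho>_def)
    have "(\<lambda>t. g (2 * t - 1)) C1_differentiable_on {\<rho> i..\<rho> (Suc i)}"
      by (rule C1_differentiable_on_affine[OF g(1)]) (auto simp: \<rho>)
    moreover have "\<forall>t\<in>{\<rho> i..\<rho> (Suc i)}. join c d t = g (2 * t - 1)"
    proof
      fix t assume t: "t \<in> {\<rho> i..\<rho> (Suc i)}"
      have "\<sigma> j \<ge> 0" using mono\<sigma>[of 0 j] j m by simp
      then have "t \<ge> 1/2" using t by (simp add: \<rho>)
      then have "join c d t = d (2 * t - 1)"
      proof (cases "t = 1/2")
        case True
        show ?thesis unfolding True using assms(3) by (simp add: join_def)
      qed (simp add: join_def)
      then show "join c d t = g (2 * t - 1)" using g(2) t by (auto simp: \<rho>)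
    qed
    moreover have "\<rho> i < \<rho> (Suc i)" using \<sigma>[OF j(1)] \<rho> by simp
    ultimately show ?thesis by blast
  qed
  ultimately show ?thesis unfolding piecewise_C1_curve_def
    by (intro exI[of _ "n + m"] exI[of _ \<rho>]) auto
qed

lemma join_has_vector_derivative:
  assumes "t \<noteq> 1/2" "t < 1/2 \<Longrightarrow> (f has_vector_derivative D) (at (2 * t))"
    "t > 1/2 \<Longrightarrow> (g has_vector_derivative D) (at (2 * t - 1))"
  shows "(join f g has_vector_derivative 2 *\<^sub>R D) (at t)"
proof (cases "t < 1/2")
  case True
  have "((\<lambda>t. 2 * t) has_vector_derivative 2) (at t)" by (auto intro!: derivative_eq_intros)
  then have "((\<lambda>t. f (2 * t)) has_vector_derivative 2 *\<^sub>R D) (at t)"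
    using vector_diff_chain_at[of "\<lambda>t. 2 * t" 2 t f D] assms(2)[OF True] by (simp add: o_def)
  then show ?thesis
    by (rule has_vector_derivative_transform_within_open[of _ _ _ "{..<1/2}"]) (use True in \<open>auto simp: join_def\<close>)
next
  case False
  then have t: "t > 1/2" using assms(1) by simp
  have "((\<lambda>t. 2 * t - 1) has_vector_derivative 2) (at t)" by (auto intro!: derivative_eq_intros)
  then have "((\<lambda>t. g (2 * t - 1)) has_vector_derivative 2 *\<^sub>R D) (at t)"
    using vector_diff_chain_at[of "\<lambda>t. 2 * t - 1" 2 t g D] assms(3)[OF t] by (simp add: o_def)
  then show ?thesis
    by (rule has_vector_derivative_transform_within_open[of _ _ _ "{1/2<..}"]) (use t in \<open>auto simp: join_def\<close>)
qed

lemma continuous_on_join: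
  assumes "continuous_on {0..1} f" "continuous_on {0..1} g" "f 1 = g 0"
  shows "continuous_on {0..1} (join f g)"
proof -
  have "continuous_on {0..1/2} (\<lambda>t. f (2 * t))"
    by (rule continuous_on_compose2[OF assms(1)]) (auto intro!: continuous_intros)
  moreover have "continuous_on {1/2..1} (\<lambda>t. g (2 * t - 1))"
    by (rule continuous_on_compose2[OF assms(2)]) (auto intro!: continuous_intros)
  moreover have "f (2 * t) = g (2 * t - 1)" if "t = 1/2" for t
    unfolding that using assms(3) by simp
  ultimately have "continuous_on ({0..1/2} \<union> {1/2..1}) (\<lambda>t. if t \<le> 1/2 then f (2 * t) else g (2 * t - 1))"
    by (intro continuous_on_If) force+
  moreover have "{0..1/2} \<union> {1/2..1} = {0..1::real}" by auto
  ultimately show ?thesis by (simp add: join_def[abs_def])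
qed

lemma parallel_along_join:
  assumes "parallel_along C F c X" "parallel_along C F d Y" "X 1 = Y 0" "c 1 = d 0"
  shows "parallel_along C F (join c d) (join X Y)"
proof -
  obtain S where S: "finite S" "\<And>t. t \<in> {0<..<1} - S \<Longrightarrow> c differentiable (at t) \<and>
        (X has_vector_derivative - (connection_coeff F (c t) (X t) *v vector_derivative c (at t))) (at t)"
    using assms(1) unfolding parallel_along_def by blast
  obtain T where T: "finite T" "\<And>t. t \<in> {0<..<1} - T \<Longrightarrow> d differentiable (at t) \<and>
        (Y has_vector_derivative - (connection_coeff F (d t) (Y t) *v vector_derivative d (at t))) (at t)"
    using assms(2) unfolding parallel_along_def by blast
  define R where "R = (\<lambda>t. t / 2) ` S \<union> (\<lambda>t. (t + 1) / 2) ` T \<union> {1/2}"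
  have "finite R" using S T by (simp add: R_def)
  moreover have "join c d differentiable (at t) \<and> (join X Y has_vector_derivative
      - (connection_coeff F (join c d t) (join X Y t) *v vector_derivative (join c d) (at t))) (at t)"
    if t: "t \<in> {0<..<1} - R" for t
  proof -
    have t2: "t \<noteq> 1/2" using t by (auto simp: R_def)
    define v where "v = (if t < 1/2 then vector_derivative c (at (2 * t)) else vector_derivative d (at (2 * t - 1)))"
    have 1: "2 * t \<in> {0<..<1} - S" if "t < 1/2"
    proof -
      have "2 * t \<in> S \<Longrightarrow> t \<in> (\<lambda>t. t / 2) ` S" by (rule image_eqI[of _ _ "2*t"]) auto
      then show ?thesis using t that by (auto simp: R_def)
    qed
    have 2: "2 * t - 1 \<in> {0<..<1} - T" if "t > 1/2"
    proof -
      have "2 * t - 1 \<in> T \<Longrightarrow> t \<in> (\<lambda>t. (t + 1) / 2) ` T" by (rule image_eqI[of _ _ "2*t-1"]) auto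
      then show ?thesis using t that by (auto simp: R_def)
    qed
    have c: "(join c d has_vector_derivative 2 *\<^sub>R v) (at t)"
      using S(2)[OF 1] T(2)[OF 2] t2
      by (intro join_has_vector_derivative) (auto simp: v_def vector_derivative_works)
    have "(join X Y has_vector_derivative 2 *\<^sub>R - (connection_coeff F (join c d t) (join X Y t) *v v)) (at t)"
      using S(2)[OF 1] T(2)[OF 2] t2
      by (intro join_has_vector_derivative) (auto simp: v_def join_def)
    then show ?thesis using c vector_derivative_at[OF c]
      by (auto simp: matrix_vector_mult_scaleR differentiableI_vector)
  qed
  moreover have "join X Y t \<in> C (join c d t)" if "t \<in> {0..1}" for t
    using that assms(1,2) by (auto simp: parallel_along_def join_def)
  moreover have "continuous_on {0..1} (join X Y)"
    using assms by (intro continuous_on_join) (auto simp: parallel_along_def)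
  ultimately show ?thesis unfolding parallel_along_def by blast
qed

lemma translation_compose:
  assumes "translation C F x y \<phi>" "translation C F y z \<psi>"
  shows "translation C F x z (\<lambda>v. \<psi> (\<phi> v))"
proof -
  obtain c where c: "piecewise_C1_curve c" "c 0 = x" "c 1 = y" 
     "\<And>v. v \<in> C x \<Longrightarrow> \<exists>X. parallel_along C F c X \<and> X 0 = v \<and> X 1 = \<phi> v"
    using assms(1) unfolding translation_def by blast
  obtain d where d: "piecewise_C1_curve d" "d 0 = y" "d 1 = z" 
     "\<And>v. v \<in> C y \<Longrightarrow> \<exists>X. parallel_along C F d X \<and> X 0 = v \<and> X 1 = \<psi> v"
    using assms(2) unfolding translation_def by blast
  have "\<exists>X. parallel_along C F (join c d) X \<and> X 0 = v \<and> X 1 = \<psi> (\<phi> v)" if v: "v \<in> C x" for v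
  proof -
    obtain X where X: "parallel_along C F c X" "X 0 = v" "X 1 = \<phi> v" using c(4)[OF v] by blast
    then have "\<phi> v \<in> C y" using c(3) by (auto simp: parallel_along_def dest!: bspec[of _ _ 1])
    then obtain Y where Y: "parallel_along C F d Y" "Y 0 = \<phi> v" "Y 1 = \<psi> (\<phi> v)" using d(4) by blast
    have "parallel_along C F (join c d) (join X Y)"
      using X Y c d by (intro parallel_along_join) auto
    then show ?thesis using X Y by (intro exI[of _ "join X Y"]) (auto simp: join_def)
  qed
  moreover have "piecewise_C1_curve (join c d)" "join c d 0 = x" "join c d 1 = z"
    using c(1-3) d(1-3) by (simp_all add: piecewise_C1_curve_join join_def)
  ultimately show ?thesis
    unfolding translation_def by blast
qed

section \<open>From commutators to one-parameter families\<close>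

lemma has_vector_derivative_chain:
  assumes "(F has_derivative D) (at (\<gamma> t))" "(\<gamma> has_vector_derivative v) (at t)"
  shows "((\<lambda>t. F (\<gamma> t)) has_vector_derivative D v) (at t)"
proof -
  have "((\<lambda>t. F (\<gamma> t)) has_derivative (\<lambda>h. D (h *\<^sub>R v))) (at t)"
    using has_derivative_compose[OF assms(2)[unfolded has_vector_derivative_def] assms(1)] .
  then show ?thesis
    by (simp add: has_vector_derivative_def linear_scale[OF has_derivative_linear[OF assms(1)]])
qed

lemma Ck_open_directional_derivative:
  "Ck_open (Suc k) U f \<Longrightarrow> Ck_open k U (\<lambda>x. frechet_derivative f (at x) v)"
  by simp

lemma norm_increment_le:
  fixes f :: "real \<Rightarrow> 'a::real_normed_vector"
  assumes "\<And>s. \<bar>s\<bar> < d \<Longrightarrow> (f has_vector_derivative D s) (at s)" "\<And>s. \<bar>s\<bar> < d \<Longrightarrow> norm (D s) \<le> B" "\<bar>s\<bar> < d"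
  shows "norm (f s - f 0) \<le> B * \<bar>s\<bar>"
proof -
  have "norm (f s - f 0) \<le> B * norm (s - 0)"
  proof (rule differentiable_bound[where S="{-d<..<d}" and f'="\<lambda>x h. h *\<^sub>R D x"])
    show "(f has_derivative (\<lambda>h. h *\<^sub>R D x)) (at x within {-d<..<d})" if "x \<in> {-d<..<d}" for x
      using assms(1)[of x] that by (auto simp: has_vector_derivative_def intro: has_derivative_at_withinI)
    show "onorm (\<lambda>h. h *\<^sub>R D x) \<le> B" if "x \<in> {-d<..<d}" for x
      using assms(2)[of x] that by (intro onorm_le) (auto simp: mult.commute[of B] mult_left_mono)
  qed (use assms(3) in auto)
  then show ?thesis by simp
qed

text \<open>A family that is trivial for \<open>s = 0\<close> and for \<open>t = 0\<close> has the expansion \<open>C (s, t, u) \<approx> u + s t Z(u)\<close>. The mean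
  value estimate is applied first in \<open>s\<close> to the derivative in \<open>t\<close>, which vanishes at \<open>s = 0\<close>, and then in
  \<open>t\<close>; this keeps the errors relative to \<open>s\<close> and to \<open>s t\<close>, locally uniformly in \<open>u\<close>.\<close>
lemma mixed_derivative_estimate:
  fixes C :: "real \<times> real \<times> 'a::euclidean_space \<Rightarrow> 'a"
  assumes U: "open U" and C: "Ck_open (Suc (Suc 0)) (UNIV \<times> UNIV \<times> U) C"
    and C0: "\<And>s u. u \<in> U \<Longrightarrow> C (s, 0, u) = u" "\<And>t u. u \<in> U \<Longrightarrow> C (0, t, u) = u"
    and u0: "u0 \<in> U" and e: "e > 0"
  defines "Ct \<equiv> \<lambda>z. frechet_derivative C (at z) (0, 1, 0)"
  defines "Z \<equiv> \<lambda>u. frechet_derivative Ct (at (0, 0, u)) (1, 0, 0)"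
  shows "\<exists>d>0. \<forall>s t u. \<bar>s\<bar> < d \<longrightarrow> \<bar>t\<bar> < d \<longrightarrow> dist u u0 < d \<longrightarrow> u \<in> U \<and> norm (Z u - Z u0) \<le> e \<and>
     norm (Ct (s, t, u) - s *\<^sub>R Z u0) \<le> e * \<bar>s\<bar> \<and> norm (C (s, t, u) - u - (s * t) *\<^sub>R Z u0) \<le> e * \<bar>s * t\<bar>"
proof -
  define W where "W = (UNIV :: real set) \<times> (UNIV :: real set) \<times> U"
  have W: "open W" unfolding W_def by (intro open_Times open_UNIV U)
  have Ct: "Ck_open (Suc 0) W Ct" using C by (simp add: Ct_def W_def)
  define Cts where "Cts z = frechet_derivative Ct (at z) (1, 0, 0)" for z
  have "continuous_on W Cts" using Ct by (simp add: Cts_def)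
  then have "isCont Cts (0, 0, u0)"
    using W u0 by (simp add: continuous_on_eq_continuous_at W_def)
  then obtain d1 where d1: "d1 > 0" "\<And>z. dist z (0, 0, u0) < d1 \<Longrightarrow> dist (Cts z) (Cts (0, 0, u0)) < e"
    unfolding continuous_at_eps_delta using e by metis
  obtain d2 where d2: "d2 > 0" "\<And>u. dist u u0 < d2 \<Longrightarrow> u \<in> U"
    using U u0 unfolding open_dist by metis
  \<comment> \<open>The distance of triples is at most the sum of the three distances of their components.\<close>
  define d where "d = min (d1 / 3) d2"
  have d: "d > 0" using d1 d2 by (simp add: d_def)
  have near: "norm (Cts (s, t, u) - Z u0) \<le> e" if "\<bar>s\<bar> < d" "\<bar>t\<bar> < d" "dist u u0 < d" for s t u
  proof -
    have "dist (s, t, u) (0, 0, u0) \<le> \<bar>s\<bar> + (\<bar>t\<bar> + norm (u - u0))"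
      unfolding dist_norm using norm_Pair_le[of s "(t, u - u0)"] norm_Pair_le[of t "u - u0"] by simp
    also have "\<dots> < d1" using that by (simp add: d_def dist_norm)
    finally have "dist (Cts (s, t, u)) (Cts (0, 0, u0)) < e" by (rule d1)
    then show ?thesis by (simp add: dist_norm Cts_def Z_def)
  qed
  have "u \<in> U \<and> norm (Z u - Z u0) \<le> e \<and>
     norm (Ct (s, t, u) - s *\<^sub>R Z u0) \<le> e * \<bar>s\<bar> \<and> norm (C (s, t, u) - u - (s * t) *\<^sub>R Z u0) \<le> e * \<bar>s * t\<bar>"
    if st: "\<bar>s\<bar> < d" "\<bar>t\<bar> < d" and u: "dist u u0 < d" for s t u
  proof -
    have uU: "u \<in> U" using d2 u by (simp add: d_def)
    then have inW: "(s, t, u) \<in> W" for s t by (simp add: W_def)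
    have C_t: "((\<lambda>t. C (s, t, u)) has_vector_derivative Ct (s, t, u)) (at t)" for s t
      unfolding Ct_def
      by (rule has_vector_derivative_chain[OF Ck_open_Suc_has_derivative[OF C[folded W_def] inW]])
        (intro has_vector_derivative_Pair has_vector_derivative_const has_vector_derivative_id)
    have C_ts: "((\<lambda>s. Ct (s, t, u)) has_vector_derivative Cts (s, t, u)) (at s)" for s t
      unfolding Cts_def zero_prod_def
      by (rule has_vector_derivative_chain[OF Ck_open_Suc_has_derivative[OF Ct inW]])
        (intro has_vector_derivative_Pair has_vector_derivative_const has_vector_derivative_id)
    have "((\<lambda>t. C (0, t, u)) has_vector_derivative 0) (at t)" for t
      using C0(2)[OF uU] by simp
    then have Ct0: "Ct (0, t, u) = 0" for t
      using C_t vector_derivative_unique_at by blast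
    have Ct_le: "norm (Ct (s, t, u) - s *\<^sub>R Z u0) \<le> e * \<bar>s\<bar>" if t: "\<bar>t\<bar> < d" for t
    proof -
      have "norm ((Ct (s, t, u) - s *\<^sub>R Z u0) - (Ct (0, t, u) - 0 *\<^sub>R Z u0)) \<le> e * \<bar>s\<bar>"
      proof (rule norm_increment_le[where d=d])
        show "((\<lambda>s. Ct (s, t, u) - s *\<^sub>R Z u0) has_vector_derivative Cts (s, t, u) - Z u0) (at s)" for s
          by (rule derivative_eq_intros C_ts refl | simp)+
      qed (use near st(1) t u in auto)
      then show ?thesis by (simp add: Ct0)
    qed
    have "norm ((C (s, t, u) - u - (s * t) *\<^sub>R Z u0) - (C (s, 0, u) - u - (s * 0) *\<^sub>R Z u0)) \<le> (e * \<bar>s\<bar>) * \<bar>t\<bar>"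
    proof (rule norm_increment_le[where d=d])
      show "((\<lambda>t. C (s, t, u) - u - (s * t) *\<^sub>R Z u0) has_vector_derivative Ct (s, t, u) - s *\<^sub>R Z u0) (at t)" for t
        by (rule derivative_eq_intros C_t refl | simp)+
    qed (use Ct_le st(2) in auto)
    moreover have "norm (Z u - Z u0) \<le> e" using near[of 0 0 u] d u by (simp add: Z_def Cts_def)
    ultimately show ?thesis using uU Ct_le[OF st(2)] C0 by (simp add: abs_mult mult.assoc)
  qed
  then show ?thesis using d by blast
qed

text \<open>The same expansion for both first derivatives. Exchanging the parameters gives the estimate for the
  derivative in \<open>s\<close>, with the mixed derivative taken in the other order. The two orders agree, since
  both are the coefficient of \<open>s t\<close> in the expansion of \<open>C\<close>.\<close>
lemma commutator_estimate:
  fixes C :: "real \<times> real \<times> 'a::euclidean_space \<Rightarrow> 'a"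
  assumes U: "open U" and C: "Ck_open (Suc (Suc 0)) (UNIV \<times> UNIV \<times> U) C"
    and C0: "\<And>s u. u \<in> U \<Longrightarrow> C (s, 0, u) = u" "\<And>t u. u \<in> U \<Longrightarrow> C (0, t, u) = u"
    and u0: "u0 \<in> U" and e: "e > 0"
  defines "Cs \<equiv> \<lambda>z. frechet_derivative C (at z) (1, 0, 0)"
  defines "Ct \<equiv> \<lambda>z. frechet_derivative C (at z) (0, 1, 0)"
  defines "Z \<equiv> \<lambda>u. frechet_derivative Ct (at (0, 0, u)) (1, 0, 0)"
  shows "\<exists>d>0. \<forall>s t u. \<bar>s\<bar> < d \<longrightarrow> \<bar>t\<bar> < d \<longrightarrow> dist u u0 < d \<longrightarrow> u \<in> U \<and> norm (Z u - Z u0) \<le> e \<and>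
     norm (Cs (s, t, u) - t *\<^sub>R Z u0) \<le> e * \<bar>t\<bar> \<and>
     norm (Ct (s, t, u) - s *\<^sub>R Z u0) \<le> e * \<bar>s\<bar> \<and> norm (C (s, t, u) - u - (s * t) *\<^sub>R Z u0) \<le> e * \<bar>s * t\<bar>"
proof -
  define W where "W = (UNIV :: real set) \<times> (UNIV :: real set) \<times> U"
  have W: "open W" unfolding W_def by (intro open_Times open_UNIV U)
  define R where "R z = (fst (snd z), fst z, snd (snd z))" for z :: "real \<times> real \<times> 'a"
  have R: "bounded_linear R" unfolding R_def
    by (intro bounded_linear_Pair bounded_linear_fst bounded_linear_snd
        bounded_linear_compose[OF bounded_linear_fst] bounded_linear_compose[OF bounded_linear_snd])
  define C' where "C' z = C (R z)" for z
  have C': "Ck_open (Suc (Suc 0)) (UNIV \<times> UNIV \<times> U) C'"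
    unfolding C'_def using W by (intro Ck_open_compose[OF _ _ _ Ck_open_linear[OF R] C]) (auto simp: W_def R_def)
  define Ct' where "Ct' = (\<lambda>z. frechet_derivative C' (at z) (0, 1, 0))"
  define Z' where "Z' = (\<lambda>u. frechet_derivative Ct' (at (0, 0, u)) (1, 0, 0))"
  have swap: "Ct' (t, s, u) = Cs (s, t, u)" if "u \<in> U" for s t u
  proof -
    have "(C has_derivative frechet_derivative C (at (R (t, s, u)))) (at (R (t, s, u)))"
      by (rule Ck_open_Suc_has_derivative[OF C]) (use that in \<open>simp add: R_def\<close>)
    then have "(C' has_derivative (\<lambda>v. frechet_derivative C (at (R (t, s, u))) (R v))) (at (t, s, u))"
      unfolding C'_def using has_derivative_compose[OF bounded_linear_imp_has_derivative[OF R]] by blast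
    from fun_cong[OF frechet_derivative_at[OF this], of "(0, 1, 0)"] show ?thesis
      by (simp add: Ct'_def Cs_def R_def)
  qed
  have est: "\<exists>d>0. \<forall>s t u. \<bar>s\<bar> < d \<longrightarrow> \<bar>t\<bar> < d \<longrightarrow> dist u u0 < d \<longrightarrow> u \<in> U \<and> norm (Z u - Z u0) \<le> e \<and>
     norm (Ct (s, t, u) - s *\<^sub>R Z u0) \<le> e * \<bar>s\<bar> \<and> norm (C (s, t, u) - u - (s * t) *\<^sub>R Z u0) \<le> e * \<bar>s * t\<bar>"
    if "e > 0" for e
    unfolding Z_def Ct_def by (rule mixed_derivative_estimate[OF U C C0 u0 that])
  have C0': "C' (s, 0, u) = u" "C' (0, t, u) = u" if "u \<in> U" for s t u
    using C0 that by (auto simp: C'_def R_def)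
  have est': "\<exists>d>0. \<forall>s t u. \<bar>s\<bar> < d \<longrightarrow> \<bar>t\<bar> < d \<longrightarrow> dist u u0 < d \<longrightarrow> u \<in> U \<and> norm (Z' u - Z' u0) \<le> e \<and>
     norm (Ct' (s, t, u) - s *\<^sub>R Z' u0) \<le> e * \<bar>s\<bar> \<and> norm (C' (s, t, u) - u - (s * t) *\<^sub>R Z' u0) \<le> e * \<bar>s * t\<bar>"
    if "e > 0" for e
    unfolding Z'_def Ct'_def by (rule mixed_derivative_estimate[OF U C' C0' u0 that])
  have "norm (Z' u0 - Z u0) \<le> 2 * e" if e: "e > 0" for e
  proof -
    obtain d where d: "d > 0" "\<And>s. \<bar>s\<bar> < d \<Longrightarrow> norm (C (s, s, u0) - u0 - (s * s) *\<^sub>R Z u0) \<le> e * \<bar>s * s\<bar>"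
      using est[OF e] u0 by (metis dist_self)
    obtain d' where d': "d' > 0" "\<And>s. \<bar>s\<bar> < d' \<Longrightarrow> norm (C' (s, s, u0) - u0 - (s * s) *\<^sub>R Z' u0) \<le> e * \<bar>s * s\<bar>"
      using est'[OF e] u0 by (metis dist_self)
    define s where "s = min d d' / 2"
    have s: "s > 0" "s < d" "s < d'" using d d' by (auto simp: s_def)
    have "norm ((s * s) *\<^sub>R (Z' u0 - Z u0)) = norm ((C (s, s, u0) - u0 - (s * s) *\<^sub>R Z u0) - (C' (s, s, u0) - u0 - (s * s) *\<^sub>R Z' u0))"
      by (simp add: C'_def R_def algebra_simps)
    also have "\<dots> \<le> e * (s * s) + e * (s * s)"
      by (rule order.trans[OF norm_triangle_ineq4 add_mono]) (use d(2)[of s] d'(2)[of s] s in auto)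
    finally have "(s * s) * norm (Z' u0 - Z u0) \<le> (s * s) * (2 * e)" using s by simp
    then show ?thesis using s by simp
  qed
  \<comment> \<open>With a quarter of the norm as error the estimate bounds the norm by half of itself.\<close>
  from this[of "norm (Z' u0 - Z u0) / 4"] have ZZ': "Z' u0 = Z u0" by fastforce
  obtain d where d: "d > 0" "\<And>s t u. \<bar>s\<bar> < d \<Longrightarrow> \<bar>t\<bar> < d \<Longrightarrow> dist u u0 < d \<Longrightarrow> u \<in> U \<and> norm (Z u - Z u0) \<le> e \<and>
     norm (Ct (s, t, u) - s *\<^sub>R Z u0) \<le> e * \<bar>s\<bar> \<and> norm (C (s, t, u) - u - (s * t) *\<^sub>R Z u0) \<le> e * \<bar>s * t\<bar>"
    using est[OF e] by blast
  obtain d' where d': "d' > 0" "\<And>s t u. \<bar>s\<bar> < d' \<Longrightarrow> \<bar>t\<bar> < d' \<Longrightarrow> dist u u0 < d' \<Longrightarrow> u \<in> U \<and>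
     norm (Ct' (s, t, u) - s *\<^sub>R Z' u0) \<le> e * \<bar>s\<bar>"
    using est'[OF e] by blast
  show ?thesis
  proof (intro exI[of _ "min d d'"] conjI allI impI)
    fix s t u assume "\<bar>s\<bar> < min d d'" "\<bar>t\<bar> < min d d'" "dist u u0 < min d d'"
    then have 1: "u \<in> U \<and> norm (Z u - Z u0) \<le> e \<and>
     norm (Ct (s, t, u) - s *\<^sub>R Z u0) \<le> e * \<bar>s\<bar> \<and> norm (C (s, t, u) - u - (s * t) *\<^sub>R Z u0) \<le> e * \<bar>s * t\<bar>"
      and 2: "u \<in> U \<and> norm (Ct' (t, s, u) - t *\<^sub>R Z' u0) \<le> e * \<bar>t\<bar>"
      using d(2)[of s t u] d'(2)[of t s u] by auto
    then show "u \<in> U" "norm (Z u - Z u0) \<le> e" "norm (Ct (s, t, u) - s *\<^sub>R Z u0) \<le> e * \<bar>s\<bar>"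
      "norm (C (s, t, u) - u - (s * t) *\<^sub>R Z u0) \<le> e * \<bar>s * t\<bar>" by auto
    show "norm (Cs (s, t, u) - t *\<^sub>R Z u0) \<le> e * \<bar>t\<bar>" using 2 swap[of u t s] ZZ' by simp
  qed (use d d' in simp)
qed

text \<open>On negative numbers \<open>sqrt\<close> is minus the root of the absolute value, so the parameters \<open>sqrt r\<close> and
  \<open>\<bar>sqrt r\<bar>\<close> have product \<open>r\<close> for all real \<open>r\<close>. For \<open>r \<noteq> 0\<close> the derivative in \<open>r\<close> is half the sum of \<open>C\<^sub>s / t\<close>
  and \<open>C\<^sub>t / s\<close>; by the preceding estimates it extends continuously to \<open>r = 0\<close> by the mixed derivative,
  and the expansion of \<open>C\<close> shows that this is the derivative there. The field \<open>X\<close> is identified as that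
  mixed derivative through \<open>Y\<close>, the derivative in \<open>t\<close> at \<open>t = 0\<close>.\<close>
lemma square_root_reparametrisation:
  fixes C :: "real \<times> real \<times> 'a::euclidean_space \<Rightarrow> 'a"
  assumes U: "open U" and C: "Ck_open (Suc (Suc 0)) (UNIV \<times> UNIV \<times> U) C"
    and C0: "\<And>s u. u \<in> U \<Longrightarrow> C (s, 0, u) = u" "\<And>t u. u \<in> U \<Longrightarrow> C (0, t, u) = u"
    and Y: "\<And>s u. u \<in> U \<Longrightarrow> ((\<lambda>t. C (s, t, u)) has_vector_derivative Y u s) (at 0)"
    and X: "\<And>u. u \<in> U \<Longrightarrow> (Y u has_vector_derivative X u) (at 0)"
  defines "h \<equiv> \<lambda>z. C (sqrt (fst z), \<bar>sqrt (fst z)\<bar>, snd z)"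
  shows "Ck_open (Suc 0) (UNIV \<times> U) h"
    and "u \<in> U \<Longrightarrow> ((\<lambda>\<tau>. h (\<tau>, u)) has_vector_derivative X u) (at 0)"
proof -
  define W where "W = (UNIV :: real set) \<times> (UNIV :: real set) \<times> U"
  have W: "open W" unfolding W_def by (intro open_Times open_UNIV U)
  define DC where "DC z = frechet_derivative C (at z)" for z
  have DC: "(C has_derivative DC z) (at z)" if "z \<in> W" for z
    unfolding DC_def by (rule Ck_open_Suc_has_derivative[OF C]) (use that in \<open>simp add: W_def\<close>)
  have linDC: "linear (DC z)" if "z \<in> W" for z using has_derivative_linear[OF DC[OF that]] .
  have contDC: "continuous_on W (\<lambda>z. DC z v)" for v
    unfolding DC_def W_def
    by (rule Ck_open_imp_continuous_on[OF Ck_open_directional_derivative[OF C]])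
  define Cs where "Cs z = DC z (1, 0, 0)" for z
  define Ct where "Ct z = DC z (0, 1, 0)" for z
  define Z where "Z u = frechet_derivative Ct (at (0, 0, u)) (1, 0, 0)" for u
  have ZX: "Z u = X u" if u: "u \<in> U" for u
  proof -
    have inW: "(s, t, u) \<in> W" for s t using u by (simp add: W_def)
    have "((\<lambda>t. C (s, t, u)) has_vector_derivative Ct (s, 0, u)) (at 0)" for s
      unfolding Ct_def 
      by (rule has_vector_derivative_chain[OF DC[OF inW]])
        (intro has_vector_derivative_Pair has_vector_derivative_const has_vector_derivative_id)
    then have "Ct (s, 0, u) = Y u s" for s
      using Y[OF u] vector_derivative_unique_at by blast
    then have Yeq: "Y u = (\<lambda>s. Ct (s, 0, u))" by auto
    have "Ck_open (Suc 0) W Ct" unfolding Ct_def[abs_def] DC_def using C by (simp add: W_def)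
    then have "((\<lambda>s. Ct (s, 0, u)) has_vector_derivative Z u) (at 0)"
      unfolding Z_def zero_prod_def
      by (rule has_vector_derivative_chain[OF Ck_open_Suc_has_derivative[OF _ inW]])
        (intro has_vector_derivative_Pair has_vector_derivative_const has_vector_derivative_id)
    then show ?thesis using X[OF u] vector_derivative_unique_at unfolding Yeq by blast
  qed
  have est: "\<exists>d>0. \<forall>s t u. \<bar>s\<bar> < d \<longrightarrow> \<bar>t\<bar> < d \<longrightarrow> dist u u0 < d \<longrightarrow> u \<in> U \<and> norm (Z u - Z u0) \<le> e \<and>
     norm (Cs (s, t, u) - t *\<^sub>R Z u0) \<le> e * \<bar>t\<bar> \<and>
     norm (Ct (s, t, u) - s *\<^sub>R Z u0) \<le> e * \<bar>s\<bar> \<and> norm (C (s, t, u) - u - (s * t) *\<^sub>R Z u0) \<le> e * \<bar>s * t\<bar>"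
    if "u0 \<in> U" "e > 0" for u0 e
    using commutator_estimate[OF U C C0 that] unfolding Cs_def Ct_def Z_def DC_def by blast
  define \<rho> where "\<rho> z = (sqrt (fst z), \<bar>sqrt (fst z)\<bar>, snd z)" for z :: "real \<times> 'a"
  have h: "h z = C (\<rho> z)" for z by (simp add: h_def \<rho>_def)
  have \<rho>W: "\<rho> z \<in> W" if "z \<in> UNIV \<times> U" for z using that by (auto simp: \<rho>_def W_def)
  have \<rho>_cont: "continuous_on S \<rho>" for S
    unfolding \<rho>_def by (intro continuous_intros)
  define H where "H z = (if fst z = 0 then Z (snd z)
     else (1/2) *\<^sub>R ((1 / \<bar>sqrt (fst z)\<bar>) *\<^sub>R Cs (\<rho> z) + (1 / sqrt (fst z)) *\<^sub>R Ct (\<rho> z)))" for z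
  define D where "D z v = fst v *\<^sub>R H z + DC (\<rho> z) (0, 0, snd v)" for z v
  have st: "sqrt \<tau> * \<bar>sqrt \<tau>\<bar> = \<tau>" for \<tau>
  proof (cases "\<tau> \<ge> 0")
    case False
    then have "sqrt \<tau> * \<bar>sqrt \<tau>\<bar> = - (sqrt (- \<tau>) * sqrt (- \<tau>))" by (simp add: real_sqrt_minus)
    with False show ?thesis by simp
  qed simp
  have small: "\<bar>sqrt \<tau>\<bar> < d" if "\<bar>\<tau>\<bar> < d\<^sup>2" "d > 0" for \<tau> d
  proof -
    have "\<bar>sqrt \<tau>\<bar> = sqrt \<bar>\<tau>\<bar>" by (cases "\<tau> \<ge> 0") (auto simp: real_sqrt_minus)
    also have "\<dots> < d" using that real_sqrt_less_mono[of "\<bar>\<tau>\<bar>" "d\<^sup>2"] by simp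
    finally show ?thesis .
  qed
  \<comment> \<open>As \<open>C (0, 0, u) = u\<close>, the derivative of \<open>C\<close> in \<open>u\<close> is the identity at \<open>r = 0\<close>.\<close>
  have D0: "D (0, u) v = fst v *\<^sub>R Z u + snd v" if u: "u \<in> U" for u v
  proof -
    have "((\<lambda>u. C (0, 0, u)) has_derivative (\<lambda>v. DC (0, 0, u) (0, 0, v))) (at u)"
      by (rule has_derivative_compose[OF _ DC]) (auto intro!: derivative_eq_intros simp: W_def u)
    moreover have "((\<lambda>u. C (0, 0, u)) has_derivative (\<lambda>v. v)) (at u)"
      by (rule has_derivative_transform_within_open[OF has_derivative_ident U u]) (simp add: C0)
    ultimately have "(\<lambda>v. DC (0, 0, u) (0, 0, v)) = (\<lambda>v. v)"
      by (rule has_derivative_unique)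
    from fun_cong[OF this] show ?thesis by (simp add: D_def H_def \<rho>_def)
  qed
  have hD: "(h has_derivative D z) (at z)" if "z \<in> UNIV \<times> U" for z
  proof (cases "fst z = 0")
    case False
    define \<tau> where "\<tau> = fst z"
    have "\<tau> \<noteq> 0" using False by (simp add: \<tau>_def)
    have 1: "(sqrt has_real_derivative 1 / (2 * \<bar>sqrt \<tau>\<bar>)) (at \<tau>)"
      using \<open>\<tau> \<noteq> 0\<close> by (intro DERIV_real_sqrt_generic) (auto simp: field_simps)
    have 2: "((\<lambda>\<tau>. \<bar>sqrt \<tau>\<bar>) has_real_derivative 1 / (2 * sqrt \<tau>)) (at \<tau>)"
    proof (cases "\<tau> > 0")
      case True
      show ?thesis 
        by (rule has_field_derivative_transform_within_open[of sqrt _ _ "{0<..}"])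
          (use 1 True in auto)
    next
      case neg: False
      then have "\<tau> < 0" using \<open>\<tau> \<noteq> 0\<close> by simp
      moreover have "((\<lambda>\<tau>. - sqrt \<tau>) has_real_derivative 1 / (2 * sqrt \<tau>)) (at \<tau>)"
        using DERIV_minus[OF 1] \<open>\<tau> < 0\<close> by (simp add: abs_if)
      ultimately show ?thesis
        by - (rule has_field_derivative_transform_within_open[of "\<lambda>\<tau>. - sqrt \<tau>" _ _ "{..<0}"], auto simp: abs_if)
    qed
    have "(\<rho> has_derivative (\<lambda>v. (fst v * (1 / (2 * \<bar>sqrt \<tau>\<bar>)), fst v * (1 / (2 * sqrt \<tau>)), snd v))) (at z)"
      unfolding \<rho>_def
    proof (rule has_derivative_Pair[OF _ has_derivative_Pair[OF _ has_derivative_snd[OF has_derivative_ident]]])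
      show "((\<lambda>z. sqrt (fst z)) has_derivative (\<lambda>v. fst v * (1 / (2 * \<bar>sqrt \<tau>\<bar>)))) (at z)"
        using has_derivative_compose[OF has_derivative_fst[OF has_derivative_ident] 1[unfolded has_field_derivative_def \<tau>_def]]
        unfolding \<tau>_def by (rule has_derivative_eq_rhs) (simp add: fun_eq_iff)
      show "((\<lambda>z. \<bar>sqrt (fst z)\<bar>) has_derivative (\<lambda>v. fst v * (1 / (2 * sqrt \<tau>)))) (at z)"
        using has_derivative_compose[OF has_derivative_fst[OF has_derivative_ident] 2[unfolded has_field_derivative_def \<tau>_def]]
        unfolding \<tau>_def by (rule has_derivative_eq_rhs) (simp add: fun_eq_iff)
    qed
    from has_derivative_compose[OF this DC[OF \<rho>W[OF that]]]
    have hh: "(h has_derivative (\<lambda>v. DC (\<rho> z) (fst v * (1 / (2 * \<bar>sqrt \<tau>\<bar>)), fst v * (1 / (2 * sqrt \<tau>)), snd v))) (at z)"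
      by (simp add: h[abs_def])
    have split: "DC (\<rho> z) (a, b, v) = a *\<^sub>R Cs (\<rho> z) + b *\<^sub>R Ct (\<rho> z) + DC (\<rho> z) (0, 0, v)" for a b v
    proof -
      have "(a, b, v) = a *\<^sub>R (1, 0, 0) + b *\<^sub>R (0, 1, 0) + (0, 0, v)" by simp
      then show ?thesis
        unfolding Cs_def Ct_def using linDC[OF \<rho>W[OF that]] by (simp only: linear_add linear_scale)
    qed
    have "D z = (\<lambda>v. DC (\<rho> z) (fst v * (1 / (2 * \<bar>sqrt \<tau>\<bar>)), fst v * (1 / (2 * sqrt \<tau>)), snd v))"
      unfolding split[of "fst v * (1 / (2 * \<bar>sqrt \<tau>\<bar>))" for v] D_def[abs_def]
      using False by (simp add: H_def \<tau>_def scaleR_add_right)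
    with hh show ?thesis by simp
  next
    case True
    define u0 where "u0 = snd z"
    have z: "z = (0, u0)" using True by (simp add: u0_def prod_eq_iff)
    have u0: "u0 \<in> U" using that by (auto simp: u0_def)
    have D: "D z = (\<lambda>v. fst v *\<^sub>R Z u0 + snd v)" using D0[OF u0] by (auto simp: z)
    show ?thesis unfolding has_derivative_at_alt
    proof (intro conjI allI impI)
      show "bounded_linear (D z)" unfolding D
        by (intro bounded_linear_add bounded_linear_snd bounded_linear_compose[OF bounded_linear_scaleR_left bounded_linear_fst])
      fix e :: real assume "e > 0"
      from est[OF u0 this] obtain d where d: "d > 0" and est: "\<And>s t u. \<bar>s\<bar> < d \<Longrightarrow> \<bar>t\<bar> < d \<Longrightarrow> dist u u0 < d \<Longrightarrow>
          norm (C (s, t, u) - u - (s * t) *\<^sub>R Z u0) \<le> e * \<bar>s * t\<bar>" by blast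
      show "\<exists>d>0. \<forall>y. norm (y - z) < d \<longrightarrow> norm (h y - h z - D z (y - z)) \<le> e * norm (y - z)"
      \<comment> \<open>\<open>sqrt \<tau>\<close> stays below \<open>d\<close> only if \<open>\<tau>\<close> stays below \<open>d\<^sup>2\<close>.\<close>
      proof (intro exI[of _ "min d (d\<^sup>2)"] conjI allI impI)
        fix y assume y: "norm (y - z) < min d (d\<^sup>2)"
        define \<tau> u where "\<tau> = fst y" and "u = snd y"
        have yeq: "y = (\<tau>, u)" by (simp add: \<tau>_def u_def)
        have "\<bar>\<tau>\<bar> \<le> norm (y - z)" "dist u u0 \<le> norm (y - z)"
          using norm_fst_le[of \<tau> "u - u0"] norm_snd_le[of "u - u0" \<tau>] by (simp_all add: yeq z dist_norm)
        then have "\<bar>sqrt \<tau>\<bar> < d" "dist u u0 < d" using y d by (auto intro!: small)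
        then have "norm (C (\<rho> y) - u - \<tau> *\<^sub>R Z u0) \<le> e * \<bar>\<tau>\<bar>"
          using est[of "sqrt \<tau>" "\<bar>sqrt \<tau>\<bar>" u] by (simp add: st \<rho>_def yeq)
        also have "\<dots> \<le> e * norm (y - z)" using \<open>\<bar>\<tau>\<bar> \<le> norm (y - z)\<close> \<open>e > 0\<close> by simp
        also have "C (\<rho> y) - u - \<tau> *\<^sub>R Z u0 = h y - h z - D z (y - z)"
          using C0(1)[OF u0, of 0] by (simp add: h D0[OF u0] yeq z \<rho>_def)
        finally show "norm (h y - h z - D z (y - z)) \<le> e * norm (y - z)" .
      qed (use d in simp)
    qed
  qed
  have HC: "isCont H z" if z: "z \<in> UNIV \<times> U" for z
  proof (cases "fst z = 0")
    case False
    define V where "V = {z :: real \<times> 'a. fst z \<noteq> 0} \<inter> UNIV \<times> U"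
    have V: "open V" unfolding V_def by (intro open_Int open_Times U open_UNIV open_Collect_neq continuous_intros)
    have "continuous_on V (\<lambda>z. Cs (\<rho> z))" "continuous_on V (\<lambda>z. Ct (\<rho> z))"
      unfolding Cs_def Ct_def by (rule continuous_on_compose2[OF contDC \<rho>_cont]; use \<rho>W V_def in auto)+
    then have "continuous_on V (\<lambda>z. (1/2) *\<^sub>R ((1 / \<bar>sqrt (fst z)\<bar>) *\<^sub>R Cs (\<rho> z) + (1 / sqrt (fst z)) *\<^sub>R Ct (\<rho> z)))"
      by (auto intro!: continuous_intros simp: V_def)
    then have "continuous_on V H"
      by (rule continuous_on_eq) (simp add: H_def V_def)
    then show ?thesis using V z False by (simp add: continuous_on_eq_continuous_at V_def)
  next
    case True
    define u0 where "u0 = snd z"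
    have zeq: "z = (0, u0)" using True by (simp add: u0_def prod_eq_iff)
    have u0: "u0 \<in> U" using z by (auto simp: u0_def)
    show ?thesis unfolding continuous_at_eps_delta
    proof (intro allI impI)
      fix e :: real assume "e > 0"
      then have e2: "e / 2 > 0" by simp
      from est[OF u0 e2] obtain d where d: "d > 0" and est: "\<And>s t u. \<bar>s\<bar> < d \<Longrightarrow> \<bar>t\<bar> < d \<Longrightarrow> dist u u0 < d \<Longrightarrow>
          norm (Z u - Z u0) \<le> e / 2 \<and> norm (Cs (s, t, u) - t *\<^sub>R Z u0) \<le> e / 2 * \<bar>t\<bar> \<and>
          norm (Ct (s, t, u) - s *\<^sub>R Z u0) \<le> e / 2 * \<bar>s\<bar>" by blast
      show "\<exists>d>0. \<forall>y. dist y z < d \<longrightarrow> dist (H y) (H z) < e"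
      proof (intro exI[of _ "min d (d\<^sup>2)"] conjI allI impI)
        fix y assume y: "dist y z < min d (d\<^sup>2)"
        define \<tau> u where "\<tau> = fst y" and "u = snd y"
        have yeq: "y = (\<tau>, u)" by (simp add: \<tau>_def u_def)
        have "\<bar>\<tau>\<bar> \<le> dist y z" "dist u u0 \<le> dist y z"
          using norm_fst_le[of \<tau> "u - u0"] norm_snd_le[of "u - u0" \<tau>] by (simp_all add: yeq zeq dist_norm)
        then have "\<bar>sqrt \<tau>\<bar> < d" "dist u u0 < d" using y d by (auto intro!: small)
        then have E: "norm (Z u - Z u0) \<le> e / 2" "norm (Cs (\<rho> y) - \<bar>sqrt \<tau>\<bar> *\<^sub>R Z u0) \<le> e / 2 * \<bar>sqrt \<tau>\<bar>"
            "norm (Ct (\<rho> y) - sqrt \<tau> *\<^sub>R Z u0) \<le> e / 2 * \<bar>sqrt \<tau>\<bar>"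
          using est[of "sqrt \<tau>" "\<bar>sqrt \<tau>\<bar>" u] by (simp_all add: \<rho>_def yeq)
        have "norm (H y - Z u0) \<le> e / 2"
        proof (cases "\<tau> = 0")
          case True
          then show ?thesis using E(1) by (simp add: H_def yeq)
        next
          case False
          have scale: "norm ((1 / a) *\<^sub>R c - Z u0) \<le> e / 2" if "norm (c - a *\<^sub>R Z u0) \<le> e / 2 * \<bar>a\<bar>" "a \<noteq> 0" for a c
          proof -
            have "(1 / a) *\<^sub>R c - Z u0 = (1 / a) *\<^sub>R (c - a *\<^sub>R Z u0)" using that(2) by (simp add: algebra_simps)
            then have "norm ((1 / a) *\<^sub>R c - Z u0) = norm (c - a *\<^sub>R Z u0) / \<bar>a\<bar>" by simp
            also have "\<dots> \<le> e / 2" using that by (subst pos_divide_le_eq) auto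
            finally show ?thesis .
          qed
          have "H y - Z u0 = (1/2) *\<^sub>R (((1 / \<bar>sqrt \<tau>\<bar>) *\<^sub>R Cs (\<rho> y) - Z u0) + ((1 / sqrt \<tau>) *\<^sub>R Ct (\<rho> y) - Z u0))"
            using False by (simp add: H_def yeq algebra_simps flip: scaleR_add_left)
          also have "norm \<dots> \<le> (1/2) * (e / 2 + e / 2)"
            unfolding norm_scaleR using E(2,3) False
            by (intro mult_mono norm_triangle_le add_mono scale) (auto)
          finally show ?thesis by simp
        qed
        then show "dist (H y) (H z) < e" using \<open>e > 0\<close> by (simp add: dist_norm H_def zeq)
      qed (use d in simp)
    qed
  qed
  show "Ck_open (Suc 0) (UNIV \<times> U) h"
  proof (rule Ck_open_SucI[OF _ hD])
    show "Ck_open 0 (UNIV \<times> U) (\<lambda>z. D z v)" for v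
    proof -
      have "continuous_on (UNIV \<times> U) H" using HC by (auto intro!: continuous_at_imp_continuous_on)
      moreover have "continuous_on (UNIV \<times> U) (\<lambda>z. DC (\<rho> z) (0, 0, snd v))"
        by (rule continuous_on_compose2[OF contDC \<rho>_cont]) (use \<rho>W in auto)
      ultimately show ?thesis unfolding D_def by (auto intro!: continuous_intros)
    qed
  qed (auto intro!: open_Times U)
  show "((\<lambda>\<tau>. h (\<tau>, u)) has_vector_derivative X u) (at 0)" if "u \<in> U"
  proof -
    have "((\<lambda>\<tau>. h (\<tau>, u)) has_vector_derivative D (0, u) (1, 0)) (at 0)"
      by (rule has_vector_derivative_chain[OF hD])
        (use that in \<open>auto intro!: has_vector_derivative_Pair has_vector_derivative_const has_vector_derivative_id\<close>)
    then show ?thesis using ZX[OF that] by (simp add: D0[OF that])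
  qed
qed

section \<open>Words of frame translations\<close>

type_synonym word = "(3 \<times> real) list"

text \<open>A word lists steps along the frame fields, first step first. It acts on frame components of
  vectors by \<open>act\<close> and moves the base point by \<open>base\<close>; the action on components is the same at every base
  point because the metric is left-invariant.\<close>
definition act :: "word \<Rightarrow> real^3 \<Rightarrow> real^3" where
  "act w u = fold (\<lambda>(i, s). flow i s) w u"

definition base :: "word \<Rightarrow> real^3 \<Rightarrow> real^3" where
  "base w x = fold (\<lambda>(i, s) x. x + s *\<^sub>R frame i (x$1)) w x"

definition reverse_word :: "word \<Rightarrow> word" where
  "reverse_word w = rev (map (\<lambda>(i, s). (i, - s)) w)"

lemma act_simps [simp]:
  "act [] u = u" "act ((i, s) # w) u = act w (flow i s u)" "act (v @ w) u = act w (act v u)"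
  by (simp_all add: act_def)

lemma base_simps [simp]:
  "base [] x = x" "base ((i, s) # w) x = base w (x + s *\<^sub>R frame i (x$1))" "base (v @ w) x = base w (base v x)"
  by (simp_all add: base_def)

lemma act_in_cone [simp]: "act w u \<in> frame_cone \<longleftrightarrow> u \<in> frame_cone"
proof (induction w arbitrary: u)
  case (Cons a w)
  then show ?case by (cases a) simp
qed simp

lemma act_reverse_word: "act (reverse_word w) (act w u) = u"
proof (induction w arbitrary: u)
  case (Cons a w)
  then show ?case by (cases a) (simp add: reverse_word_def flow_add)
qed (simp add: reverse_word_def)

lemma reverse_reverse_word [simp]: "reverse_word (reverse_word w) = w"
  by (induction w) (auto simp: reverse_word_def)

lemma act_reverse_word': "act w (act (reverse_word w) u) = u"
  using act_reverse_word[of "reverse_word w" u] by simp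

lemma flow_volume: "flow i s u $ 1 * flow i s u $ 2 * flow i s u $ 3 = u$1 * u$2 * u$3"
proof -
  have "weight i $ 1 + weight i $ 2 + weight i $ 3 = 0"
    using exhaust_3[of i] by (auto simp: weight_def)
  then have "s * rate i u * weight i $ 1 + s * rate i u * weight i $ 2 + s * rate i u * weight i $ 3 = 0"
    by (simp flip: distrib_left)
  then have "exp (s * rate i u * weight i $ 1) * exp (s * rate i u * weight i $ 2) * exp (s * rate i u * weight i $ 3) = 1"
    by (simp flip: exp_add)
  then show ?thesis by (simp add: flow_def)
qed

lemma act_volume: "act w u $ 1 * act w u $ 2 * act w u $ 3 = u$1 * u$2 * u$3"
proof (induction w arbitrary: u)
  case (Cons a w)
  then show ?case using flow_volume by (cases a) (simp del: mult_cancel_left mult_cancel_right)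
qed simp

lemma translation_act:
  "translation heis_cone berwald_moor x (base w x) (\<lambda>v. from_frame (base w x $ 1) (act w (to_frame (x$1) v)))"
proof (induction w arbitrary: x)
  case Nil
  then show ?case using translation_id by simp
next
  case (Cons a w)
  obtain i s where a: "a = (i, s)" by (cases a)
  from translation_compose[OF translation_frame[of x s i] Cons.IH]
  show ?case by (simp add: a)
qed

lemma open_cone: "open frame_cone"
  unfolding frame_cone_def by (intro open_Collect_conj open_Collect_neq continuous_intros)

lemma Ck_open_flow:
  assumes V: "open V" and "Ck_open k V \<sigma>" "Ck_open k V f" "f ` V \<subseteq> frame_cone"
  shows "Ck_open k V (\<lambda>z. flow i (\<sigma> z) (f z))"
proof -
  have f: "Ck_open k V (\<lambda>z. f z $ j)" for j by (rule Ck_open_vec_nth[OF V assms(3)])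
  have nz: "f z $ 1 \<noteq> 0" "f z $ 2 \<noteq> 0" "f z $ 3 \<noteq> 0" if "z \<in> V" for z
    using assms(4) that by (auto simp: frame_cone_def)
  have "Ck_open k V (\<lambda>z. rate i (f z))"
    using exhaust_3[of i] unfolding rate_def power2_eq_square
    by (auto intro!: Ck_open_divide Ck_open_mult f V simp: nz)
  then show ?thesis
    unfolding flow_def by (intro Ck_open_vec_lambda Ck_open_mult Ck_open_exp_comp f V Ck_open_const assms(2))
qed

lemma Ck_open_act:
  assumes V: "open V" and "\<And>i \<sigma>. (i, \<sigma>) \<in> set ws \<Longrightarrow> Ck_open k V \<sigma>" "Ck_open k V f" "f ` V \<subseteq> frame_cone"
  shows "Ck_open k V (\<lambda>z. act (map (\<lambda>(i, \<sigma>). (i, \<sigma> z)) ws) (f z))"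
  using assms(2-)
proof (induction ws arbitrary: f)
  case (Cons a ws)
  obtain i \<sigma> where a: "a = (i, \<sigma>)" by (cases a)
  have "Ck_open k V (\<lambda>z. flow i (\<sigma> z) (f z))"
    using Cons.prems by (intro Ck_open_flow V) (auto simp: a)
  then have "Ck_open k V (\<lambda>z. act (map (\<lambda>(i, \<sigma>). (i, \<sigma> z)) ws) (flow i (\<sigma> z) (f z)))"
    using Cons.prems by (intro Cons.IH) auto
  then show ?case by (simp add: a)
qed simp

lemma Ck_open_act_fixed: "Ck_open k frame_cone (act w)"
proof -
  have "Ck_open k frame_cone (\<lambda>u. act (map (\<lambda>(i, \<sigma>). (i, \<sigma> u)) (map (\<lambda>(i, s). (i, \<lambda>_. s)) w)) u)"
    by (rule Ck_open_act[OF open_cone _ Ck_open_linear[OF bounded_linear_ident open_cone]])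
      (auto intro: Ck_open_const)
  moreover have "map (\<lambda>(i, \<sigma>). (i, \<sigma> u)) (map (\<lambda>(i, s). (i, \<lambda>_. s)) w) = w" for u :: "real^3"
    by (induction w) auto
  ultimately show ?thesis by simp
qed

section \<open>The holonomy group and its tangent fields\<close>

lemma bounded_linear_to_frame: "bounded_linear (to_frame a)"
proof -
  have "linear (to_frame a)"
    by (rule linearI) (auto simp: to_frame_def vec_eq_iff forall_3 algebra_simps)
  then show ?thesis by (simp add: linear_conv_bounded_linear)
qed

lemma bounded_linear_from_frame: "bounded_linear (from_frame a)"
proof -
  have "linear (from_frame a)"
    by (rule linearI) (auto simp: from_frame_def vec_eq_iff forall_3 algebra_simps)
  then show ?thesis by (simp add: linear_conv_bounded_linear)
qed

abbreviation bm_indicatrix :: "real^3 \<Rightarrow> (real^3) set" where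
  "bm_indicatrix x \<equiv> indicatrix heis_cone berwald_moor x"

lemma indicatrix_iff:
  "y \<in> bm_indicatrix x \<longleftrightarrow> to_frame (x$1) y \<in> frame_cone \<and>
     (root 3 (to_frame (x$1) y $ 1 * to_frame (x$1) y $ 2 * to_frame (x$1) y $ 3))\<^sup>2 = 1"
proof -
  have "berwald_moor x y \<noteq> -1"
    using zero_le_power2[of "root 3 (y$1 * (y$2 - x$1 * y$3) * y$3)"] unfolding berwald_moor_def by linarith
  then show ?thesis
    by (simp add: indicatrix_def heis_cone_iff) (simp add: berwald_moor_def to_frame_def)
qed

definition word_map :: "real \<Rightarrow> word \<Rightarrow> real^3 \<Rightarrow> real^3" where
  "word_map a w y = from_frame a (act w (to_frame a y))"

lemma word_map_indicatrix: "y \<in> bm_indicatrix x \<Longrightarrow> word_map (x$1) w y \<in> bm_indicatrix x"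
  by (simp add: indicatrix_iff word_map_def act_volume)

lemma word_map_inverse:
  "word_map a (reverse_word w) (word_map a w y) = y" "word_map a w (word_map a (reverse_word w) y) = y"
  by (simp_all add: word_map_def act_reverse_word act_reverse_word')

lemma Ck_open_word_map: "Ck_open k (heis_cone x) (word_map (x$1) w)"
  unfolding word_map_def
  by (intro Ck_open_linear_comp[OF bounded_linear_from_frame]
      Ck_open_compose[OF _ open_cone _ Ck_open_linear[OF bounded_linear_to_frame] Ck_open_act_fixed] open_heis_cone)
     (auto simp: heis_cone_iff)

lemma indicatrix_subset: "bm_indicatrix x \<subseteq> heis_cone x"
  by (auto simp: indicatrix_def)

lemma word_map_in_holonomy:
  assumes "base w x = x"
  shows "restrict (word_map (x$1) w) (bm_indicatrix x) \<in> holonomy heis_cone berwald_moor x"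
proof -
  define \<phi> where "\<phi> = restrict (word_map (x$1) w) (bm_indicatrix x)"
  have bij: "bij_betw \<phi> (bm_indicatrix x) (bm_indicatrix x)"
    by (rule bij_betw_byWitness[where f'="word_map (x$1) (reverse_word w)"])
      (auto simp: \<phi>_def word_map_inverse word_map_indicatrix)
  have "smooth_on (bm_indicatrix x) \<phi>"
    by (rule Ck_on_restrict[OF open_heis_cone indicatrix_subset Ck_open_word_map]) (simp add: \<phi>_def)
  moreover have "inv_into (bm_indicatrix x) \<phi> q = word_map (x$1) (reverse_word w) q" if "q \<in> bm_indicatrix x" for q
    using bij that word_map_indicatrix[OF that, of "reverse_word w"]
    by (intro inv_into_f_eq) (auto simp: bij_betw_def \<phi>_def word_map_inverse)
  then have "smooth_on (bm_indicatrix x) (inv_into (bm_indicatrix x) \<phi>)"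
    by (rule Ck_on_restrict[OF open_heis_cone indicatrix_subset Ck_open_word_map])
  ultimately have "\<phi> \<in> Diff (bm_indicatrix x)"
    using bij by (simp add: Diff_def \<phi>_def)
  moreover obtain c where "piecewise_C1_curve c" "c 0 = x" "c 1 = x"
    "\<And>v. v \<in> heis_cone x \<Longrightarrow> \<exists>X. parallel_along heis_cone berwald_moor c X \<and> X 0 = v \<and> X 1 = word_map (x$1) w v"
    using translation_act[of x w] unfolding translation_def assms word_map_def by blast
  moreover have "\<phi> v = word_map (x$1) w v" "v \<in> heis_cone x" if "v \<in> bm_indicatrix x" for v
    using that indicatrix_subset by (auto simp: \<phi>_def)
  ultimately have "\<phi> \<in> holonomy heis_cone berwald_moor x"
    unfolding holonomy_def by (intro CollectI conjI exI[of _ c]) auto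
  then show ?thesis by (simp add: \<phi>_def)
qed

text \<open>Velocities at the identity of families of loop words. Keeping the families on the whole open cone,
  in frame components, avoids all local extensions and makes the notion independent of the base
  point.\<close>
definition holonomy_velocity :: "(real^3 \<Rightarrow> real^3) \<Rightarrow> bool" where
  "holonomy_velocity Z \<longleftrightarrow> (\<exists>w :: real \<Rightarrow> word. (\<forall>t x. base (w t) x = x) \<and> (\<forall>u\<in>frame_cone. act (w 0) u = u) \<and>
     Ck_open (Suc 0) (UNIV \<times> frame_cone) (\<lambda>z. act (w (fst z)) (snd z)) \<and>
     (\<forall>u\<in>frame_cone. ((\<lambda>t. act (w t) u) has_vector_derivative Z u) (at 0)))"

lemma open_UNIV_cone: "open ((UNIV :: real set) \<times> frame_cone)"
  by (intro open_Times open_UNIV open_cone)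

text \<open>Concatenation of words composes the families, and at the identity velocities add.\<close>
lemma holonomy_velocity_add:
  assumes "holonomy_velocity Z1" "holonomy_velocity Z2"
  shows "holonomy_velocity (\<lambda>u. Z1 u + Z2 u)"
proof -
  obtain w1 where w1: "\<And>t x. base (w1 t) x = x" "\<And>u. u \<in> frame_cone \<Longrightarrow> act (w1 0) u = u"
     "Ck_open (Suc 0) (UNIV \<times> frame_cone) (\<lambda>z. act (w1 (fst z)) (snd z))"
     "\<And>u. u \<in> frame_cone \<Longrightarrow> ((\<lambda>t. act (w1 t) u) has_vector_derivative Z1 u) (at 0)"
    using assms(1) unfolding holonomy_velocity_def by blast
  obtain w2 where w2: "\<And>t x. base (w2 t) x = x" "\<And>u. u \<in> frame_cone \<Longrightarrow> act (w2 0) u = u"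
     "Ck_open (Suc 0) (UNIV \<times> frame_cone) (\<lambda>z. act (w2 (fst z)) (snd z))"
     "\<And>u. u \<in> frame_cone \<Longrightarrow> ((\<lambda>t. act (w2 t) u) has_vector_derivative Z2 u) (at 0)"
    using assms(2) unfolding holonomy_velocity_def by blast
  define F where "F z = act (w2 (fst z)) (snd z)" for z
  have "Ck_open (Suc 0) (UNIV \<times> frame_cone) (\<lambda>z. F (fst z, act (w1 (fst z)) (snd z)))"
    unfolding F_def
    by (rule Ck_open_compose[OF open_UNIV_cone open_UNIV_cone _
          Ck_open_Pair[OF open_UNIV_cone Ck_open_linear[OF bounded_linear_fst open_UNIV_cone] w1(3)] w2(3)])
      auto
  then have C1: "Ck_open (Suc 0) (UNIV \<times> frame_cone) (\<lambda>z. act (w1 (fst z) @ w2 (fst z)) (snd z))"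
    by (simp add: F_def)
  have "((\<lambda>t. act (w1 t @ w2 t) u) has_vector_derivative Z1 u + Z2 u) (at 0)" if u: "u \<in> frame_cone" for u
  proof -
    obtain D where D: "(F has_derivative D) (at (0, u))"
      using Ck_open_Suc_has_derivative[OF w2(3), of "(0, u)"] u unfolding F_def by auto
    have "((\<lambda>t. F (t, act (w1 t) u)) has_vector_derivative D (1, Z1 u)) (at 0)"
      by (rule has_vector_derivative_chain[where F=F])
        (use D w1 u in \<open>auto intro!: has_vector_derivative_Pair has_vector_derivative_id\<close>)
    moreover have "((\<lambda>t. F (t, u)) has_vector_derivative D (1, 0)) (at 0)"
      by (rule has_vector_derivative_chain[where F=F])
        (use D in \<open>auto intro!: has_vector_derivative_Pair has_vector_derivative_id has_vector_derivative_const\<close>)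
    then have "D (1, 0) = Z2 u"
      using w2(4)[OF u] unfolding F_def by (auto dest: vector_derivative_unique_at)
    \<comment> \<open>The second family starts at the identity, so its derivative at time \<open>0\<close> in the point is the identity.\<close>
    moreover have "D (0, v) = v" for v
    proof -
      have "((\<lambda>u. F (0, u)) has_derivative (\<lambda>v. D (0, v))) (at u)"
        by (rule has_derivative_compose[where g=F and f="\<lambda>u. (0, u)"])
          (use D in \<open>auto intro!: has_derivative_Pair has_derivative_const has_derivative_ident\<close>)
      moreover have "((\<lambda>u. F (0, u)) has_derivative (\<lambda>v. v)) (at u)"
        by (rule has_derivative_transform_within_open[OF has_derivative_ident open_cone u]) (simp add: F_def w2)
      ultimately show ?thesis using has_derivative_unique by metis
    qed
    moreover have "D (1, Z1 u) = D (0, Z1 u) + D (1, 0)"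
      using linear_add[OF has_derivative_linear[OF D], of "(0, Z1 u)" "(1, 0)"] by simp
    ultimately show ?thesis by (simp add: F_def)
  qed
  then show ?thesis
    unfolding holonomy_velocity_def using C1 w1 w2 by (intro exI[of _ "\<lambda>t. w1 t @ w2 t"]) auto
qed

lemma holonomy_velocity_scale:
  assumes "holonomy_velocity Z"
  shows "holonomy_velocity (\<lambda>u. c *\<^sub>R Z u)"
proof -
  obtain w where w: "\<And>t x. base (w t) x = x" "\<And>u. u \<in> frame_cone \<Longrightarrow> act (w 0) u = u"
     "Ck_open (Suc 0) (UNIV \<times> frame_cone) (\<lambda>z. act (w (fst z)) (snd z))"
     "\<And>u. u \<in> frame_cone \<Longrightarrow> ((\<lambda>t. act (w t) u) has_vector_derivative Z u) (at 0)"
    using assms(1) unfolding holonomy_velocity_def by blast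
  have L: "bounded_linear (\<lambda>z. (c * fst z, snd z) :: real \<times> (real^3))"
    by (intro bounded_linear_Pair bounded_linear_snd bounded_linear_const_mult bounded_linear_fst)
  have C1: "Ck_open (Suc 0) (UNIV \<times> frame_cone) (\<lambda>z. act (w (c * fst z)) (snd z))"
  proof -
    have "(\<lambda>z. (c * fst z, snd z)) ` (UNIV \<times> frame_cone) \<subseteq> UNIV \<times> frame_cone" by auto
    from Ck_open_compose[OF open_UNIV_cone open_UNIV_cone this Ck_open_linear[OF L open_UNIV_cone] w(3)]
    show ?thesis by (simp del: Ck_open.simps)
  qed
  have "((\<lambda>t. act (w (c * t)) u) has_vector_derivative c *\<^sub>R Z u) (at 0)" if u: "u \<in> frame_cone" for u
  proof -
    have 1: "((\<lambda>t. c * t) has_vector_derivative c) (at 0)" by (auto intro!: derivative_eq_intros)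
    have "((\<lambda>t. act (w t) u) has_vector_derivative Z u) (at (c * 0))" using w(4)[OF u] by simp
    from vector_diff_chain_at[OF 1 this] show ?thesis by (simp only: o_def)
  qed
  then show ?thesis
    unfolding holonomy_velocity_def using C1 w by (intro exI[of _ "\<lambda>t. w (c * t)"]) auto
qed

lemma holonomy_velocity_zero: "holonomy_velocity (\<lambda>u. 0)"
  unfolding holonomy_velocity_def
  by (intro exI[of _ "\<lambda>t. []"]) (auto intro: Ck_open_linear bounded_linear_snd open_UNIV_cone simp del: Ck_open.simps)

definition frame_field :: "real^3 \<Rightarrow> (real^3 \<Rightarrow> real^3) \<Rightarrow> real^3 \<Rightarrow> real^3" where
  "frame_field x Z y = (if y \<in> bm_indicatrix x then from_frame (x$1) (Z (to_frame (x$1) y)) else 0)"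

lemma holonomy_velocity_tangent_to:
  assumes "holonomy_velocity Z"
  shows "tangent_to (bm_indicatrix x) (holonomy heis_cone berwald_moor x) (frame_field x Z)"
proof -
  obtain w where w: "\<And>t x. base (w t) x = x" "\<And>u. u \<in> frame_cone \<Longrightarrow> act (w 0) u = u"
     "Ck_open (Suc 0) (UNIV \<times> frame_cone) (\<lambda>z. act (w (fst z)) (snd z))"
     "\<And>u. u \<in> frame_cone \<Longrightarrow> ((\<lambda>t. act (w t) u) has_vector_derivative Z u) (at 0)"
    using assms(1) unfolding holonomy_velocity_def by blast
  define \<phi> where "\<phi> t = restrict (word_map (x$1) (w t)) (bm_indicatrix x)" for t
  have in_cone: "to_frame (x$1) p \<in> frame_cone" if "p \<in> bm_indicatrix x" for p using that by (simp add: indicatrix_iff)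
  have V: "open ((UNIV :: real set) \<times> heis_cone x)" by (intro open_Times open_UNIV open_heis_cone)
  have "Ck_open (Suc 0) (UNIV \<times> heis_cone x) (\<lambda>z. act (w (fst z)) (to_frame (x$1) (snd z)))"
  proof -
    have "Ck_open (Suc 0) (UNIV \<times> heis_cone x) (\<lambda>z. (\<lambda>z. act (w (fst z)) (snd z)) (fst z, to_frame (x$1) (snd z)))"
      by (rule Ck_open_compose[OF V open_UNIV_cone _ Ck_open_Pair[OF V Ck_open_linear[OF bounded_linear_fst V]
             Ck_open_linear[OF bounded_linear_compose[OF bounded_linear_to_frame bounded_linear_snd] V]] w(3)])
        (auto simp: heis_cone_iff)
    then show ?thesis by simp
  qed
  then have C1: "Ck_open (Suc 0) (UNIV \<times> heis_cone x) (\<lambda>z. word_map (x$1) (w (fst z)) (snd z))"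
    unfolding word_map_def by (rule Ck_open_linear_comp[OF bounded_linear_from_frame V])
  have "Ck_on 1 ({-1<..<1} \<times> bm_indicatrix x) (\<lambda>(t, p). \<phi> t p)"
  proof (rule Ck_on_restrict[OF V])
    show "{- 1<..<1} \<times> bm_indicatrix x \<subseteq> UNIV \<times> heis_cone x" using indicatrix_subset by auto
    show "Ck_open j (UNIV \<times> heis_cone x) (\<lambda>z. word_map (x$1) (w (fst z)) (snd z))" if "enat j \<le> 1" for j
      by (rule Ck_open_mono[OF C1]) (use that in \<open>simp add: one_enat_def\<close>)
  qed (auto simp: \<phi>_def)
  moreover have "\<phi> 0 p = p" if "p \<in> bm_indicatrix x" for p
    using that in_cone w(2) by (simp add: \<phi>_def word_map_def)
  moreover have "((\<lambda>t. \<phi> t p) has_vector_derivative frame_field x Z p) (at 0)" if "p \<in> bm_indicatrix x" for p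
    using bounded_linear.has_vector_derivative[OF bounded_linear_from_frame w(4)[OF in_cone[OF that]], of "x$1"] that
    by (simp add: \<phi>_def word_map_def frame_field_def)
  moreover have "\<phi> t \<in> holonomy heis_cone berwald_moor x" for t
    unfolding \<phi>_def by (rule word_map_in_holonomy[OF w(1)])
  ultimately show ?thesis
    unfolding tangent_to_def by (intro exI[of _ "1::real"] conjI exI[of _ \<phi>]) auto
qed

section \<open>A commutator word\<close>

text \<open>If the components of a curve have logarithmic derivatives \<open>l\<close>, then \<open>rate i\<close> has logarithmic
  derivative \<open>rate_log i l\<close> along it.\<close>
definition rate_log :: "3 \<Rightarrow> real^3 \<Rightarrow> real" where
  "rate_log i l = (if i = 1 then l$3 - l$2 else if i = 2 then l$1 + l$3 - 2 * l$2 else l$1 - l$2)"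

lemma rate_has_derivative:
  assumes u: "\<And>k. ((\<lambda>t. u t $ k) has_real_derivative u t0 $ k * l $ k) (at t0)" and "u t0 \<in> frame_cone"
  shows "((\<lambda>t. rate i (u t)) has_real_derivative rate i (u t0) * rate_log i l) (at t0)"
proof -
  have nz: "u t0 $ 1 \<noteq> 0" "u t0 $ 2 \<noteq> 0" "u t0 $ 3 \<noteq> 0" using assms(2) by (auto simp: frame_cone_def)
  consider "i = 1" | "i = 2" | "i = 3" using exhaust_3 by blast
  then show ?thesis
  proof cases
    case 1
    show ?thesis unfolding 1 rate_def rate_log_def
      using nz by (auto intro!: derivative_eq_intros u simp: field_simps)
  next
    case 2
    show ?thesis unfolding 2 rate_def rate_log_def
      using nz by (auto intro!: derivative_eq_intros u simp: field_simps power2_eq_square)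
  next
    case 3
    show ?thesis unfolding 3 rate_def rate_log_def
      using nz by (auto intro!: derivative_eq_intros u simp: field_simps)
  qed
qed

lemma flow_has_log_derivative:
  assumes u: "\<And>k. ((\<lambda>t. u t $ k) has_real_derivative u t0 $ k * l $ k) (at t0)" and "u t0 \<in> frame_cone"
    and \<sigma>: "(\<sigma> has_real_derivative \<sigma>') (at t0)"
  shows "((\<lambda>t. flow i (\<sigma> t) (u t) $ k) has_real_derivative
     flow i (\<sigma> t0) (u t0) $ k * (l + ((\<sigma>' + \<sigma> t0 * rate_log i l) * rate i (u t0)) *\<^sub>R weight i) $ k) (at t0)"
  unfolding flow_def
  by (auto intro!: derivative_eq_intros u \<sigma> rate_has_derivative[OF assms(1,2)] simp: algebra_simps)

text \<open>The steps \<open>(2, -\<tau>), (3, t), (2, \<tau>)\<close> are the translation along \<open>E\<^sub>3\<close> for time \<open>t\<close> conjugated by that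
  along \<open>E\<^sub>2\<close>, and the first eight steps are the commutator of this with the translation along \<open>E\<^sub>1\<close>.
  They displace the base point by \<open>- s t\<close> in the central direction, which the last step undoes.\<close>
definition commutator_word :: "real \<Rightarrow> real \<Rightarrow> real \<Rightarrow> word" where
  "commutator_word \<tau> s t = [(2, -\<tau>), (3, -t), (2, \<tau>), (1, -s), (2, -\<tau>), (3, t), (2, \<tau>), (1, s), (2, s * t)]"

lemma base_commutator_word: "base (commutator_word \<tau> s t) x = x"
  by (simp add: commutator_word_def vec_eq_iff forall_3 frame_def algebra_simps)

lemma act_commutator_word_trivial:
  "act (commutator_word \<tau> s 0) u = u" "act (commutator_word \<tau> 0 t) u = u"
  by (simp_all add: commutator_word_def flow_add)

text \<open>Up to the constant factor \<open>- 9/4\<close>, the first summand is \<open>m h'(m)\<close> for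
  \<open>h(m) = m (1 + \<tau> m / 2) exp (\<tau> m / 2)\<close>, the Poisson bracket of the Hamiltonians \<open>q\<close> and \<open>p exp (\<tau> m / 2)\<close> with
  \<open>m = pq\<close>. The second summand comes from the central correction.\<close>
definition commutator_rate :: "real \<Rightarrow> real \<Rightarrow> real" where
  "commutator_rate \<tau> m = - (9/16) * m * exp (\<tau> * m / 2) * (4 + 6 * \<tau> * m + \<tau>\<^sup>2 * m\<^sup>2) - m / 2"

lemma rate_flow_other:
  "rate 3 (flow 2 s u) = rate 3 u * exp (- s * rate 2 u / 2)"
  "rate 2 (flow 1 s u) = rate 2 u * exp (3/2 * s * rate 1 u)"
  "rate 3 (flow 1 s u) = rate 3 u * exp (3/2 * s * rate 1 u)"
proof -
  show "rate 3 (flow 2 s u) = rate 3 u * exp (- s * rate 2 u / 2)"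
    by (simp add: rate_def flow_def weight_def)
  define z where "z = s * rate 1 u"
  have f: "flow 1 s u $ 1 = u$1 * exp z" "flow 1 s u $ 2 = u$2 * exp (- z/2)" "flow 1 s u $ 3 = u$3 * exp (- z/2)"
    by (simp_all add: flow_def weight_def z_def)
  have e: "exp (- z/2) / exp (- z/2) = 1" "exp z / exp (- z/2) = exp (3/2 * z)"
    by (simp_all flip: exp_diff)
  have "rate 2 (flow 1 s u) = rate 2 u * (exp (- z/2) / exp (- z/2)) * (exp z / exp (- z/2))"
    unfolding rate_def f by (simp add: power2_eq_square ac_simps)
  then show "rate 2 (flow 1 s u) = rate 2 u * exp (3/2 * s * rate 1 u)"
    unfolding e by (simp add: z_def mult.assoc)
  have "rate 3 (flow 1 s u) = rate 3 u * (exp z / exp (- z/2))"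
    unfolding rate_def f by simp
  then show "rate 3 (flow 1 s u) = rate 3 u * exp (3/2 * s * rate 1 u)"
    unfolding e by (simp add: z_def mult.assoc)
qed

text \<open>All maps involved multiply components by exponentials, so derivatives are recorded as logarithmic
  derivatives \<open>l\<close> of the components at parameter \<open>0\<close>.\<close>
definition has_log_derivative :: "(real \<Rightarrow> real^3) \<Rightarrow> real^3 \<Rightarrow> real^3 \<Rightarrow> bool" where
  "has_log_derivative A a l \<longleftrightarrow> A 0 = a \<and> a \<in> frame_cone \<and> (\<forall>k. ((\<lambda>t. A t $ k) has_real_derivative a $ k * l $ k) (at 0))"

lemma has_log_derivative_flow:
  assumes "has_log_derivative A a l" "(\<sigma> has_real_derivative \<sigma>') (at 0)"
    "flow i (\<sigma> 0) a = b" "l + ((\<sigma>' + \<sigma> 0 * rate_log i l) * rate i a) *\<^sub>R weight i = l'"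
  shows "has_log_derivative (\<lambda>t. flow i (\<sigma> t) (A t)) b l'"
  using flow_has_log_derivative[of A 0 l \<sigma> \<sigma>' i] assms by (auto simp: has_log_derivative_def)

lemma rate_log_linear:
  "rate_log i (v + w) = rate_log i v + rate_log i w" "rate_log i (c *\<^sub>R v) = c * rate_log i v"
  "rate_log i (- v) = - rate_log i v" "rate_log i (v - w) = rate_log i v - rate_log i w" "rate_log i 0 = 0"
  by (simp_all add: rate_log_def algebra_simps)

lemma rate_log_weight:
  "rate_log 1 (weight 1) = 0" "rate_log 2 (weight 2) = 0" "rate_log 2 (weight 3) = - 3/2"
  "rate_log 1 (weight 3) = - 3/2" "rate_log 1 (weight 2) = 1/2"
  by (simp_all add: rate_log_def weight_def)

text \<open>The logarithmic velocity of the translation along \<open>E\<^sub>3\<close> conjugated by that along \<open>E\<^sub>2\<close> for time \<open>\<tau>\<close>.\<close>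
definition conjugate_generator :: "real \<Rightarrow> real^3 \<Rightarrow> real^3" where
  "conjugate_generator \<tau> u = (rate 3 u * exp (\<tau> * rate 2 u / 2)) *\<^sub>R (weight 3 - (3/2 * \<tau> * rate 2 u) *\<^sub>R weight 2)"

text \<open>The logarithmic derivative in \<open>t\<close> at \<open>t = 0\<close> is propagated through the steps of the word one at a time.
  At \<open>t = 0\<close> the intermediate points are \<open>u\<close>, its translate \<open>v'\<close> along \<open>E\<^sub>1\<close>, and their translates \<open>ua\<close> and
  \<open>va\<close> along \<open>E\<^sub>2\<close>.\<close>
lemma commutator_word_derivative:
  assumes u: "u \<in> frame_cone"
  defines "v s \<equiv> flow 1 (- s) u"
  shows "((\<lambda>t. act (commutator_word \<tau> s t) u) has_vector_derivative
     (\<chi> k. u $ k * (conjugate_generator \<tau> (v s) - conjugate_generator \<tau> u + (s * rate_log 1 (conjugate_generator \<tau> (v s)) * rate 1 u) *\<^sub>R weight 1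
        + (s * rate 2 u) *\<^sub>R weight 2) $ k)) (at 0)"
proof -
  define v' where "v' = v s"
  define b where "b = conjugate_generator \<tau> u"
  define b' where "b' = conjugate_generator \<tau> v'"
  have b: "b = rate 3 (flow 2 (-\<tau>) u) *\<^sub>R (weight 3 - (3/2 * \<tau> * rate 2 u) *\<^sub>R weight 2)"
    and b': "b' = rate 3 (flow 2 (-\<tau>) v') *\<^sub>R (weight 3 - (3/2 * \<tau> * rate 2 v') *\<^sub>R weight 2)"
    by (simp_all add: b_def b'_def conjugate_generator_def rate_flow_other)
  have v': "rate 1 v' = rate 1 u" by (simp add: v'_def v_def)
  have t: "((\<lambda>t. t) has_real_derivative 1) (at 0)" "((\<lambda>t. - t) has_real_derivative - 1) (at 0)"
    "((\<lambda>t. s * t) has_real_derivative s) (at 0)"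
    by (auto intro!: derivative_eq_intros)
  define ua va where "ua = flow 2 (-\<tau>) u" and "va = flow 2 (-\<tau>) v'"
  have fl: "flow 2 \<tau> ua = u" "flow 2 \<tau> va = v'" "flow 1 s v' = u" "flow 1 (- s) u = v'"
    "rate 2 ua = rate 2 u" "rate 2 va = rate 2 v'"
    by (simp_all add: ua_def va_def v'_def v_def flow_add)
  define c where "c = - b + (s * rate_log 1 b * rate 1 u) *\<^sub>R weight 1"
  have "has_log_derivative (\<lambda>t. u) u 0"
    using u by (simp add: has_log_derivative_def)
  from has_log_derivative_flow[OF this DERIV_const]
  have "has_log_derivative (\<lambda>t. flow 2 (-\<tau>) u) ua 0"
    by (simp add: ua_def rate_log_linear)
  from has_log_derivative_flow[OF this t(2)]
  have "has_log_derivative (\<lambda>t. flow 3 (-t) (flow 2 (-\<tau>) u)) ua (- (rate 3 ua *\<^sub>R weight 3))"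
    by (simp add: rate_log_linear)
  from has_log_derivative_flow[OF this DERIV_const]
  have "has_log_derivative (\<lambda>t. flow 2 \<tau> (flow 3 (-t) (flow 2 (-\<tau>) u))) u (- b)"
    by (simp add: fl rate_log_linear rate_log_weight b ua_def[symmetric] algebra_simps)
  from has_log_derivative_flow[OF this DERIV_const]
  have "has_log_derivative (\<lambda>t. flow 1 (-s) (flow 2 \<tau> (flow 3 (-t) (flow 2 (-\<tau>) u)))) v' c"
    by (simp add: fl rate_log_linear c_def)
  from has_log_derivative_flow[OF this DERIV_const]
  have "has_log_derivative (\<lambda>t. flow 2 (-\<tau>) (flow 1 (-s) (flow 2 \<tau> (flow 3 (-t) (flow 2 (-\<tau>) u))))) va
      (c - (\<tau> * rate_log 2 c * rate 2 v') *\<^sub>R weight 2)"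
    by (simp add: va_def)
  from has_log_derivative_flow[OF this t(1)]
  have "has_log_derivative (\<lambda>t. flow 3 t (flow 2 (-\<tau>) (flow 1 (-s) (flow 2 \<tau> (flow 3 (-t) (flow 2 (-\<tau>) u)))))) va
      (c - (\<tau> * rate_log 2 c * rate 2 v') *\<^sub>R weight 2 + rate 3 va *\<^sub>R weight 3)"
    by simp
  from has_log_derivative_flow[OF this DERIV_const]
  have "has_log_derivative (\<lambda>t. flow 2 \<tau> (flow 3 t (flow 2 (-\<tau>) (flow 1 (-s) (flow 2 \<tau> (flow 3 (-t) (flow 2 (-\<tau>) u))))))) v' (c + b')"
    by (simp add: fl rate_log_linear rate_log_weight b' va_def[symmetric] algebra_simps)
  from has_log_derivative_flow[OF this DERIV_const]
  have "has_log_derivative (\<lambda>t. flow 1 s (flow 2 \<tau> (flow 3 t (flow 2 (-\<tau>) (flow 1 (-s) (flow 2 \<tau> (flow 3 (-t) (flow 2 (-\<tau>) u)))))))) u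
      (b' - b + (s * rate_log 1 b' * rate 1 u) *\<^sub>R weight 1)"
    by (simp add: fl rate_log_linear rate_log_weight c_def v' algebra_simps)
  from has_log_derivative_flow[OF this t(3)]
  have "has_log_derivative (\<lambda>t. act (commutator_word \<tau> s t) u) u
      (b' - b + (s * rate_log 1 b' * rate 1 u) *\<^sub>R weight 1 + (s * rate 2 u) *\<^sub>R weight 2)"
    by (simp add: commutator_word_def)
  then have "((\<lambda>t. act (commutator_word \<tau> s t) u $ k) has_real_derivative
     u $ k * (b' - b + (s * rate_log 1 b' * rate 1 u) *\<^sub>R weight 1 + (s * rate 2 u) *\<^sub>R weight 2) $ k) (at 0)" for k
    by (simp add: has_log_derivative_def)
  then show ?thesis
    by (intro has_vector_derivative_vecI) (simp add: b_def b'_def v'_def)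
qed


text \<open>The remaining derivative in \<open>s\<close> is a function of one variable, since \<open>\<mu> s\<close> and \<open>P s\<close> describe \<open>pq\<close> and
  \<open>p exp (\<tau> pq / 2)\<close> along the translation by \<open>-s\<close> along \<open>E\<^sub>1\<close>, where \<open>q\<close> is constant. The second component
  cancels, and \<open>p q = m\<close> makes the result depend on \<open>m\<close> only.\<close>
lemma commutator_word_second_derivative:
  assumes u: "u \<in> frame_cone"
  shows "((\<lambda>s. \<chi> k. u $ k * (conjugate_generator \<tau> (flow 1 (- s) u) - conjugate_generator \<tau> u
        + (s * rate_log 1 (conjugate_generator \<tau> (flow 1 (- s) u)) * rate 1 u) *\<^sub>R weight 1
        + (s * rate 2 u) *\<^sub>R weight 2) $ k) has_vector_derivative
     commutator_rate \<tau> (rate 2 u) *\<^sub>R vector [u$1, 0, - u$3]) (at 0)"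
proof -
  define p q m where "p = rate 3 u" and "q = rate 1 u" and "m = rate 2 u"
  have m: "p * q = m" using u by (simp add: p_def q_def m_def rate_def frame_cone_def power2_eq_square)
  define \<mu> where "\<mu> s = m * exp (- 3/2 * s * q)" for s
  define P where "P s = p * exp (- 3/2 * s * q) * exp (\<tau> * \<mu> s / 2)" for s
  have c: "conjugate_generator \<tau> (flow 1 (- s) u) = P s *\<^sub>R (weight 3 - (3/2 * \<tau> * \<mu> s) *\<^sub>R weight 2)" for s
    by (simp add: conjugate_generator_def rate_flow_other P_def \<mu>_def p_def q_def m_def)
  have \<mu>0: "\<mu> 0 = m" and P0: "P 0 = p * exp (\<tau> * m / 2)" by (simp_all add: \<mu>_def P_def)
  have \<mu>': "(\<mu> has_real_derivative - 3/2 * q * m) (at 0)"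
    unfolding \<mu>_def by (auto intro!: derivative_eq_intros)
  have P': "(P has_real_derivative - P 0 * q * (3/2 + 3/4 * \<tau> * m)) (at 0)"
    unfolding P_def by (auto intro!: derivative_eq_intros \<mu>' simp: \<mu>0 algebra_simps)
  define B where "B k s = P s * (weight 3 $ k - (3/2 * \<tau> * \<mu> s) * weight 2 $ k)" for k s
  have B': "(B k has_real_derivative - P 0 * q * (3/2 + 3/4 * \<tau> * m) * (weight 3 $ k - (3/2 * \<tau> * m) * weight 2 $ k)
      + P 0 * (9/4 * \<tau> * q * m) * weight 2 $ k) (at 0)" for k
    unfolding B_def by (auto intro!: derivative_eq_intros \<mu>' P' simp: \<mu>0)
  define R where "R s = P s * (- 3/2 - 3/4 * \<tau> * \<mu> s)" for s
  have R: "rate_log 1 (conjugate_generator \<tau> (flow 1 (- s) u)) = R s" for s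
    unfolding c R_def by (simp add: rate_log_linear rate_log_weight)
  have R': "((\<lambda>s. s * R s) has_real_derivative R 0) (at 0)"
    unfolding R_def by (rule derivative_eq_intros \<mu>' P' refl | simp)+
  have "((\<lambda>s. u $ k * (B k s - conjugate_generator \<tau> u $ k + (s * R s * q) * weight 1 $ k + (s * m) * weight 2 $ k))
     has_real_derivative (commutator_rate \<tau> (rate 2 u) *\<^sub>R vector [u$1, 0, - u$3]) $ k) (at 0)" for k
  proof -
    have "((\<lambda>s. u $ k * (B k s - conjugate_generator \<tau> u $ k + (s * R s * q) * weight 1 $ k + (s * m) * weight 2 $ k))
     has_real_derivative u $ k * (- P 0 * q * (3/2 + 3/4 * \<tau> * m) * (weight 3 $ k - (3/2 * \<tau> * m) * weight 2 $ k)
      + P 0 * (9/4 * \<tau> * q * m) * weight 2 $ k + R 0 * q * weight 1 $ k + m * weight 2 $ k)) (at 0)"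
      by (rule derivative_eq_intros B' R' refl | simp)+
    moreover have "P 0 * q = m * exp (\<tau> * m / 2)" using m by (simp add: P0 mult.assoc mult.left_commute)
    then have "u $ k * (- P 0 * q * (3/2 + 3/4 * \<tau> * m) * (weight 3 $ k - (3/2 * \<tau> * m) * weight 2 $ k)
      + P 0 * (9/4 * \<tau> * q * m) * weight 2 $ k + R 0 * q * weight 1 $ k + m * weight 2 $ k) =
      u $ k * (- (m * exp (\<tau> * m / 2)) * (3/2 + 3/4 * \<tau> * m) * (weight 3 $ k - (3/2 * \<tau> * m) * weight 2 $ k)
      + (m * exp (\<tau> * m / 2)) * (9/4 * \<tau> * m) * weight 2 $ k - (m * exp (\<tau> * m / 2)) * (3/2 + 3/4 * \<tau> * m) * weight 1 $ k + m * weight 2 $ k)"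
      by (simp add: R_def \<mu>0) algebra
    also have "\<dots> = (commutator_rate \<tau> (rate 2 u) *\<^sub>R vector [u$1, 0, - u$3]) $ k"
      using exhaust_3[of k]
      by (auto simp: weight_def commutator_rate_def m_def[symmetric]) (simp_all add: field_simps power2_eq_square)
    ultimately show ?thesis by simp
  qed
  then show ?thesis
    unfolding R by (intro has_vector_derivative_vecI) (simp add: c B_def q_def m_def)
qed

text \<open>The fields \<open>f(pq) (u\<^sub>1 \<partial>\<^sub>1 - u\<^sub>3 \<partial>\<^sub>3)\<close>; their integral curves lie in the hyperbolas \<open>u\<^sub>1 u\<^sub>3 = const\<close>, \<open>u\<^sub>2 = const\<close>.\<close>
definition boost :: "3 \<Rightarrow> real" where
  "boost k = (if k = 1 then 1 else if k = 2 then 0 else -1)"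

definition hyperbolic_field :: "(real \<Rightarrow> real) \<Rightarrow> real^3 \<Rightarrow> real^3" where
  "hyperbolic_field f u = (\<chi> k. u $ k * (f (rate 2 u) * boost k))"

lemma holonomy_velocity_commutator: "holonomy_velocity (hyperbolic_field (commutator_rate \<tau>))"
proof -
  define C where "C z = act (commutator_word \<tau> (fst z) (fst (snd z))) (snd (snd z))" for z :: "real \<times> real \<times> (real^3)"
  have V: "open ((UNIV :: real set) \<times> (UNIV :: real set) \<times> frame_cone)"
    by (intro open_Times open_UNIV open_cone)
  have lin: "Ck_open k (UNIV \<times> UNIV \<times> frame_cone) (\<lambda>z :: real \<times> real \<times> (real^3). fst z)"
     "Ck_open k (UNIV \<times> UNIV \<times> frame_cone) (\<lambda>z :: real \<times> real \<times> (real^3). fst (snd z))"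
     "Ck_open k (UNIV \<times> UNIV \<times> frame_cone) (\<lambda>z :: real \<times> real \<times> (real^3). snd (snd z))" for k
    by (auto intro!: Ck_open_linear[OF _ V] bounded_linear_fst bounded_linear_compose[OF bounded_linear_fst bounded_linear_snd]
        bounded_linear_compose[OF bounded_linear_snd bounded_linear_snd] simp del: Ck_open.simps)
  have "Ck_open k (UNIV \<times> UNIV \<times> frame_cone) (\<lambda>z. act (map (\<lambda>(i, \<sigma>). (i, \<sigma> z))
     [(2 :: 3, \<lambda>z. -\<tau>), (3, \<lambda>z. - fst (snd z)), (2, \<lambda>z. \<tau>), (1, \<lambda>z. - fst z), (2, \<lambda>z. -\<tau>),
     (3, \<lambda>z. fst (snd z)), (2, \<lambda>z. \<tau>), (1, \<lambda>z. fst z), (2, \<lambda>z. fst z * fst (snd z))]) (snd (snd z)))" for k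
    by (rule Ck_open_act[OF V _ lin(3)])
      (auto intro!: lin Ck_open_const Ck_open_uminus Ck_open_mult V)
  then have C: "Ck_open k (UNIV \<times> UNIV \<times> frame_cone) C" for k
    by (simp add: C_def[abs_def] commutator_word_def del: act_simps)
  have C0: "C (s, 0, u) = u" "C (0, t, u) = u" if "u \<in> frame_cone" for s t u
    by (simp_all add: C_def act_commutator_word_trivial)
  define Y where "Y u s = (\<chi> k. u $ k * (conjugate_generator \<tau> (flow 1 (- s) u) - conjugate_generator \<tau> u
        + (s * rate_log 1 (conjugate_generator \<tau> (flow 1 (- s) u)) * rate 1 u) *\<^sub>R weight 1
        + (s * rate 2 u) *\<^sub>R weight 2) $ k)" for u :: "real^3" and s :: real
  have Y: "((\<lambda>t. C (s, t, u)) has_vector_derivative Y u s) (at 0)" if "u \<in> frame_cone" for s u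
    using commutator_word_derivative[OF that] by (simp add: C_def Y_def)
  have Z: "(Y u has_vector_derivative hyperbolic_field (commutator_rate \<tau>) u) (at 0)" if "u \<in> frame_cone" for u
  proof -
    have "hyperbolic_field (commutator_rate \<tau>) u = commutator_rate \<tau> (rate 2 u) *\<^sub>R vector [u$1, 0, - u$3]"
      by (simp add: hyperbolic_field_def boost_def vec_eq_iff forall_3)
    then show ?thesis
      unfolding Y_def using commutator_word_second_derivative[OF that] by simp
  qed
  have C1: "Ck_open (Suc 0) (UNIV \<times> frame_cone) (\<lambda>z. C (sqrt (fst z), \<bar>sqrt (fst z)\<bar>, snd z))"
    by (rule square_root_reparametrisation(1)[OF open_cone C C0 Y Z])
  have D: "((\<lambda>r. C (sqrt (fst (r, u)), \<bar>sqrt (fst (r, u))\<bar>, snd (r, u))) has_vector_derivative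
      hyperbolic_field (commutator_rate \<tau>) u) (at 0)" if "u \<in> frame_cone" for u
    by (rule square_root_reparametrisation(2)[OF open_cone C C0 Y Z]) (simp_all add: that)
  show ?thesis unfolding holonomy_velocity_def
  proof (intro exI[of _ "\<lambda>r. commutator_word \<tau> (sqrt r) \<bar>sqrt r\<bar>"] conjI allI ballI)
    show "Ck_open (Suc 0) (UNIV \<times> frame_cone) (\<lambda>z. act (commutator_word \<tau> (sqrt (fst z)) \<bar>sqrt (fst z)\<bar>) (snd z))"
      using C1 by (simp add: C_def del: Ck_open.simps)
    show "((\<lambda>t. act (commutator_word \<tau> (sqrt t) \<bar>sqrt t\<bar>) u) has_vector_derivative hyperbolic_field (commutator_rate \<tau>) u) (at 0)"
      if "u \<in> frame_cone" for u
      using D[OF that] by (simp add: C_def)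
  qed (simp_all add: base_commutator_word act_commutator_word_trivial)
qed

section \<open>An infinite-dimensional abelian Lie algebra of tangent fields\<close>

lemma cone_nonzero: "u \<in> frame_cone \<Longrightarrow> u $ 2 \<noteq> 0"
  by (simp add: frame_cone_def)

lemma Ck_open_hyperbolic_field:
  assumes "\<And>k. Ck_open k UNIV f"
  shows "Ck_open k frame_cone (hyperbolic_field f)"
proof -
  have nth: "Ck_open k frame_cone (\<lambda>u. u $ j)" for j
    by (rule Ck_open_linear[OF bounded_linear_vec_nth open_cone])
  have rate: "Ck_open k frame_cone (rate 2)"
    unfolding rate_def power2_eq_square by (auto intro!: Ck_open_divide Ck_open_mult open_cone nth dest: cone_nonzero)
  have "Ck_open k frame_cone (\<lambda>u. f (rate 2 u))"
    by (rule Ck_open_compose[OF open_cone open_UNIV _ rate assms]) auto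
  then show ?thesis
    unfolding hyperbolic_field_def by (intro Ck_open_vec_lambda Ck_open_mult nth Ck_open_const open_cone)
qed

lemma Ck_open_frame_field:
  assumes "\<And>k. Ck_open k UNIV f"
  shows "Ck_open k (heis_cone x) (\<lambda>y. from_frame (x$1) (hyperbolic_field f (to_frame (x$1) y)))"
  by (rule Ck_open_linear_comp[OF bounded_linear_from_frame open_heis_cone
        Ck_open_compose[OF open_heis_cone open_cone _ Ck_open_linear[OF bounded_linear_to_frame open_heis_cone] Ck_open_hyperbolic_field[OF assms]]])
    (auto simp: heis_cone_iff)

text \<open>The integral curve of a hyperbolic field through a point of the indicatrix. Since \<open>pq\<close> is constant
  along it, it is given by exponentials; it serves both to see that the field is tangent to the
  indicatrix and to evaluate Lie brackets.\<close>
definition hyperbolic_curve :: "(real \<Rightarrow> real) \<Rightarrow> real^3 \<Rightarrow> real^3 \<Rightarrow> real \<Rightarrow> real^3" where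
  "hyperbolic_curve f x y t = from_frame (x$1) (\<chi> k. to_frame (x$1) y $ k * exp (t * (f (rate 2 (to_frame (x$1) y)) * boost k)))"

lemma hyperbolic_curve_frame:
  "rate 2 (to_frame (x$1) (hyperbolic_curve f x y t)) = rate 2 (to_frame (x$1) y)"
  "to_frame (x$1) (hyperbolic_curve f x y t) $ k = to_frame (x$1) y $ k * exp (t * (f (rate 2 (to_frame (x$1) y)) * boost k))"
  by (simp_all add: hyperbolic_curve_def rate_def boost_def flip: exp_add)

lemma hyperbolic_curve_indicatrix:
  assumes "y \<in> bm_indicatrix x"
  shows "hyperbolic_curve f x y t \<in> bm_indicatrix x"
proof -
  have "to_frame (x$1) (hyperbolic_curve f x y t) $ 1 * to_frame (x$1) (hyperbolic_curve f x y t) $ 2 * to_frame (x$1) (hyperbolic_curve f x y t) $ 3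
     = to_frame (x$1) y $ 1 * to_frame (x$1) y $ 2 * to_frame (x$1) y $ 3"
    by (simp add: hyperbolic_curve_frame boost_def exp_minus)
  moreover have "to_frame (x$1) (hyperbolic_curve f x y t) \<in> frame_cone"
    using assms by (simp add: indicatrix_iff hyperbolic_curve_frame frame_cone_def)
  ultimately show ?thesis
    using assms unfolding indicatrix_iff by simp
qed

lemma hyperbolic_curve_has_derivative:
  assumes "y \<in> bm_indicatrix x"
  shows "(hyperbolic_curve f x y has_vector_derivative frame_field x (hyperbolic_field f) y) (at 0)"
proof -
  have "((\<lambda>t. \<chi> k. to_frame (x$1) y $ k * exp (t * (f (rate 2 (to_frame (x$1) y)) * boost k))) has_vector_derivative
     hyperbolic_field f (to_frame (x$1) y)) (at 0)"
    by (rule has_vector_derivative_vecI) (auto intro!: derivative_eq_intros simp: hyperbolic_field_def)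
  from bounded_linear.has_vector_derivative[OF bounded_linear_from_frame this, of "x$1"]
  show ?thesis using assms by (simp add: frame_field_def hyperbolic_curve_def[abs_def])
qed

lemma hyperbolic_curve_smooth: "Ck_open k UNIV (hyperbolic_curve f x y)"
  unfolding hyperbolic_curve_def
  by (intro Ck_open_linear_comp[OF bounded_linear_from_frame] Ck_open_vec_lambda Ck_open_mult Ck_open_exp_comp
      Ck_open_const Ck_open_linear bounded_linear_ident open_UNIV)

lemma frame_field_vector_field:
  assumes "\<And>k. Ck_open k UNIV f"
  shows "frame_field x (hyperbolic_field f) \<in> vector_fields (bm_indicatrix x)"
proof -
  have "smooth_on (bm_indicatrix x) (frame_field x (hyperbolic_field f))"
    by (rule Ck_on_restrict[OF open_heis_cone indicatrix_subset Ck_open_frame_field[OF assms]])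
      (simp add: frame_field_def)
  moreover have "frame_field x (hyperbolic_field f) p \<in> tangent_space (bm_indicatrix x) p" if "p \<in> bm_indicatrix x" for p
  proof -
    have "smooth_on {-1<..<1} (hyperbolic_curve f x p)"
      by (rule Ck_on_restrict[OF open_UNIV _ hyperbolic_curve_smooth]) auto
    moreover have "hyperbolic_curve f x p 0 = p" by (simp add: hyperbolic_curve_def)
    ultimately show ?thesis
      unfolding tangent_space_def using hyperbolic_curve_indicatrix[OF that] hyperbolic_curve_has_derivative[OF that]
      by (intro CollectI exI[of _ 1] conjI exI[of _ "hyperbolic_curve f x p"]) auto
  qed
  ultimately show ?thesis by (simp add: vector_fields_def frame_field_def)
qed

text \<open>A derivative within \<open>N\<close> is not unique, but its value on the velocity of a curve in \<open>N\<close> is.\<close>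
lemma frechet_derivative_within_curve:
  fixes \<gamma> :: "real \<Rightarrow> 'a::euclidean_space" and Y :: "'a \<Rightarrow> 'b::euclidean_space"
  assumes "Y differentiable (at (\<gamma> 0) within N)" "\<And>t. \<gamma> t \<in> N"
    "(\<gamma> has_vector_derivative v) (at 0)" "((\<lambda>t. Y (\<gamma> t)) has_vector_derivative w) (at 0)"
  shows "frechet_derivative Y (at (\<gamma> 0) within N) v = w"
proof -
  define D where "D = frechet_derivative Y (at (\<gamma> 0) within N)"
  have "(Y has_derivative D) (at (\<gamma> 0) within N)"
    using assms(1) by (simp add: D_def frechet_derivative_works)
  then have D: "(Y has_derivative D) (at (\<gamma> 0) within range \<gamma>)"
    by (rule has_derivative_subset) (use assms(2) in auto)
  have "((\<lambda>t. Y (\<gamma> t)) has_derivative (\<lambda>h. D (h *\<^sub>R v))) (at 0)"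
    using has_derivative_in_compose[OF assms(3)[unfolded has_vector_derivative_def] D] .
  then have "((\<lambda>t. Y (\<gamma> t)) has_vector_derivative D v) (at 0)"
    by (simp add: has_vector_derivative_def linear_scale[OF has_derivative_linear[OF D]])
  then show ?thesis using assms(4) vector_derivative_unique_at unfolding D_def by blast
qed

text \<open>Differentiating the field of \<open>g\<close> along an integral curve of the field of \<open>f\<close> gives an expression that is
  symmetric in \<open>f\<close> and \<open>g\<close>, because \<open>g(pq)\<close> is constant on that curve.\<close>
lemma lie_bracket_hyperbolic_fields:
  assumes f: "\<And>k. Ck_open k UNIV f" and g: "\<And>k. Ck_open k UNIV g"
  shows "lie_bracket (bm_indicatrix x) (frame_field x (hyperbolic_field f)) (frame_field x (hyperbolic_field g)) = (\<lambda>p. 0)"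
proof -
  have "frechet_derivative (frame_field x (hyperbolic_field g)) (at p within bm_indicatrix x) (frame_field x (hyperbolic_field f) p)
     = from_frame (x$1) (\<chi> k. to_frame (x$1) p $ k * ((f (rate 2 (to_frame (x$1) p)) * g (rate 2 (to_frame (x$1) p))) * (boost k)\<^sup>2))"
    if p: "p \<in> bm_indicatrix x" and g: "\<And>k. Ck_open k UNIV g" for p f g
  proof -
    define u m where "u = to_frame (x$1) p" and "m = rate 2 u"
    have h0: "hyperbolic_curve f x p 0 = p" by (simp add: hyperbolic_curve_def)
    have "((\<lambda>y. from_frame (x$1) (hyperbolic_field g (to_frame (x$1) y))) differentiable (at p))"
      using Ck_open_frame_field[OF g, of "Suc 0" x] p indicatrix_subset by auto
    then obtain D where "((\<lambda>y. from_frame (x$1) (hyperbolic_field g (to_frame (x$1) y))) has_derivative D) (at p within bm_indicatrix x)"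
      unfolding differentiable_def by (blast intro: has_derivative_at_withinI)
    then have "(frame_field x (hyperbolic_field g) has_derivative D) (at p within bm_indicatrix x)"
      by (rule has_derivative_transform[OF p, rotated]) (simp add: frame_field_def)
    then have "frame_field x (hyperbolic_field g) differentiable (at p within bm_indicatrix x)"
      by (rule differentiableI)
    moreover have "((\<lambda>t. frame_field x (hyperbolic_field g) (hyperbolic_curve f x p t)) has_vector_derivative
        from_frame (x$1) (\<chi> k. u $ k * ((f m * g m) * (boost k)\<^sup>2))) (at 0)"
    proof -
      have "((\<lambda>t. \<chi> k. u $ k * exp (t * (f m * boost k)) * (g m * boost k)) has_vector_derivative
         (\<chi> k. u $ k * ((f m * g m) * (boost k)\<^sup>2))) (at 0)"
        by (rule has_vector_derivative_vecI) (auto intro!: derivative_eq_intros simp: power2_eq_square)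
      from bounded_linear.has_vector_derivative[OF bounded_linear_from_frame this, of "x$1"]
      show ?thesis
        using hyperbolic_curve_indicatrix[OF p]
        by (simp add: frame_field_def hyperbolic_field_def hyperbolic_curve_frame u_def[symmetric] m_def[symmetric])
    qed
    ultimately show ?thesis
      using frechet_derivative_within_curve[of "frame_field x (hyperbolic_field g)" "hyperbolic_curve f x p" "bm_indicatrix x"]
        hyperbolic_curve_indicatrix[OF p] hyperbolic_curve_has_derivative[OF p] 
      by (simp add: h0 u_def m_def)
  qed
  from this[OF _ g] this[OF _ f] show ?thesis
    by (simp add: lie_bracket_def fun_eq_iff mult.commute)
qed

text \<open>Taking all hyperbolic fields that are holonomy velocities, rather than a span of known ones, makes
  closure under addition and scaling a property of holonomy velocities alone.\<close>
definition tangent_algebra :: "real^3 \<Rightarrow> (real^3 \<Rightarrow> real^3) set" where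
  "tangent_algebra x = {frame_field x (hyperbolic_field f) | f. (\<forall>k. Ck_open k UNIV f) \<and> holonomy_velocity (hyperbolic_field f)}"

lemma hyperbolic_field_linear:
  "frame_field x (hyperbolic_field f) + frame_field x (hyperbolic_field g) = frame_field x (hyperbolic_field (\<lambda>m. f m + g m))"
  "(\<lambda>p. c *\<^sub>R frame_field x (hyperbolic_field f) p) = frame_field x (hyperbolic_field (\<lambda>m. c * f m))"
  "frame_field x (hyperbolic_field (\<lambda>m. 0)) = (\<lambda>p. 0)"
proof -
  have "hyperbolic_field (\<lambda>m. f m + g m) u = hyperbolic_field f u + hyperbolic_field g u" "hyperbolic_field (\<lambda>m. c * f m) u = c *\<^sub>R hyperbolic_field f u"
    "hyperbolic_field (\<lambda>m. 0) u = 0" for u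
    by (simp_all add: hyperbolic_field_def vec_eq_iff algebra_simps)
  then show "frame_field x (hyperbolic_field f) + frame_field x (hyperbolic_field g) = frame_field x (hyperbolic_field (\<lambda>m. f m + g m))"
    "(\<lambda>p. c *\<^sub>R frame_field x (hyperbolic_field f) p) = frame_field x (hyperbolic_field (\<lambda>m. c * f m))"
    "frame_field x (hyperbolic_field (\<lambda>m. 0)) = (\<lambda>p. 0)"
    using bounded_linear.linear[OF bounded_linear_from_frame[of "x$1"]]
    by (auto simp: frame_field_def fun_eq_iff linear_add linear_scale linear_0)
qed

lemma lie_subalgebra_tangent_algebra: "lie_subalgebra (bm_indicatrix x) (tangent_algebra x)"
proof -
  have 0: "(\<lambda>p. 0) \<in> tangent_algebra x"
  proof -
    have "hyperbolic_field (\<lambda>m. 0) = (\<lambda>u. 0)" by (simp add: hyperbolic_field_def fun_eq_iff vec_eq_iff)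
    then show ?thesis
      unfolding tangent_algebra_def using holonomy_velocity_zero hyperbolic_field_linear(3)[of x, symmetric]
      by (intro CollectI exI[of _ "\<lambda>m. 0"]) (simp add: Ck_open_const)
  qed
  have "vf.subspace (tangent_algebra x)"
    unfolding vf.subspace_def
  proof (intro conjI ballI allI)
    show "0 \<in> tangent_algebra x" using 0 by (simp add: zero_fun_def)
    fix X Y assume "X \<in> tangent_algebra x" "Y \<in> tangent_algebra x"
    then obtain f g where f: "X = frame_field x (hyperbolic_field f)" "\<And>k. Ck_open k UNIV f" "holonomy_velocity (hyperbolic_field f)"
      and g: "Y = frame_field x (hyperbolic_field g)" "\<And>k. Ck_open k UNIV g" "holonomy_velocity (hyperbolic_field g)"
      unfolding tangent_algebra_def by blast
    have "hyperbolic_field (\<lambda>m. f m + g m) = (\<lambda>u. hyperbolic_field f u + hyperbolic_field g u)"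
      by (simp add: hyperbolic_field_def vec_eq_iff algebra_simps fun_eq_iff)
    then have "holonomy_velocity (hyperbolic_field (\<lambda>m. f m + g m))" using holonomy_velocity_add f g by simp
    then show "X + Y \<in> tangent_algebra x"
      unfolding tangent_algebra_def using f g hyperbolic_field_linear(1)[of x f g]
      by (intro CollectI exI[of _ "\<lambda>m. f m + g m"]) (simp add: Ck_open_add)
  next
    fix c X assume "X \<in> tangent_algebra x"
    then obtain f where f: "X = frame_field x (hyperbolic_field f)" "\<And>k. Ck_open k UNIV f" "holonomy_velocity (hyperbolic_field f)"
      unfolding tangent_algebra_def by blast
    have "hyperbolic_field (\<lambda>m. c * f m) = (\<lambda>u. c *\<^sub>R hyperbolic_field f u)"
      by (simp add: hyperbolic_field_def vec_eq_iff algebra_simps fun_eq_iff)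
    then have "holonomy_velocity (hyperbolic_field (\<lambda>m. c * f m))" using holonomy_velocity_scale f by simp
    then show "(\<lambda>p. c *\<^sub>R X p) \<in> tangent_algebra x"
      unfolding tangent_algebra_def using f hyperbolic_field_linear(2)[of c x f]
      by (intro CollectI exI[of _ "\<lambda>m. c * f m"]) (simp add: Ck_open_mult Ck_open_const)
  qed
  moreover have "lie_bracket (bm_indicatrix x) X Y \<in> tangent_algebra x" if "X \<in> tangent_algebra x" "Y \<in> tangent_algebra x" for X Y
    using that lie_bracket_hyperbolic_fields 0 unfolding tangent_algebra_def by auto
  moreover have "tangent_algebra x \<subseteq> vector_fields (bm_indicatrix x)"
    using frame_field_vector_field unfolding tangent_algebra_def by auto
  ultimately show ?thesis unfolding lie_subalgebra_def by blast
qed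


text \<open>A curve in the indicatrix on which \<open>pq = m\<close>, with frame components \<open>(r\<^sup>2, 1/r, 1/r)\<close> for \<open>m = r\<^sup>3\<close>. Evaluation
  along it recovers the factor \<open>f\<close> of a hyperbolic field.\<close>
definition probe :: "real \<Rightarrow> real \<Rightarrow> real^3" where
  "probe a m = from_frame a (let r = root 3 m in vector [r\<^sup>2, 1/r, 1/r])"

lemma probe:
  assumes "m > 0"
  shows "probe (x$1) m \<in> bm_indicatrix x" "frame_field x (hyperbolic_field f) (probe (x$1) m) $ 1 = f m * (root 3 m)\<^sup>2"
proof -
  define r where "r = root 3 m"
  have r: "r > 0" "r ^ 3 = m" using assms by (simp_all add: r_def)
  define u :: "real^3" where "u = vector [r\<^sup>2, 1/r, 1/r]"
  have m: "rate 2 u = m"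
    using r by (simp add: rate_def u_def power_divide field_simps power2_eq_square power3_eq_cube)
  have w: "probe (x$1) m = from_frame (x$1) u" by (simp add: probe_def u_def r_def Let_def)
  have "u \<in> frame_cone" "u$1 * u$2 * u$3 = 1" using r by (auto simp: frame_cone_def u_def power2_eq_square)
  then show 1: "probe (x$1) m \<in> bm_indicatrix x"
    by (simp add: indicatrix_iff w)
  show "frame_field x (hyperbolic_field f) (probe (x$1) m) $ 1 = f m * (root 3 m)\<^sup>2"
    using 1 by (simp add: frame_field_def w hyperbolic_field_def m) (simp add: from_frame_def u_def r_def boost_def)
qed

text \<open>The quotient is a polynomial in \<open>1/m\<close> with constant term \<open>- 9/16 j\<^sup>2\<close> times \<open>exp (- (n - j) m / 2)\<close>, up to
  a term that vanishes at infinity.\<close>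
lemma commutator_rate_growth:
  assumes "0 < n" "j \<le> n"
  shows "((\<lambda>m. commutator_rate j m / (m^3 * exp (n * m / 2))) \<longlongrightarrow> (if j = n then - 9/16 * n\<^sup>2 else 0)) at_top"
proof -
  have inv: "((\<lambda>m::real. 1 / m) \<longlongrightarrow> 0) at_top"
    using tendsto_inverse_0_at_top[OF filterlim_ident] by (simp add: inverse_eq_divide)
  have E: "((\<lambda>m. exp (- (c * m))) \<longlongrightarrow> 0) at_top" if "c > 0" for c :: real
  proof (rule filterlim_compose[OF exp_at_bot])
    show "filterlim (\<lambda>m. - (c * m)) at_bot at_top"
      unfolding filterlim_uminus_at_bot
      using filterlim_tendsto_pos_mult_at_top[OF tendsto_const that filterlim_ident] by simp
  qed
  have e: "((\<lambda>m. exp (- ((n - j) / 2 * m))) \<longlongrightarrow> (if j = n then 1 else 0)) at_top"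
    using E[of "(n - j) / 2"] assms by (cases "j = n") auto
  have "((\<lambda>m. - 9/16 * exp (- ((n - j) / 2 * m)) * (4 * (1/m)\<^sup>2 + 6 * j * (1/m) + j\<^sup>2)
      - 1/2 * (1/m)\<^sup>2 * exp (- (n / 2 * m))) \<longlongrightarrow>
     - 9/16 * (if j = n then 1 else 0) * (4 * 0\<^sup>2 + 6 * j * 0 + j\<^sup>2) - 1/2 * 0\<^sup>2 * 0) at_top"
    by (intro tendsto_intros inv e E) (use assms in auto)
  moreover have "eventually (\<lambda>m. - 9/16 * exp (- ((n - j) / 2 * m)) * (4 * (1/m)\<^sup>2 + 6 * j * (1/m) + j\<^sup>2)
      - 1/2 * (1/m)\<^sup>2 * exp (- (n / 2 * m)) = commutator_rate j m / (m^3 * exp (n * m / 2))) at_top"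
    using eventually_gt_at_top[of 0]
  proof eventually_elim
    case (elim m)
    have "exp (j * m / 2) = exp (- ((n - j) / 2 * m)) * exp (n * m / 2)"
      by (simp add: field_simps flip: exp_add)
    moreover have "exp (- (n / 2 * m)) = 1 / exp (n * m / 2)"
      by (simp add: exp_minus field_simps)
    ultimately show ?case
      using elim by (simp add: commutator_rate_def) (simp add: field_simps power2_eq_square power3_eq_cube)
  qed
  ultimately have "((\<lambda>m. commutator_rate j m / (m^3 * exp (n * m / 2))) \<longlongrightarrow>
     - 9/16 * (if j = n then 1 else 0) * (4 * 0\<^sup>2 + 6 * j * 0 + j\<^sup>2) - 1/2 * 0\<^sup>2 * 0) at_top"
    by (rule Lim_transform_eventually)
  then show ?thesis by (cases "j = n") auto
qed

lemma Ck_open_commutator_rate: "Ck_open k UNIV (commutator_rate \<tau>)"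
proof -
  have id: "Ck_open k UNIV (\<lambda>m::real. m)" by (rule Ck_open_linear[OF bounded_linear_ident open_UNIV])
  have "Ck_open k UNIV (\<lambda>m::real. (- (9/16) * m) * exp (\<tau>/2 * m) * ((4 + (6 * \<tau>) * m) + \<tau>\<^sup>2 * (m * m)) + (- 1/2) * m)"
    by (intro Ck_open_add Ck_open_mult Ck_open_exp_comp Ck_open_const id open_UNIV)
  then show ?thesis by (simp add: commutator_rate_def[abs_def] power2_eq_square)
qed

text \<open>The field for \<open>\<tau> = n + 1\<close> outgrows every linear combination of those for \<open>\<tau> = 1, ..., n\<close>, so the fields
  for \<open>\<tau> = 1, ..., n\<close> are linearly independent for every \<open>n\<close>.\<close>
lemma infinite_dimensional_tangent_algebra: "infinite_dimensional (tangent_algebra x)"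
proof -
  define X where "X n = frame_field x (hyperbolic_field (commutator_rate (real n)))" for n :: nat
  have X_in: "X n \<in> tangent_algebra x" for n
    unfolding X_def tangent_algebra_def using holonomy_velocity_commutator Ck_open_commutator_rate by blast
  define q where "q n Y m = Y (probe (x$1) m) $ 1 / ((root 3 m)\<^sup>2 * (m^3 * exp (real n * m / 2)))"
    for n :: nat and Y :: "real^3 \<Rightarrow> real^3" and m
  have qX: "(q n (X j) \<longlongrightarrow> (if j = n then - 9/16 * (real n)\<^sup>2 else 0)) at_top" if "0 < n" "j \<le> n" for n j
  proof (rule Lim_transform_eventually)
    show "((\<lambda>m. commutator_rate (real j) m / (m^3 * exp (real n * m / 2))) \<longlongrightarrow> (if j = n then - 9/16 * (real n)\<^sup>2 else 0)) at_top"
      using commutator_rate_growth[of "real n" "real j"] that by simp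
    show "eventually (\<lambda>m. commutator_rate (real j) m / (m^3 * exp (real n * m / 2)) = q n (X j) m) at_top"
      using eventually_gt_at_top[of 0] by eventually_elim (simp add: q_def X_def probe)
  qed
  have notin: "X (Suc n) \<notin> vf.span (X ` {1..n})" for n
  proof
    assume "X (Suc n) \<in> vf.span (X ` {1..n})"
    then have "(q (Suc n) (X (Suc n)) \<longlongrightarrow> 0) at_top"
    proof (induction rule: vf.span_induct_alt)
      case base
      then show ?case by (simp add: q_def[abs_def])
    next
      case (step c Y Z)
      then obtain j where "Y = X j" "j \<le> n" by auto
      then have "(q (Suc n) Y \<longlongrightarrow> 0) at_top" using qX[of "Suc n" j] by simp
      then have "((\<lambda>m. c * q (Suc n) Y m + q (Suc n) Z m) \<longlongrightarrow> c * 0 + 0) at_top"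
        by (intro tendsto_intros step)
      then show ?case by (simp add: q_def[abs_def] add_divide_distrib)
    qed
    with qX[of "Suc n" "Suc n"] have "- 9/16 * (real (Suc n))\<^sup>2 = 0"
      by (intro tendsto_unique[of at_top "q (Suc n) (X (Suc n))"]) auto
    then show False by simp
  qed
  have indep: "vf.independent (X ` {1..n}) \<and> card (X ` {1..n}) = n" for n
  proof (induction n)
    case 0
    then show ?case by (simp add: vf.independent_empty)
  next
    case (Suc n)
    have "{1..Suc n} = insert (Suc n) {1..n}" by auto
    moreover have "X (Suc n) \<notin> X ` {1..n}" using notin[of n] vf.span_base by blast
    ultimately show ?case using Suc notin[of n] by (simp add: vf.independent_insertI)
  qed
  show ?thesis unfolding infinite_dimensional_def
  proof safe
    fix B assume B: "finite B" "tangent_algebra x \<subseteq> vf.span B"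
    have "X ` {1..Suc (card B)} \<subseteq> vf.span B" using X_in B by auto
    with vf.independent_span_bound[OF B(1)] indep[of "Suc (card B)"] show False
      by fastforce
  qed
qed

theorem corollary19:
  fixes x :: "real^3"
  shows "\<exists>L. lie_subalgebra (indicatrix heis_cone berwald_moor x) L \<and>
             infinite_dimensional L \<and>
             (\<forall>X\<in>L. tangent_to (indicatrix heis_cone berwald_moor x)
                       (holonomy heis_cone berwald_moor x) X)"
proof (intro exI conjI ballI)
  show "lie_subalgebra (bm_indicatrix x) (tangent_algebra x)" by (rule lie_subalgebra_tangent_algebra)
  show "infinite_dimensional (tangent_algebra x)" by (rule infinite_dimensional_tangent_algebra)
  fix X assume "X \<in> tangent_algebra x"
  then show "tangent_to (bm_indicatrix x) (holonomy heis_cone berwald_moor x) X"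
    unfolding tangent_algebra_def using holonomy_velocity_tangent_to by auto
qed

end
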